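(* Let $d\in\mathbb{N}$, $\mu_1,\mu_2\in\mathbb{R}$, $\mu:=\frac{\mu_1(2-\mu_1)}{4}+\mu_2$, and let $r\in[1,2)$ be such that $\alpha=\alpha(r,\mu)<1$. Then there is a constant $C>0$, independent of time and of the initial data, such that the following holds. Let $(u_0,u_1)\in\Sigma^r$ and let $u$ be the solution of $$\partial_t^2u-\Delta u+\frac{\mu_1}{1+t}\partial_tu+\frac{\mu_2}{(1+t)^2}u=0\ \text{ in }(0,\infty)\times\mathbb{R}^d,\qquad (u(0),\partial_tu(0))=(u_0,u_1).$$ Set $(v_0,v_1):=(u_0,\tfrac{\mu_1}{2}u_0+u_1)$ and $$\Theta(t):=\begin{cases}(1+t)^{-1-\frac{\mu_1}{2}}\{1+\log(1+t)\}^{\delta} & \text{if }\alpha<0,\text{ or }\alpha=0\text{ and }r>1,\\ (1+t)^{-1-\frac{\mu_1}{2}}\{1+\log(1+t)\}^{\frac12+\delta} & \text{if }\alpha=0\text{ and }r=1,\\ (1+t)^{\alpha-1-\frac{\mu_1}{2}}\{1+\log(1+t)\}^{\delta} & \text{if }\alpha\in(0,1).\end{cases}$$ Then there exists $\overrightarrow{v_+}\in\dot H^1(\mathbb{R}^d)\times L^2(\mathbb{R}^d)$ such that for all $t\ge0$ $$\|u(t)-(1+t)^{-\frac{\mu_1}{2}}(\mathcal{W}(t)\overrightarrow{v_+})_1\|_{\dot H^1}\le C|\mu|\,\|(v_0,v_1)\|_{\Sigma^r}\,\Theta(t)$$ and $$\|\partial_tu(t)-(1+t)^{-\frac{\mu_1}{2}}(\mathcal{W}(t)\overrightarrow{v_+})_2\|_{L^2}\le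 C(|\mu|+|\mu_1|)\,\|(v_0,v_1)\|_{\Sigma^r}\,\Theta(t).$$
   Context: Notation. For $\mu\in\mathbb{R}$ set $\nu:=\frac12\sqrt{1-4\mu}$ if $\mu\le 1/4$ and $\nu:=\frac{i}{2}\sqrt{4\mu-1}$ if $\mu>1/4$ (so $\operatorname{Re}\nu=0$ for $\mu\geq 1/4$). For $1\le r<2$ set $\alpha=\alpha(r,\mu):=\frac12+\operatorname{Re}\nu-\frac{d(2-r)}{2r}$. Set $\delta:=1$ if $\mu=1/4$ and $\delta:=0$ if $\mu\ne1/4$. $\Sigma^r:=(H^1(\mathbb{R}^d)\cap L^r(\mathbb{R}^d))\times(L^2(\mathbb{R}^d)\cap L^r(\mathbb{R}^d))$, with the natural norm $\|(f,g)\|_{\Sigma^r}=\|f\|_{H^1}+\|f\|_{L^r}+\|g\|_{L^2}+\|g\|_{L^r}$. $\dot H^1(\mathbb{R}^d)$ is the (complete) homogeneous Sobolev space with norm $\|f\|_{\dot H^1}=\||\xi|\widehat f\,\|_{L^2}$. $\mathcal{W}(t)$ is the solution map of the free wave equation: $\mathcal{W}(t)(f,g)=\big(\cos(t|\nabla|)f+|\nabla|^{-1}\sin(t|\nabla|)g,\ -|\nabla|\sin(t|\nabla|)f+\cos(t|\nabla|)g\big)$, where functions of $|\nabla|$ are Fourier multipliers in $|\xi|$; $(\mathcal{W}(t)\overrightarrow{v_+})_j$ is its $j$-th component, $j=1,2$. "The solution" is the unique solution in $C([0,\infty);H^1)\cap C^1([0,\infty);L^2)$; equivalently, for a.e. $\xi$,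 $\widehat u(\cdot,\xi)$ solves the corresponding second-order ODE in $t$ (with $-\Delta$ replaced by $|\xi|^2$) with data $(\widehat u_0(\xi),\widehat u_1(\xi))$. *)

theory Defs
  imports "HOL-Analysis.Analysis"
begin

definition Lp :: "real \<Rightarrow> ('a::euclidean_space \<Rightarrow> complex) set" where
  "Lp p = {f. f \<in> borel_measurable lborel \<and> integrable lborel (\<lambda>x. norm (f x) powr p)}"

definition Lp_norm :: "real \<Rightarrow> ('a::euclidean_space \<Rightarrow> complex) \<Rightarrow> real" where
  "Lp_norm p f = (LINT x|lborel. norm (f x) powr p) powr (1 / p)"

text \<open>The Fourier transform is the unitary one with kernel \<open>exp (-i x \<bullet> \<xi>)\<close>, so that \<open>-\<Delta>\<close> becomes
  \<open>\<bar>\<xi>\<bar>\<^sup>2\<close>. On \<open>L\<^sup>2\<close> it is defined as the \<open>L\<^sup>2\<close>-limit of the transforms of the truncations of \<open>f\<close>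
  to balls (which are integrable), and is determined up to null sets.\<close>

definition fourier_trunc :: "real \<Rightarrow> ('a::euclidean_space \<Rightarrow> complex) \<Rightarrow> 'a \<Rightarrow> complex" where
  "fourier_trunc R f \<xi> =
     complex_of_real ((2 * pi) powr (- real DIM('a) / 2)) *
     (LINT x:cball 0 R|lborel. cis (- (x \<bullet> \<xi>)) * f x)"

definition has_fourier ::
    "('a::euclidean_space \<Rightarrow> complex) \<Rightarrow> ('a \<Rightarrow> complex) \<Rightarrow> bool" where
  "has_fourier f F \<longleftrightarrow> f \<in> Lp 2 \<and> F \<in> Lp 2 \<and>
     ((\<lambda>R. Lp_norm 2 (\<lambda>\<xi>. F \<xi> - fourier_trunc R f \<xi>)) \<longlongrightarrow> 0) at_top"

definition fourier :: "('a::euclidean_space \<Rightarrow> complex) \<Rightarrow> 'a \<Rightarrow> complex" where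
  "fourier f = (SOME F. has_fourier f F)"

definition inv_fourier :: "('a::euclidean_space \<Rightarrow> complex) \<Rightarrow> 'a \<Rightarrow> complex" where
  "inv_fourier F = (SOME f. has_fourier f F)"

definition H1 :: "('a::euclidean_space \<Rightarrow> complex) set" where
  "H1 = {f \<in> Lp 2. (\<lambda>\<xi>. complex_of_real (sqrt (1 + (norm \<xi>)\<^sup>2)) * fourier f \<xi>) \<in> Lp 2}"

definition H1_norm :: "('a::euclidean_space \<Rightarrow> complex) \<Rightarrow> real" where
  "H1_norm f = Lp_norm 2 (\<lambda>\<xi>. complex_of_real (sqrt (1 + (norm \<xi>)\<^sup>2)) * fourier f \<xi>)"

text \<open>In dimensions 1 and 2 the complete homogeneous Sobolev space is not a space of functions of
  \<open>x\<close>. In every dimension it is isometric, via the Fourier transform, to the weighted \<open>L\<^sup>2\<close>-space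
  below, and its elements are represented here by their Fourier transforms: an \<open>f \<in> H1\<close> is
  regarded as the element \<open>fourier f\<close> of \<open>Hdot1\<close>.\<close>

definition Hdot1 :: "('a::euclidean_space \<Rightarrow> complex) set" where
  "Hdot1 = {F. (\<lambda>\<xi>. complex_of_real (norm \<xi>) * F \<xi>) \<in> Lp 2}"

definition Hdot1_norm :: "('a::euclidean_space \<Rightarrow> complex) \<Rightarrow> real" where
  "Hdot1_norm F = Lp_norm 2 (\<lambda>\<xi>. complex_of_real (norm \<xi>) * F \<xi>)"

definition data_space ::
    "real \<Rightarrow> (('a::euclidean_space \<Rightarrow> complex) \<times> ('a \<Rightarrow> complex)) set" where
  "data_space r = (H1 \<inter> Lp r) \<times> (Lp 2 \<inter> Lp r)"

definition data_norm ::
    "real \<Rightarrow> ('a::euclidean_space \<Rightarrow> complex) \<times> ('a \<Rightarrow> complex) \<Rightarrow> real" where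
  "data_norm r = (\<lambda>(f, g). H1_norm f + Lp_norm r f + Lp_norm 2 g + Lp_norm r g)"

text \<open>The solution map of the free wave equation on \<open>Hdot1 \<times> Lp 2\<close>. First components are given by
  their Fourier transforms (see \<open>Hdot1\<close>), second components are functions of \<open>x\<close>. The quotient
  by \<open>norm \<xi>\<close> is undefined only on the null set \<open>\<xi> = 0\<close>.\<close>

definition wave_flow ::
    "real \<Rightarrow> ('a::euclidean_space \<Rightarrow> complex) \<times> ('a \<Rightarrow> complex) \<Rightarrow>
       ('a \<Rightarrow> complex) \<times> ('a \<Rightarrow> complex)" where
  "wave_flow t = (\<lambda>(F, g).
     (\<lambda>\<xi>. complex_of_real (cos (t * norm \<xi>)) * F \<xi>
           + complex_of_real (sin (t * norm \<xi>) / norm \<xi>) * fourier g \<xi>,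
      inv_fourier (\<lambda>\<xi>. - complex_of_real (norm \<xi> * sin (t * norm \<xi>)) * F \<xi>
           + complex_of_real (cos (t * norm \<xi>)) * fourier g \<xi>)))"

text \<open>\<open>u \<in> C([0,\<infinity>); H1)\<close>, and \<open>u \<in> C\<^sup>1([0,\<infinity>); L\<^sup>2)\<close> with time derivative \<open>u'\<close>.\<close>

definition cont_H1 :: "(real \<Rightarrow> 'a::euclidean_space \<Rightarrow> complex) \<Rightarrow> bool" where
  "cont_H1 u \<longleftrightarrow> (\<forall>t\<ge>0. u t \<in> H1 \<and>
     ((\<lambda>s. H1_norm (\<lambda>x. u s x - u t x)) \<longlongrightarrow> 0) (at t within {0..}))"

definition C1_L2 ::
    "(real \<Rightarrow> 'a::euclidean_space \<Rightarrow> complex) \<Rightarrow> (real \<Rightarrow> 'a \<Rightarrow> complex) \<Rightarrow> bool" where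
  "C1_L2 u u' \<longleftrightarrow> (\<forall>t\<ge>0. u t \<in> Lp 2 \<and> u' t \<in> Lp 2 \<and>
     ((\<lambda>s. Lp_norm 2 (\<lambda>x. (u s x - u t x) / complex_of_real (s - t) - u' t x)) \<longlongrightarrow> 0)
       (at t within {0..}) \<and>
     ((\<lambda>s. Lp_norm 2 (\<lambda>x. u' s x - u' t x)) \<longlongrightarrow> 0) (at t within {0..}))"

text \<open>The solution \<open>u\<close>, with time derivative \<open>u'\<close>, of
  \<open>u\<^sub>t\<^sub>t - \<Delta> u + \<mu>\<^sub>1/(1+t) u\<^sub>t + \<mu>\<^sub>2/(1+t)\<^sup>2 u = 0\<close> with data \<open>(u0, u1)\<close>. The equation is imposed on the
  Fourier side, for almost every \<open>\<xi>\<close>. As each \<open>fourier (u t)\<close> is only determined up to a null set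
  depending on \<open>t\<close>, the equation is required of one family \<open>U\<close> of versions of these transforms.\<close>

definition wave_solution ::
    "real \<Rightarrow> real \<Rightarrow> ('a::euclidean_space \<Rightarrow> complex) \<Rightarrow> ('a \<Rightarrow> complex) \<Rightarrow>
       (real \<Rightarrow> 'a \<Rightarrow> complex) \<Rightarrow> (real \<Rightarrow> 'a \<Rightarrow> complex) \<Rightarrow> bool" where
  "wave_solution \<mu>1 \<mu>2 u0 u1 u u' \<longleftrightarrow>
     cont_H1 u \<and> C1_L2 u u' \<and>
     (AE x in lborel. u 0 x = u0 x) \<and> (AE x in lborel. u' 0 x = u1 x) \<and>
     (\<exists>U U'. (\<forall>t\<ge>0. AE \<xi> in lborel. U t \<xi> = fourier (u t) \<xi>) \<and>
       (AE \<xi> in lborel. U 0 \<xi> = fourier u0 \<xi> \<and> U' 0 \<xi> = fourier u1 \<xi> \<and>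
         (\<forall>t\<ge>0.
           ((\<lambda>s. U s \<xi>) has_vector_derivative U' t \<xi>) (at t within {0..}) \<and>
           ((\<lambda>s. U' s \<xi>) has_vector_derivative
              - ((norm \<xi>)\<^sup>2 *\<^sub>R U t \<xi>) - (\<mu>1 / (1 + t)) *\<^sub>R U' t \<xi> - (\<mu>2 / (1 + t)\<^sup>2) *\<^sub>R U t \<xi>)
              (at t within {0..}))))"

definition nu :: "real \<Rightarrow> complex" where
  "nu \<mu> = (if \<mu> \<le> 1/4 then complex_of_real (sqrt (1 - 4 * \<mu>)) / 2
           else \<i> / 2 * complex_of_real (sqrt (4 * \<mu> - 1)))"

definition alpha :: "nat \<Rightarrow> real \<Rightarrow> real \<Rightarrow> real" where
  "alpha d r \<mu> = 1/2 + Re (nu \<mu>) - real d * (2 - r) / (2 * r)"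

definition delta :: "real \<Rightarrow> real" where
  "delta \<mu> = (if \<mu> = 1/4 then 1 else 0)"

text \<open>The decay rate; it is only meaningful for \<open>alpha d r \<mu> < 1\<close>.\<close>

definition Theta :: "nat \<Rightarrow> real \<Rightarrow> real \<Rightarrow> real \<Rightarrow> real \<Rightarrow> real" where
  "Theta d r \<mu>1 \<mu> t =
     (let \<alpha> = alpha d r \<mu>; \<delta> = delta \<mu> in
      if \<alpha> < 0 \<or> \<alpha> = 0 \<and> r > 1 then
        (1 + t) powr (- 1 - \<mu>1 / 2) * (1 + ln (1 + t)) powr \<delta>
      else if \<alpha> = 0 then
        (1 + t) powr (- 1 - \<mu>1 / 2) * (1 + ln (1 + t)) powr (1/2 + \<delta>)
      else
        (1 + t) powr (\<alpha> - 1 - \<mu>1 / 2) * (1 + ln (1 + t)) powr \<delta>)"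

end

theory Submission
  imports Defs "HOL-Probability.Probability"
begin

text \<open>Liouville's substitution \<open>v = (1 + t) powr (\<mu>\<^sub>1/2) u\<close> turns the equation into
  \<open>v\<^sub>t\<^sub>t - \<Delta>v + \<mu> v / (1 + t)\<^sup>2 = 0\<close>, a free wave equation with forcing \<open>- \<mu> v / (1 + t)\<^sup>2\<close>. By Cook's
  method the free wave that osculates \<open>v\<close> at time \<open>t\<close> converges as \<open>t \<rightarrow> \<infinity>\<close>, with error at most
  \<open>\<bar>\<mu>\<bar>\<close> times the integral of \<open>\<parallel>v(s)\<parallel> / (1 + s)\<^sup>2\<close> over \<open>s \<ge> t\<close>, where \<open>\<parallel>\<cdot>\<parallel>\<close> is the \<open>L\<^sup>2\<close>-norm, so it
  suffices to bound \<open>\<parallel>v(s)\<parallel>\<close>.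
  For each frequency \<open>\<xi>\<close> the mode is compared with Euler's equation \<open>V'' + \<mu> V / (1 + t)\<^sup>2 = 0\<close> as long
  as \<open>\<bar>\<xi>\<bar> (1 + t) \<le> 1\<close>, and its energy is essentially conserved afterwards. This bounds it by the
  data times \<open>(1 + log (1 + t)) powr \<delta>\<close> times \<open>min (1 + t) (max 1 (1 / \<bar>\<xi>\<bar>)) powr (1/2 + Re \<nu>)\<close>. The
  low frequencies of the data are controlled by their \<open>L\<^sup>r\<close>-norm, shell by dyadic shell.\<close>


subsection \<open>The space of square integrable functions\<close>

text \<open>The exponent \<open>b = 1/2 + Re nu\<close> is the largest real part of a root of
  \<open>beta (1 - beta) = mu\<close>; \<open>delta\<close> marks the double root, which brings a
  logarithm. Apart from it, a mode grows at most like \<open>(1+t)^b\<close> until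
  \<open>1 + t = 1/|xi|\<close>, then stops growing. At this time both comparisons cost only a
  constant: before it the term \<open>rho^2 V\<close> perturbs with relative size 1/4, after it the
  energy gains at most a factor \<open>exp |mu|\<close>. On the ball \<open>|xi| <= 1/s\<close> the
  data have energy of order \<open>s^(-d(2-r)/r)\<close>, so for alpha > 0 the norm of
  \<open>v(s)\<close> grows like \<open>s^alpha\<close>, and the integral of
  \<open>s^(alpha-2)\<close> converges since alpha < 1. Two obstacles shape the rest.
  \<open>fourier\<close> is a choice of an L^2 limit of truncated integrals, so Plancherel's theorem
  and surjectivity have to be derived from that definition. And the equation is known for a family
  of versions that agree with \<open>fourier (u t)\<close> only off a null set depending on
  \<open>t\<close>; hence L^2 statements are made at single times or along sequences of times, and
  no integral over time is ever formed.\<close>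

lemma Lp2_iff:
  fixes f :: "'a::euclidean_space \<Rightarrow> complex"
  shows "f \<in> Lp 2 \<longleftrightarrow> f \<in> borel_measurable lborel \<and> integrable lborel (\<lambda>x. (norm (f x))\<^sup>2)"
  by (simp add: Lp_def powr_numeral)

lemma Lp_norm2_eq:
  fixes f :: "'a::euclidean_space \<Rightarrow> complex"
  shows "Lp_norm 2 f = sqrt (LINT x|lborel. (norm (f x))\<^sup>2)"
  by (simp add: Lp_norm_def powr_numeral powr_half_sqrt)

lemma Lp_norm_nonneg [simp]: "0 \<le> Lp_norm p f"
  by (simp add: Lp_norm_def)

lemma Lp_norm2_power2:
  fixes f :: "'a::euclidean_space \<Rightarrow> complex"
  shows "(Lp_norm 2 f)\<^sup>2 = (LINT x|lborel. (norm (f x))\<^sup>2)"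
  by (simp add: Lp_norm2_eq)

lemma Lp_measurable [measurable_dest]: "f \<in> Lp p \<Longrightarrow> f \<in> borel_measurable borel"
  by (simp add: Lp_def)

lemma nn_integral_Lp2:
  fixes f :: "'a::euclidean_space \<Rightarrow> complex"
  assumes "f \<in> Lp 2"
  shows "(\<integral>\<^sup>+x. ennreal ((norm (f x))\<^sup>2) \<partial>lborel) = ennreal ((Lp_norm 2 f)\<^sup>2)"
  using assms unfolding Lp_norm2_power2 Lp2_iff by (intro nn_integral_eq_integral) auto

text \<open>The nonnegative integral makes sense for every measurable function, so one estimate of
  it yields integrability and the norm bound together.\<close>

lemma Lp2_boundI:
  fixes f :: "'a::euclidean_space \<Rightarrow> complex"
  assumes [measurable]: "f \<in> borel_measurable borel"
    and le: "(\<integral>\<^sup>+x. ennreal ((norm (f x))\<^sup>2) \<partial>lborel) \<le> ennreal (c\<^sup>2)" and c: "0 \<le> c"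
  shows "f \<in> Lp 2" "Lp_norm 2 f \<le> c"
proof -
  have "integrable lborel (\<lambda>x. (norm (f x))\<^sup>2)"
    by (rule integrableI_bounded) (use le in \<open>auto simp: le_less_trans\<close>)
  then show f: "f \<in> Lp 2" by (simp add: Lp2_iff)
  have "(Lp_norm 2 f)\<^sup>2 \<le> c\<^sup>2"
    using le nn_integral_Lp2[OF f] by (simp add: ennreal_le_iff)
  then show "Lp_norm 2 f \<le> c" using c by (rule power2_le_imp_le)
qed

lemma Lp2_cong_AE:
  fixes f g :: "'a::euclidean_space \<Rightarrow> complex"
  assumes "f \<in> Lp 2" "g \<in> borel_measurable borel" "AE x in lborel. f x = g x"
  shows "g \<in> Lp 2"
  using assms unfolding Lp2_iff
  by (auto elim!: integrable_cong_AE_imp simp: eq_commute)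

lemma Lp_norm2_cong_AE:
  fixes f g :: "'a::euclidean_space \<Rightarrow> complex"
  assumes [measurable]: "f \<in> borel_measurable borel" "g \<in> borel_measurable borel"
    and "AE x in lborel. f x = g x"
  shows "Lp_norm 2 f = Lp_norm 2 g"
  unfolding Lp_norm2_eq using assms(3) by (auto intro!: arg_cong[where f=sqrt] integral_cong_AE)

lemma Lp2_mono:
  fixes f g :: "'a::euclidean_space \<Rightarrow> complex"
  assumes "g \<in> Lp 2" and [measurable]: "f \<in> borel_measurable borel"
    and le: "AE x in lborel. norm (f x) \<le> norm (g x)"
  shows "f \<in> Lp 2" "Lp_norm 2 f \<le> Lp_norm 2 g"
proof -
  have "(\<integral>\<^sup>+x. ennreal ((norm (f x))\<^sup>2) \<partial>lborel) \<le> (\<integral>\<^sup>+x. ennreal ((norm (g x))\<^sup>2) \<partial>lborel)"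
    using le by (intro nn_integral_mono_AE) (auto intro!: ennreal_leI power_mono)
  then have *: "(\<integral>\<^sup>+x. ennreal ((norm (f x))\<^sup>2) \<partial>lborel) \<le> ennreal ((Lp_norm 2 g)\<^sup>2)"
    using nn_integral_Lp2[OF assms(1)] by simp
  show "f \<in> Lp 2" "Lp_norm 2 f \<le> Lp_norm 2 g" by (rule Lp2_boundI[OF _ *]; simp)+
qed

lemma Lp2_cmult:
  fixes f :: "'a::euclidean_space \<Rightarrow> complex"
  assumes "f \<in> Lp 2"
  shows "(\<lambda>x. c * f x) \<in> Lp 2"
  using assms by (auto simp: Lp2_iff norm_mult power_mult_distrib)

lemma Lp_norm2_cmult:
  fixes f :: "'a::euclidean_space \<Rightarrow> complex"
  shows "Lp_norm 2 (\<lambda>x. c * f x) = norm c * Lp_norm 2 f"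
  by (simp add: Lp_norm2_eq norm_mult power_mult_distrib real_sqrt_mult)

lemma Lp2_add:
  fixes f g :: "'a::euclidean_space \<Rightarrow> complex"
  assumes f: "f \<in> Lp 2" and g: "g \<in> Lp 2"
  shows "(\<lambda>x. f x + g x) \<in> Lp 2"
  unfolding Lp2_iff
proof
  note [measurable] = Lp_measurable[OF f] Lp_measurable[OF g]
  show "(\<lambda>x. f x + g x) \<in> borel_measurable lborel" by simp
  show "integrable lborel (\<lambda>x. (norm (f x + g x))\<^sup>2)"
  proof (rule Bochner_Integration.integrable_bound)
    show "integrable lborel (\<lambda>x. 2 * (norm (f x))\<^sup>2 + 2 * (norm (g x))\<^sup>2)"
      using f g by (simp add: Lp2_iff)
    have "(norm (f x + g x))\<^sup>2 \<le> 2 * (norm (f x))\<^sup>2 + 2 * (norm (g x))\<^sup>2" for x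
    proof -
      have "(norm (f x + g x))\<^sup>2 \<le> (norm (f x) + norm (g x))\<^sup>2"
        by (intro power_mono norm_triangle_ineq) auto
      then show ?thesis using sum_squares_bound[of "norm (f x)" "norm (g x)"]
        by (simp add: power2_sum)
    qed
    then show "AE x in lborel. norm ((norm (f x + g x))\<^sup>2)
        \<le> norm (2 * (norm (f x))\<^sup>2 + 2 * (norm (g x))\<^sup>2)"
      by simp
  qed simp
qed

lemma Lp2_diff:
  fixes f g :: "'a::euclidean_space \<Rightarrow> complex"
  assumes f: "f \<in> Lp 2" and g: "g \<in> Lp 2"
  shows "(\<lambda>x. f x - g x) \<in> Lp 2"
  using Lp2_add[OF f Lp2_cmult[OF g, of "-1"]] by simp

lemma Lp_norm2_minus_commute:
  fixes f g :: "'a::euclidean_space \<Rightarrow> complex"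
  shows "Lp_norm 2 (\<lambda>x. f x - g x) = Lp_norm 2 (\<lambda>x. g x - f x)"
  by (simp add: Lp_norm2_eq norm_minus_commute)

text \<open>Pointwise \<open>2ab <= eta a^2 + b^2/eta\<close> is integrated and \<open>eta\<close>
  is optimised afterwards; the weight 1 already gives integrability.\<close>

lemma Lp2_Cauchy_Schwarz:
  fixes f g :: "'a::euclidean_space \<Rightarrow> complex"
  assumes f: "f \<in> Lp 2" and g: "g \<in> Lp 2"
  shows "integrable lborel (\<lambda>x. norm (f x) * norm (g x))"
    and "(LINT x|lborel. norm (f x) * norm (g x)) \<le> Lp_norm 2 f * Lp_norm 2 g"
proof -
  note [measurable] = Lp_measurable[OF f] Lp_measurable[OF g]
  have fi: "integrable lborel (\<lambda>x. (norm (f x))\<^sup>2)" and gi: "integrable lborel (\<lambda>x. (norm (g x))\<^sup>2)"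
    using f g by (auto simp: Lp2_iff)
  have amgm: "norm (f x) * norm (g x) \<le> (\<eta> * (norm (f x))\<^sup>2 + (norm (g x))\<^sup>2 / \<eta>) / 2"
    if "\<eta> > 0" for \<eta> x
  proof -
    have "0 \<le> (\<eta> * norm (f x) - norm (g x))\<^sup>2 / \<eta>" using that by simp
    then show ?thesis using that by (simp add: power2_eq_square field_simps)
  qed
  show i: "integrable lborel (\<lambda>x. norm (f x) * norm (g x))"
  proof (rule Bochner_Integration.integrable_bound)
    show "integrable lborel (\<lambda>x. (1 * (norm (f x))\<^sup>2 + (norm (g x))\<^sup>2 / 1) / 2)"
      using fi gi by simp
  qed (use amgm[of 1] in auto)
  \<comment> \<open>The optimal \<open>eta\<close> is a quotient of the two norms, so vanishing
    norms are treated apart; there the product is zero almost everywhere.\<close>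
  consider "Lp_norm 2 f = 0" | "Lp_norm 2 g = 0" | "Lp_norm 2 f > 0" "Lp_norm 2 g > 0"
    using Lp_norm_nonneg[of 2 f] Lp_norm_nonneg[of 2 g] by linarith
  then show "(LINT x|lborel. norm (f x) * norm (g x)) \<le> Lp_norm 2 f * Lp_norm 2 g"
  proof cases
    case 1
    then have "AE x in lborel. (norm (f x))\<^sup>2 = 0"
      by (subst integral_nonneg_eq_0_iff_AE[OF fi, symmetric]) (auto simp: Lp_norm2_eq)
    then have "(LINT x|lborel. norm (f x) * norm (g x)) = (LINT x|(lborel::'a measure). 0)"
      by (intro integral_cong_AE) auto
    then show ?thesis by simp
  next
    case 2
    then have "AE x in lborel. (norm (g x))\<^sup>2 = 0"
      by (subst integral_nonneg_eq_0_iff_AE[OF gi, symmetric]) (auto simp: Lp_norm2_eq)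
    then have "(LINT x|lborel. norm (f x) * norm (g x)) = (LINT x|(lborel::'a measure). 0)"
      by (intro integral_cong_AE) auto
    then show ?thesis by simp
  next
    case 3
    define \<eta> where "\<eta> = Lp_norm 2 g / Lp_norm 2 f"
    have \<eta>: "\<eta> > 0" using 3 by (simp add: \<eta>_def)
    have "(LINT x|lborel. norm (f x) * norm (g x))
        \<le> (LINT x|lborel. (\<eta> * (norm (f x))\<^sup>2 + (norm (g x))\<^sup>2 / \<eta>) / 2)"
      using i fi gi amgm[OF \<eta>] by (intro integral_mono) auto
    also have "\<dots> = (\<eta> * (Lp_norm 2 f)\<^sup>2 + (Lp_norm 2 g)\<^sup>2 / \<eta>) / 2"
      using fi gi by (simp add: Lp_norm2_power2)
    also have "\<dots> = Lp_norm 2 f * Lp_norm 2 g"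
      using 3 by (simp add: \<eta>_def field_simps power2_eq_square)
    finally show ?thesis .
  qed
qed

lemma Lp_norm2_triangle:
  fixes f g :: "'a::euclidean_space \<Rightarrow> complex"
  assumes f: "f \<in> Lp 2" and g: "g \<in> Lp 2"
  shows "Lp_norm 2 (\<lambda>x. f x + g x) \<le> Lp_norm 2 f + Lp_norm 2 g"
proof -
  have fi: "integrable lborel (\<lambda>x. (norm (f x))\<^sup>2)" and gi: "integrable lborel (\<lambda>x. (norm (g x))\<^sup>2)"
    using f g by (auto simp: Lp2_iff)
  have "(norm (f x + g x))\<^sup>2 \<le> (norm (f x))\<^sup>2 + (norm (g x))\<^sup>2 + 2 * (norm (f x) * norm (g x))" for x
  proof -
    have "(norm (f x + g x))\<^sup>2 \<le> (norm (f x) + norm (g x))\<^sup>2"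
      by (intro power_mono norm_triangle_ineq) auto
    then show ?thesis by (simp add: power2_sum)
  qed
  then have "(Lp_norm 2 (\<lambda>x. f x + g x))\<^sup>2
      \<le> (LINT x|lborel. (norm (f x))\<^sup>2 + (norm (g x))\<^sup>2 + 2 * (norm (f x) * norm (g x)))"
    unfolding Lp_norm2_power2
    using Lp2_add[OF f g] fi gi Lp2_Cauchy_Schwarz(1)[OF f g]
    by (intro integral_mono) (auto simp: Lp2_iff)
  also have "\<dots> = (Lp_norm 2 f)\<^sup>2 + (Lp_norm 2 g)\<^sup>2 + 2 * (LINT x|lborel. norm (f x) * norm (g x))"
    using fi gi Lp2_Cauchy_Schwarz(1)[OF f g] by (simp add: Lp_norm2_power2)
  also have "\<dots> \<le> (Lp_norm 2 f + Lp_norm 2 g)\<^sup>2"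
    using Lp2_Cauchy_Schwarz(2)[OF f g] by (simp add: power2_sum)
  finally show ?thesis by (rule power2_le_imp_le) simp
qed

lemma Lp_norm2_triangle_diff:
  fixes f g h :: "'a::euclidean_space \<Rightarrow> complex"
  assumes "f \<in> Lp 2" "g \<in> Lp 2" "h \<in> Lp 2"
  shows "Lp_norm 2 (\<lambda>x. f x - h x) \<le> Lp_norm 2 (\<lambda>x. f x - g x) + Lp_norm 2 (\<lambda>x. g x - h x)"
  using Lp_norm2_triangle[OF Lp2_diff[OF assms(1,2)] Lp2_diff[OF assms(2,3)]] by simp

lemma Lp_norm2_diff_abs:
  fixes f g :: "'a::euclidean_space \<Rightarrow> complex"
  assumes f: "f \<in> Lp 2" and g: "g \<in> Lp 2"
  shows "\<bar>Lp_norm 2 f - Lp_norm 2 g\<bar> \<le> Lp_norm 2 (\<lambda>x. f x - g x)"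
  using Lp_norm2_triangle[OF Lp2_diff[OF f g] g] Lp_norm2_triangle[OF Lp2_diff[OF g f] f]
    Lp_norm2_minus_commute[of f g] by auto

lemma Lp_norm2_zero_AE:
  fixes f :: "'a::euclidean_space \<Rightarrow> complex"
  assumes f: "f \<in> Lp 2" and "Lp_norm 2 f = 0"
  shows "AE x in lborel. f x = 0"
proof -
  have "AE x in lborel. (norm (f x))\<^sup>2 = 0"
    using assms by (subst integral_nonneg_eq_0_iff_AE[symmetric]) (auto simp: Lp_norm2_eq Lp2_iff)
  then show ?thesis by simp
qed

text \<open>Fatou's lemma makes the norm lower semicontinuous under convergence almost everywhere.
  Completeness and the scattering estimate both rest on this, since there only pointwise limits are
  at hand.\<close>

lemma Lp2_Fatou:
  fixes f :: "nat \<Rightarrow> 'a::euclidean_space \<Rightarrow> complex"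
  assumes f: "\<And>n. f n \<in> Lp 2" and g: "g \<in> borel_measurable borel"
    and lim: "AE x in lborel. (\<lambda>n. f n x) \<longlonglongrightarrow> g x"
    and le: "\<And>n. Lp_norm 2 (f n) \<le> c"
  shows "g \<in> Lp 2" "Lp_norm 2 g \<le> c"
proof -
  have c: "0 \<le> c" using le[of 0] Lp_norm_nonneg[of 2 "f 0"] by linarith
  have "(\<integral>\<^sup>+x. ennreal ((norm (g x))\<^sup>2) \<partial>lborel)
      = (\<integral>\<^sup>+x. liminf (\<lambda>n. ennreal ((norm (f n x))\<^sup>2)) \<partial>lborel)"
  proof (rule nn_integral_cong_AE)
    show "AE x in lborel. ennreal ((norm (g x))\<^sup>2) = liminf (\<lambda>n. ennreal ((norm (f n x))\<^sup>2))"
      using lim by eventually_elim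
        (rule lim_imp_Liminf[symmetric], simp, intro tendsto_ennrealI tendsto_intros)
  qed
  also have "\<dots> \<le> liminf (\<lambda>n. \<integral>\<^sup>+x. ennreal ((norm (f n x))\<^sup>2) \<partial>lborel)"
    using f[THEN Lp_measurable] by (intro nn_integral_liminf) measurable
  also have "\<dots> \<le> ennreal (c\<^sup>2)"
    using nn_integral_Lp2[OF f] le
    by (intro Liminf_le always_eventually allI) (auto intro!: ennreal_leI power_mono)
  finally have *: "(\<integral>\<^sup>+x. ennreal ((norm (g x))\<^sup>2) \<partial>lborel) \<le> ennreal (c\<^sup>2)" .
  show "g \<in> Lp 2" "Lp_norm 2 g \<le> c" using Lp2_boundI[OF g * c] by auto
qed

text \<open>The corresponding statement for L^1 applies to \<open>|f n - g|^2\<close>. It is the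
  bridge from convergence in norm to values at single frequencies.\<close>

lemma Lp2_tendsto_AE_subseq:
  fixes f :: "nat \<Rightarrow> 'a::euclidean_space \<Rightarrow> complex"
  assumes f: "\<And>n. f n \<in> Lp 2" and g: "g \<in> Lp 2"
    and lim: "(\<lambda>n. Lp_norm 2 (\<lambda>x. f n x - g x)) \<longlonglongrightarrow> 0"
  shows "\<exists>s::nat \<Rightarrow> nat. strict_mono s \<and> (AE x in lborel. (\<lambda>n. f (s n) x) \<longlonglongrightarrow> g x)"
proof -
  have d: "(\<lambda>x. f n x - g x) \<in> Lp 2" for n by (intro Lp2_diff f g)
  have i: "integrable lborel (\<lambda>x. (norm (f n x - g x))\<^sup>2)" for n
    using d by (simp add: Lp2_iff)
  have "(\<lambda>n. LINT x|lborel. norm ((norm (f n x - g x))\<^sup>2)) \<longlonglongrightarrow> 0"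
    using tendsto_power[OF lim, of 2] by (simp add: Lp_norm2_power2)
  from tendsto_L1_AE_subseq[OF i this] obtain s :: "nat \<Rightarrow> nat" where s: "strict_mono s"
    and ae: "AE x in lborel. (\<lambda>n. (norm (f (s n) x - g x))\<^sup>2) \<longlonglongrightarrow> 0" by auto
  have "AE x in lborel. (\<lambda>n. f (s n) x) \<longlonglongrightarrow> g x"
    using ae
  proof eventually_elim
    case (elim x)
    have "(\<lambda>n. sqrt ((norm (f (s n) x - g x))\<^sup>2)) \<longlonglongrightarrow> sqrt 0"
      using elim by (intro tendsto_real_sqrt)
    then show ?case by (simp add: tendsto_norm_zero_iff LIM_zero_iff)
  qed
  with s show ?thesis by blast
qed

lemma Lp2_dominated:
  fixes f :: "nat \<Rightarrow> 'a::euclidean_space \<Rightarrow> complex"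
  assumes f: "\<And>n. f n \<in> borel_measurable borel" and g: "g \<in> borel_measurable borel"
    and h: "h \<in> Lp 2" and lim: "AE x in lborel. (\<lambda>n. f n x) \<longlonglongrightarrow> g x"
    and bd: "\<And>n. AE x in lborel. norm (f n x - g x) \<le> norm (h x)"
  shows "(\<lambda>n. Lp_norm 2 (\<lambda>x. f n x - g x)) \<longlonglongrightarrow> 0"
proof -
  note [measurable] = f g
  have "(\<lambda>n. LINT x|lborel. (norm (f n x - g x))\<^sup>2) \<longlonglongrightarrow> (LINT x|(lborel::'a measure). 0)"
  proof (rule integral_dominated_convergence[where w="\<lambda>x. (norm (h x))\<^sup>2"])
    show "integrable lborel (\<lambda>x. (norm (h x))\<^sup>2)" using h by (simp add: Lp2_iff)
    show "AE x in lborel. (\<lambda>n. (norm (f n x - g x))\<^sup>2) \<longlonglongrightarrow> 0"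
      using lim
    proof eventually_elim
      case (elim x)
      have "(\<lambda>n. (norm (f n x - g x))\<^sup>2) \<longlonglongrightarrow> (norm (g x - g x))\<^sup>2" by (intro tendsto_intros elim)
      then show ?case by simp
    qed
    show "AE x in lborel. norm ((norm (f n x - g x))\<^sup>2) \<le> (norm (h x))\<^sup>2" for n
      using bd[of n] by eventually_elim (auto intro: power_mono)
  qed simp_all
  then show ?thesis unfolding Lp_norm2_eq using tendsto_real_sqrt by fastforce
qed

text \<open>The Riesz-Fischer theorem. Along a subsequence with increments of norm at most
  \<open>2^(-k)\<close>, the series of \<open>2^k |d k|^2\<close> is integrable, since
  \<open>2^k 4^(-k) = 2^(-k)\<close>; this forces absolute convergence of the increments almost
  everywhere. Fatou's lemma then upgrades the pointwise limit to a limit in norm.\<close>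

lemma Lp2_complete:
  fixes f :: "nat \<Rightarrow> 'a::euclidean_space \<Rightarrow> complex"
  assumes f: "\<And>n. f n \<in> Lp 2"
    and C: "\<And>e. e > 0 \<Longrightarrow> \<exists>N. \<forall>m\<ge>N. \<forall>n\<ge>N. Lp_norm 2 (\<lambda>x. f m x - f n x) < e"
  shows "\<exists>g\<in>Lp 2. (\<lambda>n. Lp_norm 2 (\<lambda>x. f n x - g x)) \<longlonglongrightarrow> 0"
proof -
  note [measurable] = f[THEN Lp_measurable]
  obtain N where N: "\<And>k m n. m \<ge> N k \<Longrightarrow> n \<ge> N k \<Longrightarrow> Lp_norm 2 (\<lambda>x. f m x - f n x) < (1/2)^k"
    using C[of "(1/2)^k" for k] by (metis zero_less_divide_1_iff zero_less_numeral zero_less_power)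
  \<comment> \<open>A running maximum makes the indices monotone and still puts \<open>s k\<close>
    beyond \<open>N k\<close>.\<close>
  define s where "s k = Max (N ` {..k})" for k
  have sN: "s k \<ge> N k" for k unfolding s_def by (intro Max_ge) auto
  have smono: "s k \<le> s l" if "k \<le> l" for k l unfolding s_def using that by (intro Max_mono) auto
  define d where "d k x = f (s (Suc k)) x - f (s k) x" for k x
  have dL: "d k \<in> Lp 2" for k unfolding d_def by (intro Lp2_diff f)
  have dn: "Lp_norm 2 (d k) \<le> (1/2)^k" for k
    unfolding d_def using N[of k "s (Suc k)" "s k"] sN[of k] smono[of k "Suc k"] by simp
  note [measurable] = dL[THEN Lp_measurable]
  have "(\<integral>\<^sup>+x. (\<Sum>k. ennreal (2^k * (norm (d k x))\<^sup>2)) \<partial>lborel)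
      = (\<Sum>k. \<integral>\<^sup>+x. ennreal (2^k * (norm (d k x))\<^sup>2) \<partial>lborel)"
    by (intro nn_integral_suminf) simp
  also have "\<dots> \<le> (\<Sum>k. ennreal ((1/2)^k))"
  proof (intro suminf_le allI summableI)
    fix k
    have "(\<integral>\<^sup>+x. ennreal (2^k * (norm (d k x))\<^sup>2) \<partial>lborel) = ennreal (2^k) * ennreal ((Lp_norm 2 (d k))\<^sup>2)"
      by (simp add: ennreal_mult nn_integral_cmult nn_integral_Lp2[OF dL])
    also have "\<dots> \<le> ennreal (2^k) * ennreal (((1/2)^k)\<^sup>2)"
      using dn[of k] by (intro mult_left_mono ennreal_leI power_mono) auto
    also have "\<dots> = ennreal ((1/2)^k)"
      by (simp add: ennreal_mult[symmetric] power2_eq_square power_mult_distrib[symmetric] field_simps)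
    finally show "(\<integral>\<^sup>+x. ennreal (2^k * (norm (d k x))\<^sup>2) \<partial>lborel) \<le> ennreal ((1/2)^k)" .
  qed
  also have "\<dots> = ennreal 2"
    by (subst suminf_ennreal2) (auto simp: suminf_geometric)
  finally have "(\<integral>\<^sup>+x. (\<Sum>k. ennreal (2^k * (norm (d k x))\<^sup>2)) \<partial>lborel) \<noteq> \<infinity>"
    by (auto simp: top_unique)
  then have "AE x in lborel. (\<Sum>k. ennreal (2^k * (norm (d k x))\<^sup>2)) \<noteq> \<infinity>"
    by (intro nn_integral_PInf_AE) auto
  then have ae: "AE x in lborel. convergent (\<lambda>k. f (s k) x)"
  proof eventually_elim
    case (elim x)
    have "summable (\<lambda>k. 2^k * (norm (d k x))\<^sup>2)"
      using elim by (intro summable_suminf_not_top) auto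
    then have "summable (\<lambda>k. 2^k * (norm (d k x))\<^sup>2 + (1/2)^k)"
      by (intro summable_add summable_geometric) auto
    then have "summable (\<lambda>k. d k x)"
    proof (rule summable_comparison_test'[where N=0])
      fix k :: nat
      \<comment> \<open>Expanding the square compares \<open>|d|\<close> with
        \<open>2^k |d|^2 + 2^(-k)\<close>: the weighted squares control the increments up to a
        geometric series.\<close>
      have "0 \<le> (2^k * norm (d k x) - 1)\<^sup>2 / 2^k" by simp
      also have "\<dots> = 2^k * (norm (d k x))\<^sup>2 + (1/2)^k - 2 * norm (d k x)"
        by (simp add: power2_eq_square field_simps)
      finally show "norm (d k x) \<le> 2^k * (norm (d k x))\<^sup>2 + (1/2)^k"
        using norm_ge_zero[of "d k x"] by linarith
    qed
    then have "convergent (\<lambda>n. \<Sum>k<n. d k x)" by (simp add: summable_iff_convergent)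
    moreover have "(\<Sum>k<n. d k x) = f (s n) x - f (s 0) x" for n
      unfolding d_def by (rule sum_lessThan_telescope)
    ultimately have "convergent (\<lambda>n. (f (s n) x - f (s 0) x) + f (s 0) x)"
      by (intro convergent_add convergent_const) simp
    then show ?case by simp
  qed
  define g where "g x = lim (\<lambda>k. f (s k) x)" for x
  have gm [measurable]: "g \<in> borel_measurable borel" unfolding g_def
    using borel_measurable_lim_metric[of "\<lambda>k. f (s k)" borel] by simp
  have lim: "AE x in lborel. (\<lambda>k. f (s k) x) \<longlonglongrightarrow> g x"
    using ae unfolding g_def by (simp add: convergent_LIMSEQ_iff)
  have bd: "(\<lambda>x. f m x - g x) \<in> Lp 2 \<and> Lp_norm 2 (\<lambda>x. f m x - g x) \<le> (1/2)^k" if m: "m \<ge> s k" for k m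
  proof -
    have lim': "AE x in lborel. (\<lambda>i. f m x - f (s (i + k)) x) \<longlonglongrightarrow> f m x - g x"
      using lim by eventually_elim (intro tendsto_intros LIMSEQ_ignore_initial_segment)
    have "Lp_norm 2 (\<lambda>x. f m x - f (s (i + k)) x) \<le> (1/2)^k" for i
      using N[of k m "s (i+k)"] m sN[of k] smono[of k "i+k"] by simp
    from Lp2_Fatou[OF Lp2_diff[OF f f] _ lim' this] show ?thesis by simp
  qed
  have "g \<in> Lp 2"
    using Lp2_diff[OF f[of "s 0"], of "\<lambda>x. f (s 0) x - g x"] bd[of 0 "s 0"] by simp
  moreover have "(\<lambda>n. Lp_norm 2 (\<lambda>x. f n x - g x)) \<longlonglongrightarrow> 0"
  proof (rule LIMSEQ_I)
    fix e :: real assume "e > 0"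
    then obtain k where k: "(1/2)^k < e" using real_arch_pow_inv[of e "1/2"] by auto
    show "\<exists>no. \<forall>n\<ge>no. norm (Lp_norm 2 (\<lambda>x. f n x - g x) - 0) < e"
      using bd[of k] k by (intro exI[of _ "s k"]) fastforce
  qed
  ultimately show ?thesis by blast
qed

subsection \<open>Plancherel's theorem\<close>

lemma lborel_integral_affine:
  fixes f :: "'a::euclidean_space \<Rightarrow> 'b::{banach, second_countable_topology}"
  assumes [measurable]: "f \<in> borel_measurable borel" and c: "c \<noteq> 0"
  shows "(LINT x|lborel. f x) = (\<bar>c\<bar> ^ DIM('a)) *\<^sub>R (LINT x|lborel. f (t + c *\<^sub>R x))"
  by (subst lborel_affine[OF c, of t]) (simp add: integral_density integral_distr)

lemma lborel_nn_integral_affine: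
  fixes f :: "'a::euclidean_space \<Rightarrow> ennreal"
  assumes [measurable]: "f \<in> borel_measurable borel" and c: "c \<noteq> 0"
  shows "(\<integral>\<^sup>+x. f x \<partial>lborel) = ennreal (\<bar>c\<bar> ^ DIM('a)) * (\<integral>\<^sup>+x. f (t + c *\<^sub>R x) \<partial>lborel)"
  by (subst lborel_affine[OF c, of t]) (simp add: nn_integral_density nn_integral_distr nn_integral_cmult)

text \<open>The case \<open>c = 1\<close> is translation by \<open>t\<close>, and the case
  \<open>c = -1\<close>, \<open>t = 0\<close> is reflection at the origin, the two isometries that
  the Fourier part uses.\<close>

lemma Lp_norm2_affine:
  fixes f :: "'a::euclidean_space \<Rightarrow> complex"
  assumes f: "f \<in> Lp 2" and c: "\<bar>c\<bar> = 1"
  shows "(\<lambda>x. f (t + c *\<^sub>R x)) \<in> Lp 2" "Lp_norm 2 (\<lambda>x. f (t + c *\<^sub>R x)) = Lp_norm 2 f"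
proof -
  note [measurable] = Lp_measurable[OF f]
  have c0: "c \<noteq> 0" using c by auto
  have *: "(\<integral>\<^sup>+x. ennreal ((norm (f (t + c *\<^sub>R x)))\<^sup>2) \<partial>lborel) = ennreal ((Lp_norm 2 f)\<^sup>2)"
    using lborel_nn_integral_affine[OF _ c0, of "\<lambda>x. ennreal ((norm (f x))\<^sup>2)" t] nn_integral_Lp2[OF f] c
    by simp
  show L: "(\<lambda>x. f (t + c *\<^sub>R x)) \<in> Lp 2" using * by (intro Lp2_boundI[where c="Lp_norm 2 f"]) auto
  show "Lp_norm 2 (\<lambda>x. f (t + c *\<^sub>R x)) = Lp_norm 2 f"
    using nn_integral_Lp2[OF L] unfolding * by simp
qed

section \<open>Gaussians and their Fourier transforms\<close>

lemma cis_measurable [measurable]: "cis \<in> borel_measurable borel"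
  by (intro borel_measurable_continuous_onI continuous_intros)

text \<open>Written as a product of one-dimensional normal densities so that its transform factors
  over the coordinates; the normalisation gives it integral 1.\<close>

definition gauss :: "'a::euclidean_space \<Rightarrow> real" where
  "gauss z = (\<Prod>b\<in>Basis. std_normal_density (z \<bullet> b))"

lemma gauss_measurable [measurable]: "gauss \<in> borel_measurable borel"
  unfolding gauss_def[abs_def] by measurable

lemma gauss_nonneg [simp]: "0 \<le> gauss z"
  by (simp add: gauss_def prod_nonneg)

lemma exp_norm_prod:
  "exp (- (norm (z::'a::euclidean_space))\<^sup>2 / 2) = (\<Prod>b\<in>(Basis::'a set). exp (- (z \<bullet> b)\<^sup>2 / 2))"
proof -
  have "(norm z)\<^sup>2 = (\<Sum>b\<in>Basis. (z \<bullet> b)\<^sup>2)"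
    unfolding power2_norm_eq_inner by (subst euclidean_inner) (simp add: power2_eq_square)
  then show ?thesis by (simp add: exp_sum[symmetric] sum_negf sum_divide_distrib)
qed

lemma gauss_eq:
  "gauss (z::'a::euclidean_space) = (2 * pi) powr (- real DIM('a) / 2) * exp (- (norm z)\<^sup>2 / 2)"
proof -
  have "(2 * pi) powr (- (1/2)) = inverse (sqrt (2 * pi))"
    unfolding powr_minus by (subst powr_half_sqrt) auto
  then have c: "(2 * pi) powr (-1/2) = 1 / sqrt (2 * pi)"
    by (simp only: minus_divide_left inverse_eq_divide)
  have "gauss z = (\<Prod>b\<in>(Basis::'a set). (2 * pi) powr (-1/2) * exp (- (z \<bullet> b)\<^sup>2 / 2))"
    unfolding gauss_def std_normal_density_def c ..
  also have "\<dots> = ((2 * pi) powr (-1/2)) ^ DIM('a) * (\<Prod>b\<in>(Basis::'a set). exp (- (z \<bullet> b)\<^sup>2 / 2))"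
    by (simp add: prod.distrib)
  also have "((2 * pi) powr (-1/2)) ^ DIM('a) = (2 * pi) powr (- real DIM('a) / 2)"
    by (subst powr_realpow[symmetric]) (auto simp: powr_powr)
  also have "(\<Prod>b\<in>(Basis::'a set). exp (- (z \<bullet> b)\<^sup>2 / 2)) = exp (- (norm z)\<^sup>2 / 2)"
    by (rule exp_norm_prod[symmetric])
  finally show ?thesis .
qed

text \<open>This is the characteristic function of the standard normal law, evaluated at
  \<open>-t\<close>.\<close>

lemma std_normal_fourier:
  "(LINT x|lborel. complex_of_real (std_normal_density x) * cis (- (x * t))) = of_real (exp (- t\<^sup>2 / 2))"
proof -
  have "complex_of_real (exp (- t\<^sup>2 / 2)) = char std_normal_distribution (-t)"
    by (simp add: char_std_normal_distribution)
  also have "\<dots> = (LINT x|lborel. complex_of_real (std_normal_density x) * cis (- (x * t)))"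
    unfolding char_def by (subst integral_density) (auto simp: cis_conv_exp scaleR_conv_of_real mult_ac)
  finally show ?thesis by simp
qed

text \<open>Lebesgue measure on \<open>'a\<close> is the image of the product of the Lebesgue
  measures of the coordinates, so Fubini's theorem splits the integral. The bounded factors
  \<open>h\<close> will be the constant 1 for integrability and characters for the
  transform.\<close>

lemma gauss_integral_factor:
  fixes h :: "'a::euclidean_space \<Rightarrow> real \<Rightarrow> complex"
  assumes [measurable]: "\<And>b. h b \<in> borel_measurable borel" and "\<And>b x. norm (h b x) \<le> 1"
  shows "integrable lborel (\<lambda>z::'a. \<Prod>b\<in>Basis. complex_of_real (std_normal_density (z \<bullet> b)) * h b (z \<bullet> b))"
   and "(LINT z|lborel. (\<Prod>b\<in>Basis. complex_of_real (std_normal_density (z \<bullet> b)) * h b (z \<bullet> b))) =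
      (\<Prod>b\<in>(Basis::'a set). LINT x|lborel. complex_of_real (std_normal_density x) * h b x)"
proof -
  interpret product_sigma_finite "\<lambda>_::'a. lborel::real measure" by standard
  have i: "integrable lborel (\<lambda>x. complex_of_real (std_normal_density x) * h b x)" for b
    by (rule Bochner_Integration.integrable_bound[OF integrable_normal_density[of 1 0]])
       (use assms(2)[of b] in \<open>auto simp: norm_mult mult_left_le\<close>)
  have [simp]: "(\<Sum>b\<in>Basis. f b *\<^sub>R b) \<bullet> c = f c" if "c \<in> (Basis::'a set)" for f c
    using that by (simp add: inner_sum_left_Basis)
  show "integrable lborel (\<lambda>z::'a. \<Prod>b\<in>Basis. complex_of_real (std_normal_density (z \<bullet> b)) * h b (z \<bullet> b))"
    unfolding lborel_eq[where 'a='a] by (subst integrable_distr_eq) (auto intro!: product_integrable_prod i)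
  show "(LINT z|lborel. (\<Prod>b\<in>Basis. complex_of_real (std_normal_density (z \<bullet> b)) * h b (z \<bullet> b))) =
      (\<Prod>b\<in>(Basis::'a set). LINT x|lborel. complex_of_real (std_normal_density x) * h b x)"
    unfolding lborel_eq[where 'a='a] by (subst integral_distr) (auto intro!: product_integral_prod i)
qed

lemma cis_inner_prod: "cis (- (z \<bullet> w)) = (\<Prod>b\<in>Basis. cis (- ((z \<bullet> b) * (w \<bullet> b))))"
  by (subst euclidean_inner) (simp add: cis_conv_exp exp_sum[symmetric] sum_negf sum_distrib_left)

lemma gauss_fourier:
  "(LINT z|lborel. complex_of_real (gauss z) * cis (- (z \<bullet> w))) = of_real (exp (- (norm w)\<^sup>2 / 2))"
proof -
  have "(LINT z|lborel. complex_of_real (gauss z) * cis (- (z \<bullet> w)))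
      = (LINT z|lborel. (\<Prod>b\<in>Basis. complex_of_real (std_normal_density (z \<bullet> b)) * cis (- ((z \<bullet> b) * (w \<bullet> b)))))"
    unfolding cis_inner_prod gauss_def by (simp add: prod.distrib)
  also have "\<dots> = (\<Prod>b\<in>Basis. of_real (exp (- (w \<bullet> b)\<^sup>2 / 2)))"
    by (subst gauss_integral_factor(2)) (simp_all add: std_normal_fourier)
  also have "\<dots> = of_real (exp (- (norm w)\<^sup>2 / 2))"
    unfolding exp_norm_prod of_real_prod ..
  finally show ?thesis .
qed

lemma gauss_integrable: "integrable lborel (gauss :: 'a::euclidean_space \<Rightarrow> real)"
proof -
  have "integrable lborel (\<lambda>z::'a. complex_of_real (gauss z))"
    using gauss_integral_factor(1)[of "\<lambda>_ _. 1"] by (simp add: gauss_def)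
  then show ?thesis by (simp add: complex_of_real_integrable_eq)
qed

lemma gauss_integral: "(LINT z|lborel. gauss z) = 1"
  using gauss_fourier[of 0] by simp

section \<open>The Fourier integral of integrable functions\<close>

definition FT :: "('a::euclidean_space \<Rightarrow> complex) \<Rightarrow> 'a \<Rightarrow> complex" where
  "FT f \<xi> = complex_of_real ((2 * pi) powr (- real DIM('a) / 2)) * (LINT x|lborel. cis (- (x \<bullet> \<xi>)) * f x)"

lemma FT_measurable [measurable]:
  assumes [measurable]: "f \<in> borel_measurable borel"
  shows "FT f \<in> borel_measurable borel"
  unfolding FT_def[abs_def] by measurable

lemma cis_mult_integrable:
  fixes f :: "'a::euclidean_space \<Rightarrow> complex"
  assumes f: "integrable lborel f"
  shows "integrable lborel (\<lambda>x. cis (- (x \<bullet> \<xi>)) * f x)"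
  by (rule Bochner_Integration.integrable_bound[OF f]) (use f in \<open>auto simp: norm_mult\<close>)

lemma twopi_powr_le: "(2 * pi) powr (- real n / 2) \<le> 1"
  using powr_mono[of "- real n / 2" 0 "2 * pi"] pi_ge_two by simp

lemma FT_bound:
  fixes f :: "'a::euclidean_space \<Rightarrow> complex"
  assumes f: "integrable lborel f"
  shows "norm (FT f \<xi>) \<le> (LINT x|lborel. norm (f x))"
proof -
  have "norm (LINT x|lborel. cis (- (x \<bullet> \<xi>)) * f x) \<le> (LINT x|lborel. norm (cis (- (x \<bullet> \<xi>)) * f x))"
    by (rule integral_norm_bound)
  then have "(2 * pi) powr (- real DIM('a) / 2) * norm (LINT x|lborel. cis (- (x \<bullet> \<xi>)) * f x)
     \<le> 1 * (LINT x|lborel. norm (f x))"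
    by (intro mult_mono twopi_powr_le) (auto simp: norm_mult)
  then show ?thesis by (simp add: FT_def norm_mult)
qed

text \<open>Fubini's theorem, as the kernel is symmetric in \<open>x\<close> and \<xi>.\<close>

lemma FT_multiplication_formula:
  fixes f k :: "'a::euclidean_space \<Rightarrow> complex"
  assumes f: "integrable lborel f" and k: "integrable lborel k"
  shows "(LINT \<xi>|lborel. FT f \<xi> * k \<xi>) = (LINT x|lborel. f x * FT k x)"
proof -
  have [measurable]: "f \<in> borel_measurable borel" "k \<in> borel_measurable borel" using f k by auto
  let ?c = "complex_of_real ((2 * pi) powr (- real DIM('a) / 2))"
  have "integrable (lborel \<Otimes>\<^sub>M lborel) (\<lambda>(x, \<xi>). f x * k \<xi>)"
    using f k by (intro lborel_pair.Fubini_integrable) (auto simp: norm_mult)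
  then have i: "integrable (lborel \<Otimes>\<^sub>M lborel) (\<lambda>(x, \<xi>). ?c * (cis (- (x \<bullet> \<xi>)) * f x * k \<xi>))"
    using twopi_powr_le[of "DIM('a)"]
    by (elim Bochner_Integration.integrable_bound)
      (auto simp: norm_mult mult_left_le_one_le split: prod.split)
  have "(LINT \<xi>|lborel. FT f \<xi> * k \<xi>) = (LINT \<xi>|lborel. LINT x|lborel. ?c * (cis (- (x \<bullet> \<xi>)) * f x * k \<xi>))"
    unfolding FT_def by (simp add: mult.assoc[of "complex_of_real ((2 * pi) powr - (real DIM('a) / 2))"])
  also have "\<dots> = (LINT x|lborel. LINT \<xi>|lborel. ?c * (cis (- (x \<bullet> \<xi>)) * f x * k \<xi>))"
    by (rule lborel_pair.Fubini_integral[OF i])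
  also have "\<dots> = (LINT x|lborel. LINT \<xi>|lborel. (?c * f x) * (cis (- (\<xi> \<bullet> x)) * k \<xi>))"
    by (simp add: mult_ac inner_commute)
  also have "\<dots> = (LINT x|lborel. f x * FT k x)"
    unfolding FT_def integral_mult_right_zero by (simp only: mult_ac)
  finally show ?thesis .
qed

lemma gauss_scaled_fourier:
  assumes e: "\<epsilon> > 0"
  shows "(LINT \<xi>|lborel. complex_of_real (gauss (\<epsilon> *\<^sub>R \<xi>)) * cis (- (\<xi> \<bullet> (w::'a::euclidean_space)))) =
     of_real (exp (- (norm (w /\<^sub>R \<epsilon>))\<^sup>2 / 2) / \<epsilon> ^ DIM('a))"
proof -
  have "(LINT z|lborel. complex_of_real (gauss z) * cis (- (z \<bullet> (w /\<^sub>R \<epsilon>))))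
    = (\<bar>\<epsilon>\<bar> ^ DIM('a)) *\<^sub>R (LINT \<xi>|lborel. complex_of_real (gauss (0 + \<epsilon> *\<^sub>R \<xi>)) * cis (- ((0 + \<epsilon> *\<^sub>R \<xi>) \<bullet> (w /\<^sub>R \<epsilon>))))"
    using e by (intro lborel_integral_affine) auto
  then show ?thesis using e unfolding gauss_fourier by (simp add: scaleR_conv_of_real field_simps)
qed

lemma gauss_scaled_integrable:
  assumes e: "\<epsilon> \<noteq> 0"
  shows "integrable lborel (\<lambda>\<xi>::'a::euclidean_space. gauss (\<epsilon> *\<^sub>R \<xi>))"
proof (rule integrableI_bounded)
  have "(\<integral>\<^sup>+x. ennreal (gauss x) \<partial>(lborel::'a measure)) < \<infinity>"
    using gauss_integrable[where 'a='a] unfolding integrable_iff_bounded by simp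
  also have "(\<integral>\<^sup>+x. ennreal (gauss x) \<partial>(lborel::'a measure)) =
     ennreal (\<bar>\<epsilon>\<bar> ^ DIM('a)) * (\<integral>\<^sup>+x. ennreal (gauss (0 + \<epsilon> *\<^sub>R x)) \<partial>(lborel::'a measure))"
    using e by (intro lborel_nn_integral_affine) auto
  finally show "(\<integral>\<^sup>+x. ennreal (norm (gauss (\<epsilon> *\<^sub>R x))) \<partial>(lborel::'a measure)) < \<infinity>"
    using e by (auto simp: ennreal_mult_less_top)
qed simp

section \<open>Approximation by continuous functions\<close>

definition clamp :: "real \<Rightarrow> complex \<Rightarrow> complex" where
  "clamp B z = (B / max B (norm z)) *\<^sub>R z"

lemma clamp_norm_le: "B > 0 \<Longrightarrow> norm (clamp B z) \<le> B"
  by (simp add: clamp_def field_simps)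

lemma clamp_id: "B > 0 \<Longrightarrow> norm z \<le> B \<Longrightarrow> clamp B z = z"
  by (simp add: clamp_def max_def)

lemma continuous_on_clamp: "B > 0 \<Longrightarrow> continuous_on UNIV (clamp B)"
  unfolding clamp_def[abs_def] by (intro continuous_intros) (auto simp: max_def)

lemma indicator_cball_Lp2: "(\<lambda>x::'a::euclidean_space. of_real (c * indicator (cball 0 R) x)) \<in> Lp 2"
proof -
  have "integrable lborel (\<lambda>x::'a. c\<^sup>2 * indicator (cball 0 R) x :: real)"
    by (intro integrable_mult_right integrable_real_indicator) (simp_all add: emeasure_compact_finite[unfolded infinity_ennreal_def])
  moreover have m: "(\<lambda>x::'a. complex_of_real (c * indicator (cball 0 R) x)) \<in> borel_measurable lborel"
  proof -
    have [measurable]: "cball (0::'a) R \<in> sets borel" by simp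
    show ?thesis by measurable
  qed
  moreover have "(\<lambda>x::'a. (norm (complex_of_real (c * indicator (cball 0 R) x)))\<^sup>2) = (\<lambda>x. c\<^sup>2 * indicator (cball 0 R) x)"
    by (auto simp: fun_eq_iff indicator_def norm_mult power_mult_distrib)
  ultimately show ?thesis
    unfolding Lp2_iff by (metis (no_types, lifting) m)
qed

text \<open>A measurable function is a limit almost everywhere of continuous functions. Composing
  these with the radial retraction \<open>clamp B\<close> onto the disc of radius \<open>B\<close>
  and multiplying by a continuous cutoff keeps them bounded and compactly supported, so dominated
  convergence gives the limit in L^2.\<close>

lemma Lp2_continuous_dense_aux:
  fixes f :: "'a::euclidean_space \<Rightarrow> complex"
  assumes [measurable]: "f \<in> borel_measurable borel"
    and B: "B > 0" "\<And>x. norm (f x) \<le> B" and R: "\<And>x. norm x > R \<Longrightarrow> f x = 0" and e: "e > 0"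
  shows "\<exists>g. continuous_on UNIV g \<and> (\<forall>x. norm (g x) \<le> B) \<and> (\<forall>x. norm x > R + 1 \<longrightarrow> g x = 0) \<and>
     Lp_norm 2 (\<lambda>x. g x - f x) < e"
proof -
  have "f measurable_on UNIV"
    by (rule lebesgue_measurable_imp_measurable_on) (auto intro: measurable_completion)
  then obtain N g where N: "negligible N" and g: "\<And>n::nat. continuous_on UNIV (g n)"
    and lim: "\<And>x. x \<notin> N \<Longrightarrow> (\<lambda>n. g n x) \<longlonglongrightarrow> f x"
    by (auto simp: measurable_on_def)
  define ct :: "'a \<Rightarrow> real" where "ct x = max 0 (min 1 (R + 1 - norm x))" for x
  have ct: "0 \<le> ct x" "ct x \<le> 1" "norm x > R + 1 \<Longrightarrow> ct x = 0" "norm x \<le> R \<Longrightarrow> ct x = 1" for x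
    by (auto simp: ct_def)
  define h where "h n x = ct x *\<^sub>R clamp B (g n x)" for n x
  have hc: "continuous_on UNIV (h n)" for n
    unfolding h_def[abs_def] ct_def
    by (intro continuous_intros continuous_on_compose2[OF continuous_on_clamp[OF B(1)] g]) auto
  have hm: "h n \<in> borel_measurable borel" for n
    by (intro borel_measurable_continuous_onI hc)
  have hB: "norm (h n x) \<le> B" for n x
    using mult_mono[OF ct(2)[of x] clamp_norm_le[OF B(1), of "g n x"]] ct(1)[of x] by (simp add: h_def)
  have h0: "norm x > R + 1 \<Longrightarrow> h n x = 0" for n x by (simp add: h_def ct)
  have "(\<lambda>n. Lp_norm 2 (\<lambda>x. h n x - f x)) \<longlonglongrightarrow> 0"
  proof (rule Lp2_dominated[OF hm _ indicator_cball_Lp2[of "2*B" "R+1"]])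
    have "AE x in lebesgue. x \<notin> N"
      using N by (auto simp: negligible_iff_null_sets intro: AE_not_in)
    then have "AE x in lebesgue. (\<lambda>n. h n x) \<longlonglongrightarrow> f x"
    proof eventually_elim
      case (elim x)
      have "(\<lambda>n. clamp B (g n x)) \<longlonglongrightarrow> clamp B (f x)"
        using continuous_on_tendsto_compose[OF continuous_on_clamp[OF B(1)] lim[OF elim]] by auto
      then have "(\<lambda>n. ct x *\<^sub>R clamp B (g n x)) \<longlonglongrightarrow> ct x *\<^sub>R f x"
        by (intro tendsto_intros) (simp add: clamp_id[OF B])
      moreover have "ct x *\<^sub>R f x = f x" using R[of x] ct(4)[of x] by (cases "norm x > R") auto
      ultimately show ?case by (simp add: h_def)
    qed
    then show "AE x in lborel. (\<lambda>n. h n x) \<longlonglongrightarrow> f x" by (simp add: AE_completion_iff)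
    show "AE x in lborel. norm (h n x - f x) \<le> norm (of_real (2 * B * indicator (cball 0 (R + 1)) x) :: complex)" for n
    proof (intro AE_I2)
      fix x :: 'a
      show "norm (h n x - f x) \<le> norm (of_real (2 * B * indicator (cball 0 (R + 1)) x) :: complex)"
        using norm_triangle_ineq4[of "h n x" "f x"] hB[of n x] B(2)[of x] h0[of x n] R[of x] B(1)
        by (cases "norm x \<le> R + 1") (auto simp: norm_mult)
    qed
  qed simp
  from LIMSEQ_D[OF this e] obtain n where "Lp_norm 2 (\<lambda>x. h n x - f x) < e" by auto
  then show ?thesis using hc hB h0 by blast
qed

lemma Lp2_continuous_dense:
  fixes f :: "'a::euclidean_space \<Rightarrow> complex"
  assumes f: "f \<in> Lp 2" and e: "e > 0"
  shows "\<exists>g B R. continuous_on UNIV g \<and> g \<in> Lp 2 \<and> (\<forall>x. norm (g x) \<le> B) \<and> (\<forall>x. norm x > R \<longrightarrow> g x = 0) \<and>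
     Lp_norm 2 (\<lambda>x. g x - f x) < e"
proof -
  note [measurable] = Lp_measurable[OF f]
  define t where "t n x = (if norm x \<le> real n \<and> norm (f x) \<le> real n then f x else 0)" for n x
  have tm [measurable]: "t n \<in> borel_measurable borel" for n unfolding t_def[abs_def] by measurable
  have "(\<lambda>n. Lp_norm 2 (\<lambda>x. t n x - f x)) \<longlonglongrightarrow> 0"
  proof (rule Lp2_dominated[OF tm Lp_measurable[OF f] f])
    show "AE x in lborel. (\<lambda>n. t n x) \<longlonglongrightarrow> f x"
    proof (intro AE_I2 tendsto_eventually)
      fix x
      obtain n0 where "max (norm x) (norm (f x)) \<le> real n0" using real_arch_simple by blast
      then show "\<forall>\<^sub>F n in sequentially. t n x = f x"
        unfolding eventually_sequentially t_def by (intro exI[of _ n0]) auto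
    qed
    show "AE x in lborel. norm (t n x - f x) \<le> norm (f x)" for n
      by (auto simp: t_def)
  qed
  from LIMSEQ_D[OF this, of "e/2"] e obtain n where n: "Lp_norm 2 (\<lambda>x. t n x - f x) < e/2" by auto
  have tL: "t n \<in> Lp 2" by (rule Lp2_mono(1)[OF f tm]) (auto simp: t_def)
  \<comment> \<open>\<open>n + 1\<close> is at once a positive bound for the values and the radius
    \<open>R + 1\<close>, with \<open>R = n\<close>, that the approximation delivers.\<close>
  define b where "b = real n + 1"
  have b0: "b \<ge> 0" by (simp add: b_def)
  obtain g where g: "continuous_on UNIV g" "\<And>x. norm (g x) \<le> b"
      "\<And>x. norm x > b \<Longrightarrow> g x = 0" "Lp_norm 2 (\<lambda>x. g x - t n x) < e/2"
  proof -
    have "norm (t n x) \<le> b" "norm x > real n \<Longrightarrow> t n x = 0" for x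
      by (auto simp: t_def b_def)
    then show ?thesis
      using Lp2_continuous_dense_aux[OF tm, of "b" n "real n" "e/2"] e that unfolding b_def by fastforce
  qed
  have gL: "g \<in> Lp 2"
  proof (rule Lp2_mono(1)[OF indicator_cball_Lp2[of "b" "b"]])
    show "g \<in> borel_measurable borel" by (intro borel_measurable_continuous_onI g)
    show "AE x in lborel. norm (g x) \<le> norm (of_real (b * indicator (cball 0 b) x) :: complex)"
      using g(2,3) b0 by (intro AE_I2) (auto simp: indicator_def norm_mult not_le)
  qed
  have "Lp_norm 2 (\<lambda>x. g x - f x) < e"
    using Lp_norm2_triangle_diff[OF gL tL f] g(4) n by simp
  then show ?thesis using g gL by blast
qed

text \<open>For continuous functions of compact support this is dominated convergence; a general
  \<open>f\<close> lies within \<open>e/3\<close> of such a function, and translation preserves the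
  norm.\<close>

lemma Lp2_translation_continuous:
  fixes f :: "'a::euclidean_space \<Rightarrow> complex"
  assumes f: "f \<in> Lp 2" and h: "h \<longlonglongrightarrow> 0"
  shows "(\<lambda>n. Lp_norm 2 (\<lambda>x. f (x + h n) - f x)) \<longlonglongrightarrow> 0"
proof (rule LIMSEQ_I)
  fix e :: real assume e: "e > 0"
  then obtain g B R where gc: "continuous_on UNIV g" and gL: "g \<in> Lp 2" and B: "\<And>x. norm (g x) \<le> B"
    and R: "\<And>x. norm x > R \<Longrightarrow> g x = 0" and ge: "Lp_norm 2 (\<lambda>x. g x - f x) < e/3"
    using Lp2_continuous_dense[OF f, of "e/3"] by auto
  have B0: "B \<ge> 0" using B[of 0] norm_ge_zero[of "g 0"] by linarith
  \<comment> \<open>A convergent sequence of shifts is bounded, so all translates of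
    \<open>g\<close> vanish outside one ball of radius \<open>R + K\<close>.\<close>
  obtain K where K: "\<And>n. norm (h n) \<le> K"
    using convergent_imp_Bseq[OF convergentI[OF h]] by (auto simp: Bseq_def)
  have shift: "(\<lambda>x. u (x + y)) \<in> Lp 2" "Lp_norm 2 (\<lambda>x. u (x + y)) = Lp_norm 2 u"
    if "u \<in> Lp 2" for u :: "'a \<Rightarrow> complex" and y
    using Lp_norm2_affine[OF that, of 1 y] by (simp_all add: add.commute)
  have gh: "continuous_on UNIV (\<lambda>x. g (x + h n))" for n
    by (rule continuous_on_compose2[OF gc]) (auto intro!: continuous_intros)
  have "(\<lambda>n. Lp_norm 2 (\<lambda>x. g (x + h n) - g x)) \<longlonglongrightarrow> 0"
  proof (rule Lp2_dominated[OF _ _ indicator_cball_Lp2[of "2*B" "R+K"]])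
    show "(\<lambda>x. g (x + h n)) \<in> borel_measurable borel" for n
      by (intro borel_measurable_continuous_onI gh)
    show "g \<in> borel_measurable borel" by (intro borel_measurable_continuous_onI gc)
    show "AE x in lborel. (\<lambda>n. g (x + h n)) \<longlonglongrightarrow> g x"
    proof (intro AE_I2)
      fix x
      have "(\<lambda>n. x + h n) \<longlonglongrightarrow> x + 0" by (intro tendsto_intros h)
      then show "(\<lambda>n. g (x + h n)) \<longlonglongrightarrow> g x"
        using continuous_on_tendsto_compose[OF gc, of "\<lambda>n. x + h n" x] by auto
    qed
    show "AE x in lborel. norm (g (x + h n) - g x) \<le> norm (of_real (2 * B * indicator (cball 0 (R + K)) x) :: complex)" for n
    proof (intro AE_I2)
      fix x :: 'a
      have "norm (x + h n) > R \<and> norm x > R" if "norm x > R + K"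
        using norm_diff_ineq[of x "h n"] K[of n] norm_ge_zero[of "h n"] that by linarith
      then show "norm (g (x + h n) - g x) \<le> norm (of_real (2 * B * indicator (cball 0 (R + K)) x) :: complex)"
        using norm_triangle_ineq4[of "g (x + h n)" "g x"] B[of "x + h n"] B[of x] R[of x] R[of "x + h n"] B0
        by (cases "norm x \<le> R + K") (auto simp: norm_mult)
    qed
  qed
  from LIMSEQ_D[OF this, of "e/3"] e obtain n0 where n0: "\<And>n. n \<ge> n0 \<Longrightarrow> Lp_norm 2 (\<lambda>x. g (x + h n) - g x) < e/3"
    by auto
  have "norm (Lp_norm 2 (\<lambda>x. f (x + h n) - f x) - 0) < e" if n: "n \<ge> n0" for n
  proof -
    have "Lp_norm 2 (\<lambda>x. f (x + h n) - f x)
        \<le> Lp_norm 2 (\<lambda>x. f (x + h n) - g (x + h n)) + Lp_norm 2 (\<lambda>x. g (x + h n) - f x)"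
      by (intro Lp_norm2_triangle_diff shift f gL)
    moreover have "Lp_norm 2 (\<lambda>x. g (x + h n) - f x)
        \<le> Lp_norm 2 (\<lambda>x. g (x + h n) - g x) + Lp_norm 2 (\<lambda>x. g x - f x)"
      by (intro Lp_norm2_triangle_diff shift f gL)
    moreover have "Lp_norm 2 (\<lambda>x. f (x + h n) - g (x + h n)) = Lp_norm 2 (\<lambda>x. g x - f x)"
      using shift(2)[OF Lp2_diff[OF f gL]] Lp_norm2_minus_commute[of f g] by simp
    ultimately show ?thesis using n0[OF n] ge by simp
  qed
  then show "\<exists>no. \<forall>n\<ge>no. norm (Lp_norm 2 (\<lambda>x. f (x + h n) - f x) - 0) < e" by blast
qed

section \<open>Gaussian summability and Plancherel's identity for integrable functions\<close>

lemma cnj_measurable [measurable]: "cnj \<in> borel_measurable borel"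
  by (intro borel_measurable_continuous_onI continuous_intros)

lemma gauss_le: "gauss z \<le> 1"
proof -
  have "gauss z \<le> 1 * 1"
    unfolding gauss_eq by (intro mult_mono twopi_powr_le) auto
  then show ?thesis by simp
qed

lemma FT_norm_bounded:
  fixes f :: "'a::euclidean_space \<Rightarrow> complex"
  assumes f: "integrable lborel f"
  obtains B where "B \<ge> 0" "\<And>\<xi>. norm (FT f \<xi>) \<le> B"
  using FT_bound[OF f] norm_ge_zero order_trans by metis

lemma Lp_norm2_diff_le:
  fixes f g :: "'a::euclidean_space \<Rightarrow> complex"
  assumes "f \<in> Lp 2" "g \<in> Lp 2"
  shows "Lp_norm 2 (\<lambda>x. f x - g x) \<le> Lp_norm 2 f + Lp_norm 2 g"
  using Lp_norm2_triangle[OF assms(1) Lp2_cmult[OF assms(2), of "-1"]] Lp_norm2_cmult[of "-1" g]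
  by simp

lemma gauss_weighted_integrable:
  fixes k :: "'a::euclidean_space \<Rightarrow> complex"
  assumes e: "\<epsilon> \<noteq> 0" and [measurable]: "k \<in> borel_measurable borel" and k: "\<And>\<xi>. norm (k \<xi>) \<le> B"
  shows "integrable lborel (\<lambda>\<xi>. of_real (gauss (\<epsilon> *\<^sub>R \<xi>)) * k \<xi>)"
proof (rule Bochner_Integration.integrable_bound)
  show "integrable lborel (\<lambda>\<xi>::'a. B * gauss (\<epsilon> *\<^sub>R \<xi>))"
    by (intro integrable_mult_right gauss_scaled_integrable e)
  have B: "B \<ge> 0" using k[of 0] norm_ge_zero[of "k 0"] by linarith
  show "AE \<xi> in lborel. norm (of_real (gauss (\<epsilon> *\<^sub>R \<xi>)) * k \<xi>) \<le> norm (B * gauss (\<epsilon> *\<^sub>R \<xi>))"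
    using k B by (auto simp: norm_mult mult.commute[of B] intro!: mult_left_mono)
qed simp

lemma gauss_translate_integrable:
  fixes f :: "'a::euclidean_space \<Rightarrow> complex"
  assumes f: "integrable lborel f" and e: "\<epsilon> \<noteq> 0"
  shows "integrable lborel (\<lambda>z. of_real (gauss z) * f (x + \<epsilon> *\<^sub>R z))"
proof (rule Bochner_Integration.integrable_bound)
  have [measurable]: "f \<in> borel_measurable borel" using f by auto
  show "integrable lborel (\<lambda>z. f (x + \<epsilon> *\<^sub>R z))"
  proof (rule integrableI_bounded)
    have "(\<integral>\<^sup>+z. ennreal (norm (f z)) \<partial>lborel) < \<infinity>"
      using f unfolding integrable_iff_bounded by simp
    also have "(\<integral>\<^sup>+z. ennreal (norm (f z)) \<partial>lborel) =
       ennreal (\<bar>\<epsilon>\<bar> ^ DIM('a)) * (\<integral>\<^sup>+z. ennreal (norm (f (x + \<epsilon> *\<^sub>R z))) \<partial>lborel)"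
      using e by (intro lborel_nn_integral_affine) auto
    finally show "(\<integral>\<^sup>+z. ennreal (norm (f (x + \<epsilon> *\<^sub>R z))) \<partial>lborel) < \<infinity>"
      using e by (auto simp: ennreal_mult_less_top)
  qed simp
  show "(\<lambda>z. of_real (gauss z) * f (x + \<epsilon> *\<^sub>R z)) \<in> borel_measurable lborel" by simp
  show "AE z in lborel. norm (of_real (gauss z) * f (x + \<epsilon> *\<^sub>R z)) \<le> norm (f (x + \<epsilon> *\<^sub>R z))"
    by (intro AE_I2) (simp add: norm_mult mult_left_le_one_le gauss_le)
qed

text \<open>Modulation by \<open>x\<close> becomes translation and dilation by \<epsilon> becomes
  contraction, so the transform is a Gaussian kernel of width \<epsilon> centred at
  \<open>x\<close>.\<close>

lemma FT_gauss_modulated: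
  fixes x y :: "'a::euclidean_space"
  assumes e: "\<epsilon> > 0"
  defines "c \<equiv> (2 * pi) powr (- real DIM('a) / 2)"
  shows "FT (\<lambda>\<xi>. of_real c * (of_real (gauss (\<epsilon> *\<^sub>R \<xi>)) * cis (\<xi> \<bullet> x))) y
    = of_real (c * gauss ((y - x) /\<^sub>R \<epsilon>) / \<epsilon> ^ DIM('a))"
proof -
  have "(LINT \<xi>|lborel. cis (- (\<xi> \<bullet> y)) * (of_real c * (of_real (gauss (\<epsilon> *\<^sub>R \<xi>)) * cis (\<xi> \<bullet> x))))
      = of_real c * (LINT \<xi>|lborel. of_real (gauss (\<epsilon> *\<^sub>R \<xi>)) * cis (- (\<xi> \<bullet> (y - x))))"
    by (subst integral_mult_right_zero[symmetric])
      (auto intro!: Bochner_Integration.integral_cong simp: inner_diff_right cis_mult mult_ac)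
  then show ?thesis
    unfolding FT_def gauss_scaled_fourier[OF e] gauss_eq[of "(y - x) /\<^sub>R \<epsilon>"] c_def[symmetric] by (simp add: mult_ac)
qed

text \<open>Fourier inversion regularised by a Gaussian. The multiplication formula moves the
  transform from \<open>f\<close> to the modulated Gaussian, whose transform is the kernel of a
  Gaussian mean of \<open>f\<close>. The factor \<open>c\<close> stays on both sides because
  \<open>gauss\<close> contains it.\<close>

lemma gauss_mean_inversion:
  fixes f :: "'a::euclidean_space \<Rightarrow> complex"
  assumes f: "integrable lborel f" and e: "\<epsilon> > 0"
  defines "c \<equiv> (2 * pi) powr (- real DIM('a) / 2)"
  shows "of_real c * (LINT \<xi>|lborel. cis (\<xi> \<bullet> x) * (of_real (gauss (\<epsilon> *\<^sub>R \<xi>)) * FT f \<xi>))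
    = of_real c * (LINT z|lborel. of_real (gauss z) * f (x + \<epsilon> *\<^sub>R z))"
proof -
  have [measurable]: "f \<in> borel_measurable borel" using f by auto
  have c: "c > 0" by (simp add: c_def)
  have "of_real c * (LINT \<xi>|lborel. cis (\<xi> \<bullet> x) * (of_real (gauss (\<epsilon> *\<^sub>R \<xi>)) * FT f \<xi>))
      = (LINT \<xi>|lborel. FT f \<xi> * (of_real c * (of_real (gauss (\<epsilon> *\<^sub>R \<xi>)) * cis (\<xi> \<bullet> x))))"
    by (subst integral_mult_right_zero[symmetric]) (simp only: mult_ac)
  also have "\<dots> = (LINT y|lborel. f y * FT (\<lambda>\<xi>. of_real c * (of_real (gauss (\<epsilon> *\<^sub>R \<xi>)) * cis (\<xi> \<bullet> x))) y)"
    using e by (intro FT_multiplication_formula f integrable_mult_right gauss_weighted_integrable[where B=1]) auto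
  also have "\<dots> = (LINT y|lborel. f y * of_real (c * gauss ((y - x) /\<^sub>R \<epsilon>) / \<epsilon> ^ DIM('a)))"
    unfolding c_def FT_gauss_modulated[OF e] ..
  also have "\<dots> = \<bar>\<epsilon>\<bar> ^ DIM('a) *\<^sub>R
     (LINT z|lborel. f (x + \<epsilon> *\<^sub>R z) * of_real (c * gauss ((x + \<epsilon> *\<^sub>R z - x) /\<^sub>R \<epsilon>) / \<epsilon> ^ DIM('a)))"
    using e by (intro lborel_integral_affine) auto
  also have "\<dots> = \<bar>\<epsilon>\<bar> ^ DIM('a) *\<^sub>R (of_real (c / \<epsilon> ^ DIM('a)) *
      (LINT z|lborel. of_real (gauss z) * f (x + \<epsilon> *\<^sub>R z)))"
    using e by (subst integral_mult_right_zero[symmetric]) (simp add: mult_ac)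
  also have "\<dots> = of_real c * (LINT z|lborel. of_real (gauss z) * f (x + \<epsilon> *\<^sub>R z))"
    using e by (simp add: scaleR_conv_of_real)
  finally show ?thesis .
qed

text \<open>The multiplication formula with the damped conjugate of \<open>FT f\<close> as second
  function leads back to the regularised inversion. Damping makes the integrals converge absolutely
  although \<open>FT f\<close> is so far only known to be bounded.\<close>

lemma gauss_weighted_energy:
  fixes f :: "'a::euclidean_space \<Rightarrow> complex"
  assumes f: "integrable lborel f" and e: "\<epsilon> > 0"
  shows "(LINT \<xi>|lborel. complex_of_real ((norm (FT f \<xi>))\<^sup>2 * exp (- (norm (\<epsilon> *\<^sub>R \<xi>))\<^sup>2 / 2)))
    = (LINT x|lborel. f x * cnj (LINT z|lborel. of_real (gauss z) * f (x + \<epsilon> *\<^sub>R z)))"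
proof -
  have [measurable]: "f \<in> borel_measurable borel" using f by auto
  define c where "c = (2 * pi) powr (- real DIM('a) / 2)"
  have c: "c > 0" by (simp add: c_def)
  obtain B where B: "\<And>\<xi>. norm (FT f \<xi>) \<le> B" using FT_norm_bounded[OF f] by metis
  have "of_real c * (LINT \<xi>|lborel. complex_of_real ((norm (FT f \<xi>))\<^sup>2 * exp (- (norm (\<epsilon> *\<^sub>R \<xi>))\<^sup>2 / 2)))
      = (LINT \<xi>|lborel. FT f \<xi> * (of_real (gauss (\<epsilon> *\<^sub>R \<xi>)) * cnj (FT f \<xi>)))"
    unfolding gauss_eq c_def[symmetric]
    by (subst integral_mult_right_zero[symmetric])
      (intro Bochner_Integration.integral_cong refl, simp add: complex_norm_square mult_ac del: of_real_power)
  also have "\<dots> = (LINT x|lborel. f x * FT (\<lambda>\<xi>. of_real (gauss (\<epsilon> *\<^sub>R \<xi>)) * cnj (FT f \<xi>)) x)"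
    using e B by (intro FT_multiplication_formula f gauss_weighted_integrable[where B=B]) auto
  also have "\<dots> = (LINT x|lborel. f x * cnj (of_real c * (LINT \<xi>|lborel. cis (\<xi> \<bullet> x) * (of_real (gauss (\<epsilon> *\<^sub>R \<xi>)) * FT f \<xi>))))"
  proof (intro Bochner_Integration.integral_cong refl arg_cong2[where f="(*)"])
    fix x
    show "FT (\<lambda>\<xi>. of_real (gauss (\<epsilon> *\<^sub>R \<xi>)) * cnj (FT f \<xi>)) x
      = cnj (of_real c * (LINT \<xi>|lborel. cis (\<xi> \<bullet> x) * (of_real (gauss (\<epsilon> *\<^sub>R \<xi>)) * FT f \<xi>)))"
      unfolding FT_def[of "\<lambda>\<xi>. of_real (gauss (\<epsilon> *\<^sub>R \<xi>)) * cnj (FT f \<xi>)"] c_def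
      by (simp add: Bochner_Integration.integral_cnj[symmetric] cis_cnj del: Bochner_Integration.integral_cnj)
  qed
  also have "\<dots> = (LINT x|lborel. f x * cnj (of_real c * (LINT z|lborel. of_real (gauss z) * f (x + \<epsilon> *\<^sub>R z))))"
    unfolding c_def gauss_mean_inversion[OF f e] ..
  also have "\<dots> = of_real c * (LINT x|lborel. f x * cnj (LINT z|lborel. of_real (gauss z) * f (x + \<epsilon> *\<^sub>R z)))"
    by (subst integral_mult_right_zero[symmetric]) (simp add: mult_ac)
  finally show ?thesis using c by simp
qed

text \<open>The difference is the double integral of \<open>f x\<close> times the conjugate of
  \<open>gauss z * (f (x + eps z) - f x)\<close>. Cauchy-Schwarz in \<open>x\<close> for each fixed
  \<open>z\<close> reduces it to the L^2 modulus of continuity of \<open>f\<close>.\<close>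

lemma gauss_mean_error:
  fixes f :: "'a::euclidean_space \<Rightarrow> complex"
  assumes f: "integrable lborel f" and f2: "f \<in> Lp 2" and e: "\<epsilon> > 0"
  shows "norm ((LINT x|lborel. f x * cnj (LINT z|lborel. of_real (gauss z) * f (x + \<epsilon> *\<^sub>R z))) - of_real ((Lp_norm 2 f)\<^sup>2))
    \<le> Lp_norm 2 f * (LINT z|lborel. gauss z * Lp_norm 2 (\<lambda>x. f (x + \<epsilon> *\<^sub>R z) - f x))"
    and "integrable lborel (\<lambda>z. gauss z * Lp_norm 2 (\<lambda>x. f (x + \<epsilon> *\<^sub>R z) - f x))"
proof -
  have [measurable]: "f \<in> borel_measurable borel" using f by auto
  define A where "A x = (LINT z|lborel. of_real (gauss z) * f (x + \<epsilon> *\<^sub>R z))" for x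
  define D where "D z = Lp_norm 2 (\<lambda>x. f (x + \<epsilon> *\<^sub>R z) - f x)" for z
  have Am [measurable]: "A \<in> borel_measurable borel" unfolding A_def[abs_def] by measurable
  have Dm [measurable]: "D \<in> borel_measurable borel" unfolding D_def[abs_def] Lp_norm2_eq by measurable
  have tL: "(\<lambda>x. f (x + \<epsilon> *\<^sub>R z)) \<in> Lp 2" and tn: "Lp_norm 2 (\<lambda>x. f (x + \<epsilon> *\<^sub>R z)) = Lp_norm 2 f" for z
    using Lp_norm2_affine[OF f2, of 1 "\<epsilon> *\<^sub>R z"] by (simp_all add: add.commute)
  have D0: "D z \<ge> 0" and D2: "D z \<le> 2 * Lp_norm 2 f" for z
    unfolding D_def using Lp_norm2_diff_le[OF tL f2] tn[of z] by (simp_all add: tn)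
  show gD: "integrable lborel (\<lambda>z. gauss z * Lp_norm 2 (\<lambda>x. f (x + \<epsilon> *\<^sub>R z) - f x))"
    unfolding D_def[symmetric]
  proof (rule Bochner_Integration.integrable_bound)
    show "integrable lborel (\<lambda>z::'a. gauss z * (2 * Lp_norm 2 f))"
      by (intro integrable_mult_left gauss_integrable)
    show "AE z in lborel. norm (gauss z * D z) \<le> norm (gauss z * (2 * Lp_norm 2 f))"
      using D0 D2 by (auto simp: abs_mult intro!: mult_left_mono)
  qed simp
  define b where "b = Lp_norm 2 f * (LINT z|lborel. gauss z * D z)"
  have b0: "b \<ge> 0" unfolding b_def using D0 by (intro mult_nonneg_nonneg integral_nonneg_AE) auto
  have diff: "A x - f x = (LINT z|lborel. of_real (gauss z) * (f (x + \<epsilon> *\<^sub>R z) - f x))" for x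
  proof -
    have "(LINT z|lborel. complex_of_real (gauss z) * f x) = f x"
      by (simp add: gauss_integral)
    moreover have "integrable lborel (\<lambda>z. complex_of_real (gauss z) * f x)"
      by (intro integrable_mult_left integrable_of_real gauss_integrable)
    ultimately show ?thesis
      using gauss_translate_integrable[OF f, of \<epsilon> x] e
      unfolding A_def right_diff_distrib by (subst Bochner_Integration.integral_diff) auto
  qed
  have di: "integrable lborel (\<lambda>z. complex_of_real (gauss z) * (f (x + \<epsilon> *\<^sub>R z) - f x))" for x
    unfolding right_diff_distrib using e
    by (intro Bochner_Integration.integrable_diff gauss_translate_integrable f integrable_mult_left integrable_of_real gauss_integrable) auto
  have dle: "ennreal (norm (A x - f x)) \<le> (\<integral>\<^sup>+z. ennreal (gauss z * norm (f (x + \<epsilon> *\<^sub>R z) - f x)) \<partial>lborel)" for x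
    unfolding diff by (rule order_trans[OF integral_norm_bound_ennreal[OF di]]) (simp add: norm_mult)
  have "(\<integral>\<^sup>+x. ennreal (norm (f x * cnj (A x - f x))) \<partial>lborel)
     \<le> (\<integral>\<^sup>+x. \<integral>\<^sup>+z. ennreal (norm (f x) * (gauss z * norm (f (x + \<epsilon> *\<^sub>R z) - f x))) \<partial>lborel \<partial>lborel)"
  proof (rule nn_integral_mono)
    fix x
    have "ennreal (norm (f x * cnj (A x - f x))) = ennreal (norm (f x)) * ennreal (norm (A x - f x))"
      by (simp add: norm_mult ennreal_mult complex_mod_cnj flip: complex_cnj_diff)
    also have "\<dots> \<le> ennreal (norm (f x)) * (\<integral>\<^sup>+z. ennreal (gauss z * norm (f (x + \<epsilon> *\<^sub>R z) - f x)) \<partial>lborel)"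
      by (intro mult_left_mono dle) simp
    also have "\<dots> = (\<integral>\<^sup>+z. ennreal (norm (f x) * (gauss z * norm (f (x + \<epsilon> *\<^sub>R z) - f x))) \<partial>lborel)"
      by (subst nn_integral_cmult[symmetric]) (auto simp: ennreal_mult)
    finally show "ennreal (norm (f x * cnj (A x - f x)))
      \<le> (\<integral>\<^sup>+z. ennreal (norm (f x) * (gauss z * norm (f (x + \<epsilon> *\<^sub>R z) - f x))) \<partial>lborel)" .
  qed
  also have "\<dots> = (\<integral>\<^sup>+z. \<integral>\<^sup>+x. ennreal (norm (f x) * (gauss z * norm (f (x + \<epsilon> *\<^sub>R z) - f x))) \<partial>lborel \<partial>lborel)"
    by (rule lborel_pair.Fubini') simp
  also have "\<dots> \<le> (\<integral>\<^sup>+z. ennreal (Lp_norm 2 f * (gauss z * D z)) \<partial>lborel)"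
  proof (rule nn_integral_mono)
    fix z
    have dL: "(\<lambda>x. f (x + \<epsilon> *\<^sub>R z) - f x) \<in> Lp 2" by (intro Lp2_diff tL f2)
    have "(\<integral>\<^sup>+x. ennreal (norm (f x) * (gauss z * norm (f (x + \<epsilon> *\<^sub>R z) - f x))) \<partial>lborel)
       = ennreal (gauss z * (LINT x|lborel. norm (f x) * norm (f (x + \<epsilon> *\<^sub>R z) - f x)))"
      using Lp2_Cauchy_Schwarz(1)[OF f2 dL]
      by (subst integral_mult_right_zero[symmetric], subst nn_integral_eq_integral[symmetric])
        (auto simp: mult_ac)
    also have "\<dots> \<le> ennreal (gauss z * (Lp_norm 2 f * D z))"
      unfolding D_def by (intro ennreal_leI mult_left_mono Lp2_Cauchy_Schwarz(2)[OF f2 dL]) simp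
    finally show "(\<integral>\<^sup>+x. ennreal (norm (f x) * (gauss z * norm (f (x + \<epsilon> *\<^sub>R z) - f x))) \<partial>lborel)
      \<le> ennreal (Lp_norm 2 f * (gauss z * D z))" by (simp add: mult_ac)
  qed
  also have "\<dots> = ennreal b"
    unfolding b_def using gD D0
    by (subst integral_mult_right_zero[symmetric], intro nn_integral_eq_integral) (auto simp: D_def)
  finally have nb: "(\<integral>\<^sup>+x. ennreal (norm (f x * cnj (A x - f x))) \<partial>lborel) \<le> ennreal b" .
  have i1: "integrable lborel (\<lambda>x. f x * cnj (A x - f x))"
    by (rule integrableI_bounded) (use nb in \<open>auto simp: le_less_trans\<close>)
  have i2: "integrable lborel (\<lambda>x. complex_of_real ((norm (f x))\<^sup>2))"
    unfolding complex_of_real_integrable_eq using f2 by (simp add: Lp2_iff)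
  have "(LINT x|lborel. f x * cnj (A x)) = (LINT x|lborel. f x * cnj (A x - f x) + complex_of_real ((norm (f x))\<^sup>2))"
    by (intro Bochner_Integration.integral_cong refl) (simp add: complex_norm_square algebra_simps del: of_real_power)
  also have "\<dots> = (LINT x|lborel. f x * cnj (A x - f x)) + of_real ((Lp_norm 2 f)\<^sup>2)"
    unfolding Lp_norm2_power2 integral_complex_of_real[symmetric] by (rule Bochner_Integration.integral_add[OF i1 i2])
  finally have "norm ((LINT x|lborel. f x * cnj (A x)) - of_real ((Lp_norm 2 f)\<^sup>2)) = norm (LINT x|lborel. f x * cnj (A x - f x))"
    by simp
  also have "ennreal \<dots> \<le> ennreal b"
    using order_trans[OF integral_norm_bound_ennreal[OF i1] nb] .
  finally show "norm ((LINT x|lborel. f x * cnj (LINT z|lborel. of_real (gauss z) * f (x + \<epsilon> *\<^sub>R z))) - of_real ((Lp_norm 2 f)\<^sup>2))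
    \<le> Lp_norm 2 f * (LINT z|lborel. gauss z * Lp_norm 2 (\<lambda>x. f (x + \<epsilon> *\<^sub>R z) - f x))"
    using b0 unfolding A_def b_def D_def by (simp add: ennreal_le_iff)
qed

text \<open>The width \<epsilon> of the Gaussian tends to 0 in the weighted energy identity. On the
  frequency side the weights increase to 1, and monotone convergence yields integrability along with
  the value; on the other side the error vanishes because translation is continuous in L^2.\<close>

proposition Plancherel_L1_L2:
  fixes f :: "'a::euclidean_space \<Rightarrow> complex"
  assumes f: "integrable lborel f" and f2: "f \<in> Lp 2"
  shows "FT f \<in> Lp 2" "Lp_norm 2 (FT f) = Lp_norm 2 f"
proof -
  have [measurable]: "f \<in> borel_measurable borel" using f by auto
  \<comment> \<open>A decreasing sequence, so that the Gaussian weights increase, as monotone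
    convergence requires.\<close>
  define \<epsilon> where "\<epsilon> n = 1 / real (Suc n)" for n
  have e: "\<epsilon> n > 0" for n by (simp add: \<epsilon>_def)
  have e0: "\<epsilon> \<longlonglongrightarrow> 0" unfolding \<epsilon>_def[abs_def] by (rule lim_1_over_n[THEN LIMSEQ_Suc])
  define D where "D n z = Lp_norm 2 (\<lambda>x. f (x + \<epsilon> n *\<^sub>R z) - f x)" for n z
  define J where "J n = (LINT \<xi>|lborel. (norm (FT f \<xi>))\<^sup>2 * exp (- (norm (\<epsilon> n *\<^sub>R \<xi>))\<^sup>2 / 2))" for n
  have Dm [measurable]: "D n \<in> borel_measurable borel" for n
    unfolding D_def[abs_def] Lp_norm2_eq by measurable
  have tL: "(\<lambda>x. f (x + y)) \<in> Lp 2" and tn: "Lp_norm 2 (\<lambda>x. f (x + y)) = Lp_norm 2 f" for y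
    using Lp_norm2_affine[OF f2, of 1 y] by (simp_all add: add.commute)
  have D0: "D n z \<ge> 0" and D2: "D n z \<le> 2 * Lp_norm 2 f" for n z
    unfolding D_def using Lp_norm2_diff_le[OF tL f2] tn[of "\<epsilon> n *\<^sub>R z"] by (simp_all add: tn)
  have "(\<lambda>n. LINT z|lborel. gauss z * D n z) \<longlonglongrightarrow> (LINT z|(lborel::'a measure). 0)"
  proof (rule integral_dominated_convergence[where w="\<lambda>z. gauss z * (2 * Lp_norm 2 f)"])
    show "integrable lborel (\<lambda>z::'a. gauss z * (2 * Lp_norm 2 f))"
      by (intro integrable_mult_left gauss_integrable)
    show "AE z in lborel. norm (gauss z * D n z) \<le> gauss z * (2 * Lp_norm 2 f)" for n
      using D0 D2 by (auto simp: abs_mult intro!: mult_left_mono)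
    show "AE z in lborel. (\<lambda>n. gauss z * D n z) \<longlonglongrightarrow> 0"
    proof (intro AE_I2 tendsto_mult_right_zero)
      fix z :: 'a
      have "(\<lambda>n. \<epsilon> n *\<^sub>R z) \<longlonglongrightarrow> 0" using tendsto_scaleR[OF e0 tendsto_const[of z]] by simp
      from Lp2_translation_continuous[OF f2 this] show "(\<lambda>n. D n z) \<longlonglongrightarrow> 0" by (simp add: D_def)
    qed
  qed simp_all
  then have "(\<lambda>n. Lp_norm 2 f * (LINT z|lborel. gauss z * D n z)) \<longlonglongrightarrow> 0"
    by (intro tendsto_mult_right_zero) simp
  then have L0: "(\<lambda>n. Lp_norm 2 f * (LINT z|lborel. gauss z * D n z)) \<longlonglongrightarrow> 0" .
  have "norm (J n - (Lp_norm 2 f)\<^sup>2) \<le> Lp_norm 2 f * (LINT z|lborel. gauss z * D n z)" for n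
  proof -
    have "norm (J n - (Lp_norm 2 f)\<^sup>2) = norm (complex_of_real (J n) - of_real ((Lp_norm 2 f)\<^sup>2))"
      by (simp only: of_real_diff[symmetric] norm_of_real real_norm_def)
    moreover have "complex_of_real (J n) = (LINT x|lborel. f x * cnj (LINT z|lborel. of_real (gauss z) * f (x + \<epsilon> n *\<^sub>R z)))"
      unfolding J_def integral_complex_of_real[symmetric] by (rule gauss_weighted_energy[OF f e])
    ultimately show ?thesis
      unfolding D_def using gauss_mean_error(1)[OF f f2 e[of n]] by (simp only:)
  qed
  then have "(\<lambda>n. J n - (Lp_norm 2 f)\<^sup>2) \<longlonglongrightarrow> 0"
    by (intro Lim_null_comparison[OF _ L0] always_eventually allI)
  then have "J \<longlonglongrightarrow> (Lp_norm 2 f)\<^sup>2" by (simp add: LIM_zero_iff)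
  then have JL: "(\<lambda>n. ennreal (J n)) \<longlonglongrightarrow> ennreal ((Lp_norm 2 f)\<^sup>2)" by (rule tendsto_ennrealI)
  have nnJ: "(\<integral>\<^sup>+\<xi>. ennreal ((norm (FT f \<xi>))\<^sup>2 * exp (- (norm (\<epsilon> n *\<^sub>R \<xi>))\<^sup>2 / 2)) \<partial>lborel) = ennreal (J n)" for n
    unfolding J_def
  proof (intro nn_integral_eq_integral)
    obtain B where B: "\<And>\<xi>. norm (FT f \<xi>) \<le> B" using FT_norm_bounded[OF f] by metis
    have B': "norm (complex_of_real ((norm (FT f \<xi>))\<^sup>2)) \<le> B\<^sup>2" for \<xi>
      using power_mono[OF B, of \<xi> 2] by (simp add: norm_power)
    define c where "c = (2 * pi) powr (- real DIM('a) / 2)"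
    have c: "c > 0" by (simp add: c_def)
    have "integrable lborel (\<lambda>\<xi>. complex_of_real (gauss (\<epsilon> n *\<^sub>R \<xi>)) * complex_of_real ((norm (FT f \<xi>))\<^sup>2))"
      using e[of n] B' by (intro gauss_weighted_integrable[where B="B\<^sup>2"]) auto
    then have "integrable lborel (\<lambda>\<xi>. gauss (\<epsilon> n *\<^sub>R \<xi>) * (norm (FT f \<xi>))\<^sup>2)"
      unfolding of_real_mult[symmetric] complex_of_real_integrable_eq .
    then have "integrable lborel (\<lambda>\<xi>. (gauss (\<epsilon> n *\<^sub>R \<xi>) * (norm (FT f \<xi>))\<^sup>2) / c)" by simp
    then show "integrable lborel (\<lambda>\<xi>. (norm (FT f \<xi>))\<^sup>2 * exp (- (norm (\<epsilon> n *\<^sub>R \<xi>))\<^sup>2 / 2))"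
      unfolding gauss_eq c_def[symmetric] using c by (simp add: mult_ac)
  qed simp
  have "(\<lambda>n. \<integral>\<^sup>+\<xi>. ennreal ((norm (FT f \<xi>))\<^sup>2 * exp (- (norm (\<epsilon> n *\<^sub>R \<xi>))\<^sup>2 / 2)) \<partial>lborel)
     \<longlonglongrightarrow> (\<integral>\<^sup>+\<xi>. ennreal ((norm (FT f \<xi>))\<^sup>2) \<partial>lborel)"
  proof (rule nn_integral_LIMSEQ)
    have *: "exp (- (norm (\<epsilon> m *\<^sub>R \<xi>))\<^sup>2 / 2) \<le> exp (- (norm (\<epsilon> n *\<^sub>R \<xi>))\<^sup>2 / 2)" if "m \<le> n" for m n and \<xi> :: 'a
    proof -
      have "\<epsilon> n \<le> \<epsilon> m" using that by (simp add: \<epsilon>_def frac_le)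
      then have "norm (\<epsilon> n *\<^sub>R \<xi>) \<le> norm (\<epsilon> m *\<^sub>R \<xi>)"
        using e[of n] e[of m] by (simp add: mult_right_mono)
      then have "(norm (\<epsilon> n *\<^sub>R \<xi>))\<^sup>2 \<le> (norm (\<epsilon> m *\<^sub>R \<xi>))\<^sup>2" by (rule power_mono) simp
      then show ?thesis by simp
    qed
    show "incseq (\<lambda>n \<xi>. ennreal ((norm (FT f \<xi>))\<^sup>2 * exp (- (norm (\<epsilon> n *\<^sub>R \<xi>))\<^sup>2 / 2)))"
      unfolding incseq_def le_fun_def by (intro allI impI ennreal_leI mult_left_mono *) auto
    show "(\<lambda>n. ennreal ((norm (FT f \<xi>))\<^sup>2 * exp (- (norm (\<epsilon> n *\<^sub>R \<xi>))\<^sup>2 / 2))) \<longlonglongrightarrow> ennreal ((norm (FT f \<xi>))\<^sup>2)" for \<xi>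
    proof (rule tendsto_ennrealI)
      have "(\<lambda>n. (norm (FT f \<xi>))\<^sup>2 * exp (- (norm (\<epsilon> n *\<^sub>R \<xi>))\<^sup>2 / 2))
         \<longlonglongrightarrow> (norm (FT f \<xi>))\<^sup>2 * exp (- (norm (0 *\<^sub>R \<xi>))\<^sup>2 / 2)"
        by (intro tendsto_intros e0) simp
      then show "(\<lambda>n. (norm (FT f \<xi>))\<^sup>2 * exp (- (norm (\<epsilon> n *\<^sub>R \<xi>))\<^sup>2 / 2)) \<longlonglongrightarrow> (norm (FT f \<xi>))\<^sup>2"
        by simp
    qed
  qed simp
  from LIMSEQ_unique[OF this JL[folded nnJ]]
  have *: "(\<integral>\<^sup>+\<xi>. ennreal ((norm (FT f \<xi>))\<^sup>2) \<partial>lborel) = ennreal ((Lp_norm 2 f)\<^sup>2)" .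
  show L: "FT f \<in> Lp 2" using * by (intro Lp2_boundI[where c="Lp_norm 2 f"]) auto
  show "Lp_norm 2 (FT f) = Lp_norm 2 f" using nn_integral_Lp2[OF L] unfolding * by simp
qed

section \<open>The transform of square integrable functions\<close>

definition trunc :: "real \<Rightarrow> ('a::euclidean_space \<Rightarrow> complex) \<Rightarrow> 'a \<Rightarrow> complex" where
  "trunc R f x = indicator (cball 0 R) x *\<^sub>R f x"

lemma fourier_trunc_eq_FT: "fourier_trunc R f = FT (trunc R f)"
  unfolding fourier_trunc_def FT_def trunc_def set_lebesgue_integral_def fun_eq_iff
  by (simp add: scaleR_conv_of_real mult_ac)

lemma trunc_measurable [measurable]:
  assumes [measurable]: "f \<in> borel_measurable borel"
  shows "trunc R f \<in> borel_measurable borel"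
proof -
  have [measurable]: "cball (0::'a) R \<in> sets borel" by simp
  show ?thesis unfolding trunc_def[abs_def] by measurable
qed

lemma trunc_Lp2:
  fixes f :: "'a::euclidean_space \<Rightarrow> complex"
  assumes f: "f \<in> Lp 2"
  shows "trunc R f \<in> Lp 2"
  using Lp_measurable[OF f]
  by (intro Lp2_mono(1)[OF f]) (auto simp: trunc_def indicator_def)

lemma trunc_integrable:
  fixes f :: "'a::euclidean_space \<Rightarrow> complex"
  assumes f: "f \<in> Lp 2"
  shows "integrable lborel (trunc R f)"
proof (rule Bochner_Integration.integrable_bound)
  show "integrable lborel (\<lambda>x. norm (f x) * norm (complex_of_real (1 * indicator (cball 0 R) x)))"
    by (rule Lp2_Cauchy_Schwarz(1)[OF f indicator_cball_Lp2])
  show "trunc R f \<in> borel_measurable lborel" using Lp_measurable[OF f] by simp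
qed (auto simp: trunc_def indicator_def)

lemma trunc_Lp2_limit:
  fixes f :: "'a::euclidean_space \<Rightarrow> complex"
  assumes f: "f \<in> Lp 2"
  shows "((\<lambda>R. Lp_norm 2 (\<lambda>x. f x - trunc R f x)) \<longlongrightarrow> 0) at_top"
proof (rule tendsto_at_topI_sequentially)
  fix X :: "nat \<Rightarrow> real" assume X: "filterlim X at_top sequentially"
  have "(\<lambda>n. Lp_norm 2 (\<lambda>x. trunc (X n) f x - f x)) \<longlonglongrightarrow> 0"
  proof (rule Lp2_dominated[OF _ Lp_measurable[OF f] f])
    show "trunc (X n) f \<in> borel_measurable borel" for n
      using Lp_measurable[OF f] by simp
    show "AE x in lborel. (\<lambda>n. trunc (X n) f x) \<longlonglongrightarrow> f x"
    proof (intro AE_I2 tendsto_eventually)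
      fix x :: 'a
      have "\<forall>\<^sub>F n in sequentially. norm x \<le> X n" using X by (simp add: filterlim_at_top)
      then show "\<forall>\<^sub>F n in sequentially. trunc (X n) f x = f x"
        by eventually_elim (simp add: trunc_def)
    qed
    show "AE x in lborel. norm (trunc (X n) f x - f x) \<le> norm (f x)" for n
      by (auto simp: trunc_def indicator_def)
  qed
  then show "(\<lambda>n. Lp_norm 2 (\<lambda>x. f x - trunc (X n) f x)) \<longlonglongrightarrow> 0"
    by (simp only: Lp_norm2_minus_commute)
qed

lemma FT_diff:
  fixes f g :: "'a::euclidean_space \<Rightarrow> complex"
  assumes "integrable lborel f" "integrable lborel g"
  shows "FT (\<lambda>x. f x - g x) \<xi> = FT f \<xi> - FT g \<xi>"
  using cis_mult_integrable[OF assms(1)] cis_mult_integrable[OF assms(2)]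
  by (simp add: FT_def right_diff_distrib)

lemma FT_norm_diff:
  fixes f g :: "'a::euclidean_space \<Rightarrow> complex"
  assumes "integrable lborel f" "integrable lborel g" "f \<in> Lp 2" "g \<in> Lp 2"
  shows "Lp_norm 2 (\<lambda>\<xi>. FT f \<xi> - FT g \<xi>) = Lp_norm 2 (\<lambda>x. f x - g x)"
proof -
  have "Lp_norm 2 (FT (\<lambda>x. f x - g x)) = Lp_norm 2 (\<lambda>x. f x - g x)"
    using assms by (intro Plancherel_L1_L2(2) Bochner_Integration.integrable_diff Lp2_diff)
  moreover have "FT (\<lambda>x. f x - g x) = (\<lambda>\<xi>. FT f \<xi> - FT g \<xi>)"
    using FT_diff[OF assms(1,2)] by auto
  ultimately show ?thesis by simp
qed

lemma has_fourierD:
  assumes "has_fourier f F"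
  shows "f \<in> Lp 2" "F \<in> Lp 2" "((\<lambda>R. Lp_norm 2 (\<lambda>\<xi>. F \<xi> - FT (trunc R f) \<xi>)) \<longlongrightarrow> 0) at_top"
  using assms by (auto simp: has_fourier_def fourier_trunc_eq_FT)

lemma FT_trunc_Lp2: "f \<in> Lp 2 \<Longrightarrow> FT (trunc R f) \<in> Lp 2"
  by (intro Plancherel_L1_L2(1) trunc_integrable trunc_Lp2)

text \<open>Plancherel's identity carries the Cauchy property of the truncations over to their
  transforms. The limit is found along integer radii, whereas the definition asks for all real
  radii.\<close>

lemma has_fourier_exists:
  fixes f :: "'a::euclidean_space \<Rightarrow> complex"
  assumes f: "f \<in> Lp 2"
  shows "\<exists>F. has_fourier f F"
proof -
  define \<psi> where "\<psi> R = Lp_norm 2 (\<lambda>x. f x - trunc R f x)" for R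
  have \<psi>: "(\<psi> \<longlongrightarrow> 0) at_top" unfolding \<psi>_def by (rule trunc_Lp2_limit[OF f])
  have d: "Lp_norm 2 (\<lambda>\<xi>. FT (trunc R f) \<xi> - FT (trunc S f) \<xi>) \<le> \<psi> R + \<psi> S" for R S
    using Lp_norm2_triangle_diff[OF trunc_Lp2[OF f] f trunc_Lp2[OF f], of R S]
      Lp_norm2_minus_commute[of "trunc R f" f]
    by (simp add: FT_norm_diff trunc_integrable trunc_Lp2 f \<psi>_def)
  have \<psi>n: "(\<lambda>n. \<psi> (real n)) \<longlonglongrightarrow> 0"
    using filterlim_compose[OF \<psi> filterlim_real_sequentially] .
  have "\<exists>F\<in>Lp 2. (\<lambda>n. Lp_norm 2 (\<lambda>\<xi>. FT (trunc (real n) f) \<xi> - F \<xi>)) \<longlonglongrightarrow> 0"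
  proof (rule Lp2_complete)
    fix e :: real assume "e > 0"
    then obtain N where "\<And>n. n \<ge> N \<Longrightarrow> \<bar>\<psi> (real n)\<bar> < e/2"
      using LIMSEQ_D[OF \<psi>n, of "e/2"] by auto
    then have "\<psi> (real m) + \<psi> (real n) < e" if "m \<ge> N" "n \<ge> N" for m n
      using that by (smt (verit) field_sum_of_halves)
    then show "\<exists>N. \<forall>m\<ge>N. \<forall>n\<ge>N. Lp_norm 2 (\<lambda>\<xi>. FT (trunc (real m) f) \<xi> - FT (trunc (real n) f) \<xi>) < e"
      using d by (meson order_le_less_trans)
  qed (rule FT_trunc_Lp2[OF f])
  then obtain F where F: "F \<in> Lp 2" and lim: "(\<lambda>n. Lp_norm 2 (\<lambda>\<xi>. FT (trunc (real n) f) \<xi> - F \<xi>)) \<longlonglongrightarrow> 0"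
    by blast
  \<comment> \<open>Letting the integer radius \<open>n\<close> tend to infinity with
    \<open>R\<close> fixed extends the convergence from integer to real radii.\<close>
  have "Lp_norm 2 (\<lambda>\<xi>. F \<xi> - FT (trunc R f) \<xi>) \<le> \<psi> R" for R
  proof (rule LIMSEQ_le_const)
    show "(\<lambda>n. Lp_norm 2 (\<lambda>\<xi>. FT (trunc (real n) f) \<xi> - F \<xi>) + (\<psi> (real n) + \<psi> R)) \<longlonglongrightarrow> \<psi> R"
      using tendsto_add[OF lim tendsto_add[OF \<psi>n tendsto_const[of "\<psi> R"]]] by simp
    have "Lp_norm 2 (\<lambda>\<xi>. F \<xi> - FT (trunc R f) \<xi>)
        \<le> Lp_norm 2 (\<lambda>\<xi>. FT (trunc (real n) f) \<xi> - F \<xi>) + (\<psi> (real n) + \<psi> R)" for n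
      using Lp_norm2_triangle_diff[OF F FT_trunc_Lp2[OF f, of "real n"] FT_trunc_Lp2[OF f, of R]] d[of "real n" R]
        Lp_norm2_minus_commute[of F "FT (trunc (real n) f)"] by linarith
    then show "\<exists>N. \<forall>n\<ge>N. Lp_norm 2 (\<lambda>\<xi>. F \<xi> - FT (trunc R f) \<xi>)
        \<le> Lp_norm 2 (\<lambda>\<xi>. FT (trunc (real n) f) \<xi> - F \<xi>) + (\<psi> (real n) + \<psi> R)" by blast
  qed
  then have "((\<lambda>R. Lp_norm 2 (\<lambda>\<xi>. F \<xi> - FT (trunc R f) \<xi>)) \<longlongrightarrow> 0) at_top"
    by (intro Lim_null_comparison[OF _ \<psi>] always_eventually allI) simp
  then show ?thesis using f F by (auto simp: has_fourier_def fourier_trunc_eq_FT)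
qed

lemma Lp_norm2_tendsto:
  fixes f :: "'b \<Rightarrow> 'a::euclidean_space \<Rightarrow> complex"
  assumes f: "\<And>n. f n \<in> Lp 2" and g: "g \<in> Lp 2"
    and lim: "((\<lambda>n. Lp_norm 2 (\<lambda>x. g x - f n x)) \<longlongrightarrow> 0) F"
  shows "((\<lambda>n. Lp_norm 2 (f n)) \<longlongrightarrow> Lp_norm 2 g) F"
proof -
  have "((\<lambda>n. Lp_norm 2 g - Lp_norm 2 (f n)) \<longlongrightarrow> 0) F"
    using Lp_norm2_diff_abs[OF g f] by (intro Lim_null_comparison[OF _ lim] always_eventually allI) simp
  from tendsto_diff[OF tendsto_const[of "Lp_norm 2 g"] this] show ?thesis by simp
qed

lemma has_fourier_norm:
  fixes f :: "'a::euclidean_space \<Rightarrow> complex"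
  assumes "has_fourier f F"
  shows "Lp_norm 2 F = Lp_norm 2 f"
proof -
  note h = has_fourierD[OF assms]
  have "((\<lambda>R. Lp_norm 2 (FT (trunc R f))) \<longlongrightarrow> Lp_norm 2 F) at_top"
    by (rule Lp_norm2_tendsto[OF FT_trunc_Lp2[OF h(1)] h(2,3)])
  moreover have "((\<lambda>R. Lp_norm 2 (trunc R f)) \<longlongrightarrow> Lp_norm 2 f) at_top"
    by (rule Lp_norm2_tendsto[OF trunc_Lp2[OF h(1)] h(1) trunc_Lp2_limit[OF h(1)]])
  ultimately show ?thesis
    using Plancherel_L1_L2(2)[OF trunc_integrable[OF h(1)] trunc_Lp2[OF h(1)]]
    by (auto intro: tendsto_unique[rotated])
qed

lemma FT_lincomb:
  fixes f g :: "'a::euclidean_space \<Rightarrow> complex"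
  assumes "integrable lborel f" "integrable lborel g"
  shows "FT (\<lambda>x. a * f x + b * g x) \<xi> = a * FT f \<xi> + b * FT g \<xi>"
proof -
  have "integrable lborel (\<lambda>x. a * (cis (- (x \<bullet> \<xi>)) * f x))" "integrable lborel (\<lambda>x. b * (cis (- (x \<bullet> \<xi>)) * g x))"
    by (intro integrable_mult_right cis_mult_integrable assms)+
  from Bochner_Integration.integral_add[OF this]
  have "(LINT x|lborel. cis (- (x \<bullet> \<xi>)) * (a * f x + b * g x))
     = a * (LINT x|lborel. cis (- (x \<bullet> \<xi>)) * f x) + b * (LINT x|lborel. cis (- (x \<bullet> \<xi>)) * g x)"
    by (simp add: algebra_simps)
  then show ?thesis by (simp add: FT_def algebra_simps)
qed

text \<open>With free coefficients \<open>a\<close> and \<open>b\<close> this covers sums,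
  differences and difference quotients alike; isometry applied to a difference then gives
  uniqueness.\<close>

lemma has_fourier_lincomb:
  fixes f g :: "'a::euclidean_space \<Rightarrow> complex"
  assumes F: "has_fourier f F" and G: "has_fourier g G"
  shows "has_fourier (\<lambda>x. a * f x + b * g x) (\<lambda>\<xi>. a * F \<xi> + b * G \<xi>)"
proof -
  note hF = has_fourierD[OF F] and hG = has_fourierD[OF G]
  have eq: "FT (trunc R (\<lambda>x. a * f x + b * g x)) \<xi> = a * FT (trunc R f) \<xi> + b * FT (trunc R g) \<xi>" for R \<xi>
  proof -
    have "trunc R (\<lambda>x. a * f x + b * g x) = (\<lambda>x. a * trunc R f x + b * trunc R g x)"
      by (auto simp: trunc_def indicator_def)
    then show ?thesis by (simp add: FT_lincomb trunc_integrable hF hG)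
  qed
  have le: "Lp_norm 2 (\<lambda>\<xi>. (a * F \<xi> + b * G \<xi>) - FT (trunc R (\<lambda>x. a * f x + b * g x)) \<xi>)
    \<le> norm a * Lp_norm 2 (\<lambda>\<xi>. F \<xi> - FT (trunc R f) \<xi>) + norm b * Lp_norm 2 (\<lambda>\<xi>. G \<xi> - FT (trunc R g) \<xi>)" for R
    unfolding eq add_diff_add right_diff_distrib[symmetric] Lp_norm2_cmult[symmetric]
    by (intro Lp_norm2_triangle Lp2_cmult Lp2_diff hF hG FT_trunc_Lp2)
  have L0: "((\<lambda>R. norm a * Lp_norm 2 (\<lambda>\<xi>. F \<xi> - FT (trunc R f) \<xi>) + norm b * Lp_norm 2 (\<lambda>\<xi>. G \<xi> - FT (trunc R g) \<xi>)) \<longlongrightarrow> 0) at_top"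
    using tendsto_add[OF tendsto_mult[OF tendsto_const hF(3)] tendsto_mult[OF tendsto_const hG(3)], of "norm a" "norm b"] by simp
  have "((\<lambda>R. Lp_norm 2 (\<lambda>\<xi>. (a * F \<xi> + b * G \<xi>) - FT (trunc R (\<lambda>x. a * f x + b * g x)) \<xi>)) \<longlongrightarrow> 0) at_top"
    by (intro Lim_null_comparison[OF _ L0] always_eventually allI) (use le in simp)
  then show ?thesis
    by (auto simp: has_fourier_def fourier_trunc_eq_FT intro!: Lp2_add Lp2_cmult hF hG)
qed

lemma has_fourier_unique:
  fixes f :: "'a::euclidean_space \<Rightarrow> complex"
  assumes F: "has_fourier f F" and G: "has_fourier g G" and eq: "AE x in lborel. f x = g x"
  shows "AE \<xi> in lborel. F \<xi> = G \<xi>"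
proof -
  note hF = has_fourierD[OF F] and hG = has_fourierD[OF G]
  have "Lp_norm 2 (\<lambda>\<xi>. 1 * F \<xi> + (-1) * G \<xi>) = Lp_norm 2 (\<lambda>x. 1 * f x + (-1) * g x)"
    by (rule has_fourier_norm[OF has_fourier_lincomb[OF F G]])
  also have "\<dots> = Lp_norm 2 (\<lambda>x::'a. 0)"
    using hF(1) hG(1) eq by (intro Lp_norm2_cong_AE) (auto dest: Lp_measurable)
  also have "\<dots> = 0" by (simp add: Lp_norm2_eq)
  finally have "AE \<xi> in lborel. F \<xi> - G \<xi> = 0"
    using Lp2_diff[OF hF(2) hG(2)] by (intro Lp_norm2_zero_AE) auto
  then show ?thesis by simp
qed

lemma has_fourier_cong:
  fixes f :: "'a::euclidean_space \<Rightarrow> complex"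
  assumes F: "has_fourier f F" and G: "G \<in> borel_measurable borel" and eq: "AE \<xi> in lborel. F \<xi> = G \<xi>"
  shows "has_fourier f G"
proof -
  note hF = has_fourierD[OF F]
  have GL: "G \<in> Lp 2" by (rule Lp2_cong_AE[OF hF(2) G eq])
  have "Lp_norm 2 (\<lambda>\<xi>. F \<xi> - FT (trunc R f) \<xi>) = Lp_norm 2 (\<lambda>\<xi>. G \<xi> - FT (trunc R f) \<xi>)" for R
    using eq Lp_measurable[OF hF(2)] Lp_measurable[OF hF(1)] G
    by (intro Lp_norm2_cong_AE) auto
  then show ?thesis using hF GL by (simp add: has_fourier_def fourier_trunc_eq_FT)
qed

lemma has_fourier_FT:
  fixes f :: "'a::euclidean_space \<Rightarrow> complex"
  assumes f: "integrable lborel f" "f \<in> Lp 2"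
  shows "has_fourier f (FT f)"
proof -
  have "((\<lambda>R. Lp_norm 2 (\<lambda>\<xi>. FT f \<xi> - FT (trunc R f) \<xi>)) \<longlongrightarrow> 0) at_top"
    using trunc_Lp2_limit[OF f(2)] by (simp add: FT_norm_diff f trunc_integrable trunc_Lp2)
  then show ?thesis using f Plancherel_L1_L2(1)[OF f] by (simp add: has_fourier_def fourier_trunc_eq_FT)
qed

lemma has_fourier_reflect:
  fixes f :: "'a::euclidean_space \<Rightarrow> complex"
  assumes F: "has_fourier f F"
  shows "has_fourier (\<lambda>x. f (- x)) (\<lambda>\<xi>. F (- \<xi>))"
proof -
  note hF = has_fourierD[OF F]
  have L: "(\<lambda>x. g (- x)) \<in> Lp 2" "Lp_norm 2 (\<lambda>x. g (- x)) = Lp_norm 2 g" if "g \<in> Lp 2" for g :: "'a \<Rightarrow> complex"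
    using Lp_norm2_affine[OF that, of "-1" 0] by simp_all
  note [measurable] = Lp_measurable[OF hF(1)]
  have "FT (trunc R (\<lambda>x. f (- x))) \<xi> = FT (trunc R f) (- \<xi>)" for R \<xi>
  proof -
    have "(LINT x|lborel. cis (- (x \<bullet> - \<xi>)) * trunc R f x)
       = \<bar>-1\<bar> ^ DIM('a) *\<^sub>R (LINT x|lborel. cis (- ((0 + (-1) *\<^sub>R x) \<bullet> - \<xi>)) * trunc R f (0 + (-1) *\<^sub>R x))"
      by (rule lborel_integral_affine) auto
    then show ?thesis by (simp add: FT_def trunc_def indicator_def)
  qed
  then have "Lp_norm 2 (\<lambda>\<xi>. F (- \<xi>) - FT (trunc R (\<lambda>x. f (- x))) \<xi>) = Lp_norm 2 (\<lambda>\<xi>. F \<xi> - FT (trunc R f) \<xi>)" for R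
    using L(2)[OF Lp2_diff[OF hF(2) FT_trunc_Lp2[OF hF(1), of R]]] by simp
  then show ?thesis using hF L(1) by (simp add: has_fourier_def fourier_trunc_eq_FT)
qed

section \<open>Surjectivity of the transform\<close>

lemma Lp2_inner:
  fixes f g :: "'a::euclidean_space \<Rightarrow> complex"
  assumes f: "f \<in> Lp 2" and g: "g \<in> Lp 2"
  shows "integrable lborel (\<lambda>x. f x \<bullet> g x)"
    and "(LINT x|lborel. f x \<bullet> g x) = ((Lp_norm 2 (\<lambda>x. f x + g x))\<^sup>2 - (Lp_norm 2 (\<lambda>x. f x - g x))\<^sup>2) / 4"
proof -
  have i: "integrable lborel (\<lambda>x. (norm (f x + g x))\<^sup>2)" "integrable lborel (\<lambda>x. (norm (f x - g x))\<^sup>2)"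
    using Lp2_add[OF f g] Lp2_diff[OF f g] by (auto simp: Lp2_iff)
  have eq: "u \<bullet> v = ((norm (u + v))\<^sup>2 - (norm (u - v))\<^sup>2) / 4" for u v :: complex
    by (simp add: power2_norm_eq_inner inner_simps inner_commute)
  show "integrable lborel (\<lambda>x. f x \<bullet> g x)" unfolding eq using i by simp
  show "(LINT x|lborel. f x \<bullet> g x) = ((Lp_norm 2 (\<lambda>x. f x + g x))\<^sup>2 - (Lp_norm 2 (\<lambda>x. f x - g x))\<^sup>2) / 4"
    unfolding eq Lp_norm2_power2 using i by simp
qed

text \<open>By polarisation an inner product is a combination of squares of norms, so the continuity
  of the norm suffices.\<close>

lemma Lp2_inner_tendsto:
  fixes f g :: "'b \<Rightarrow> 'a::euclidean_space \<Rightarrow> complex"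
  assumes f: "\<And>n. f n \<in> Lp 2" and g: "\<And>n. g n \<in> Lp 2" and f0: "f0 \<in> Lp 2" and g0: "g0 \<in> Lp 2"
    and lf: "((\<lambda>n. Lp_norm 2 (\<lambda>x. f0 x - f n x)) \<longlongrightarrow> 0) F" and lg: "((\<lambda>n. Lp_norm 2 (\<lambda>x. g0 x - g n x)) \<longlongrightarrow> 0) F"
  shows "((\<lambda>n. LINT x|lborel. f n x \<bullet> g n x) \<longlongrightarrow> (LINT x|lborel. f0 x \<bullet> g0 x)) F"
proof -
  have s: "((\<lambda>n. Lp_norm 2 (\<lambda>x. f0 x - f n x) + Lp_norm 2 (\<lambda>x. g0 x - g n x)) \<longlongrightarrow> 0) F"
    using tendsto_add[OF lf lg] by simp
  have "Lp_norm 2 (\<lambda>x. (f0 x + g0 x) - (f n x + g n x)) \<le> Lp_norm 2 (\<lambda>x. f0 x - f n x) + Lp_norm 2 (\<lambda>x. g0 x - g n x)" for n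
    using Lp_norm2_triangle[OF Lp2_diff[OF f0 f] Lp2_diff[OF g0 g]] by (simp add: algebra_simps)
  then have "((\<lambda>n. Lp_norm 2 (\<lambda>x. f n x + g n x)) \<longlongrightarrow> Lp_norm 2 (\<lambda>x. f0 x + g0 x)) F"
    by (intro Lp_norm2_tendsto Lp2_add f g f0 g0 Lim_null_comparison[OF _ s] always_eventually allI) auto
  moreover have "Lp_norm 2 (\<lambda>x. (f0 x - g0 x) - (f n x - g n x)) \<le> Lp_norm 2 (\<lambda>x. f0 x - f n x) + Lp_norm 2 (\<lambda>x. g0 x - g n x)" for n
    using Lp_norm2_diff_le[OF Lp2_diff[OF f0 f] Lp2_diff[OF g0 g]] by (simp add: algebra_simps)
  then have "((\<lambda>n. Lp_norm 2 (\<lambda>x. f n x - g n x)) \<longlongrightarrow> Lp_norm 2 (\<lambda>x. f0 x - g0 x)) F"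
    by (intro Lp_norm2_tendsto Lp2_diff f g f0 g0 Lim_null_comparison[OF _ s] always_eventually allI) auto
  ultimately show ?thesis unfolding Lp2_inner(2)[OF f g] Lp2_inner(2)[OF f0 g0]
    by (intro tendsto_intros) simp_all
qed

text \<open>The multiplication formula for a truncation of \<open>f\<close> and the conjugate of a
  truncation of \<open>g\<close>, followed by a limit. The transform of a conjugate at
  \<open>x\<close> is the conjugate of the transform at \<open>-x\<close>, whence the
  reflection.\<close>

lemma has_fourier_adjoint:
  fixes f g :: "'a::euclidean_space \<Rightarrow> complex"
  assumes F: "has_fourier f F" and G: "has_fourier g G"
  shows "(LINT \<xi>|lborel. F \<xi> \<bullet> g \<xi>) = (LINT x|lborel. f x \<bullet> G (- x))"
proof -
  note hF = has_fourierD[OF F] and hG = has_fourierD[OF G]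
  note hG' = has_fourierD[OF has_fourier_reflect[OF G]]
  have L: "(\<lambda>x. h (- x)) \<in> Lp 2" "Lp_norm 2 (\<lambda>x. h (- x)) = Lp_norm 2 h" if "h \<in> Lp 2" for h :: "'a \<Rightarrow> complex"
    using Lp_norm2_affine[OF that, of "-1" 0] by simp_all
  have eq: "(LINT \<xi>|lborel. FT (trunc R f) \<xi> \<bullet> trunc R g \<xi>) = (LINT x|lborel. trunc R f x \<bullet> FT (trunc R g) (- x))" for R
  proof -
    have cg: "integrable lborel (\<lambda>x. cnj (trunc R g x))" using trunc_integrable[OF hG(1)] by simp
    have cn: "FT (\<lambda>x. cnj (trunc R g x)) x = cnj (FT (trunc R g) (- x))" for x
      unfolding FT_def by (simp add: Bochner_Integration.integral_cnj[symmetric] cis_cnj del: Bochner_Integration.integral_cnj)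
    have i1: "integrable lborel (\<lambda>\<xi>. FT (trunc R f) \<xi> * cnj (trunc R g \<xi>))"
      using Lp2_Cauchy_Schwarz(1)[OF FT_trunc_Lp2[OF hF(1), of R] trunc_Lp2[OF hG(1), of R]]
        FT_trunc_Lp2[OF hF(1), of R] trunc_Lp2[OF hG(1), of R]
      by (rule_tac Bochner_Integration.integrable_bound) (auto simp: norm_mult dest: Lp_measurable)
    have i2: "integrable lborel (\<lambda>x. trunc R f x * cnj (FT (trunc R g) (- x)))"
      using Lp2_Cauchy_Schwarz(1)[OF trunc_Lp2[OF hF(1), of R] L(1)[OF FT_trunc_Lp2[OF hG(1), of R]]]
        trunc_Lp2[OF hF(1), of R] L(1)[OF FT_trunc_Lp2[OF hG(1), of R]]
      by (rule_tac Bochner_Integration.integrable_bound) (auto simp: norm_mult dest: Lp_measurable)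
    have dot: "u \<bullet> v = Re (u * cnj v)" for u v :: complex by (simp add: inner_complex_def)
    show ?thesis
      unfolding dot integral_Re[OF i1] integral_Re[OF i2]
        FT_multiplication_formula[OF trunc_integrable[OF hF(1), of R] cg] cn ..
  qed
  have "((\<lambda>R. LINT \<xi>|lborel. FT (trunc R f) \<xi> \<bullet> trunc R g \<xi>) \<longlongrightarrow> (LINT \<xi>|lborel. F \<xi> \<bullet> g \<xi>)) at_top"
    by (intro Lp2_inner_tendsto hF hG FT_trunc_Lp2 trunc_Lp2 trunc_Lp2_limit)
  moreover have "((\<lambda>R. LINT x|lborel. trunc R f x \<bullet> FT (trunc R g) (- x)) \<longlongrightarrow> (LINT x|lborel. f x \<bullet> G (- x))) at_top"
  proof (intro Lp2_inner_tendsto hF hG' L(1) FT_trunc_Lp2 trunc_Lp2 trunc_Lp2_limit hG)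
    show "((\<lambda>R. Lp_norm 2 (\<lambda>x. G (- x) - FT (trunc R g) (- x))) \<longlongrightarrow> 0) at_top"
      using hG(3) L(2)[OF Lp2_diff[OF hG(2) FT_trunc_Lp2[OF hG(1)]]] by simp
  qed
  ultimately show ?thesis unfolding eq by (auto intro: tendsto_unique[rotated])
qed

text \<open>Let \<open>H\<close> be the transform of \<open>G\<close> and \<open>K\<close> that of
  the reflected \<open>H\<close>. The adjoint identity makes the inner product of \<open>K\<close>
  and \<open>G\<close> equal to \<open>|H|^2\<close>, and all three norms agree by isometry, so
  \<open>|K - G|^2 = 0\<close>: the reflected \<open>H\<close> is a preimage of
  \<open>G\<close>.\<close>

lemma has_fourier_surj:
  fixes G :: "'a::euclidean_space \<Rightarrow> complex"
  assumes G: "G \<in> Lp 2"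
  shows "\<exists>f. has_fourier f G"
proof -
  obtain H where H: "has_fourier G H" using has_fourier_exists[OF G] by blast
  have fL: "(\<lambda>x. H (- x)) \<in> Lp 2" and fn: "Lp_norm 2 (\<lambda>x. H (- x)) = Lp_norm 2 H"
    using Lp_norm2_affine[OF has_fourierD(2)[OF H], of "-1" 0] by simp_all
  obtain K where K: "has_fourier (\<lambda>x. H (- x)) K" using has_fourier_exists[OF fL] by blast
  note KL = has_fourierD(2)[OF K]
  have i: "integrable lborel (\<lambda>x. (norm (K x))\<^sup>2)" "integrable lborel (\<lambda>x. (norm (G x))\<^sup>2)" "integrable lborel (\<lambda>x. K x \<bullet> G x)"
    using KL G Lp2_inner(1)[OF KL G] by (auto simp: Lp2_iff)
  have "(LINT \<xi>|lborel. K \<xi> \<bullet> G \<xi>) = (LINT x|lborel. H (- x) \<bullet> H (- x))"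
    by (rule has_fourier_adjoint[OF K H])
  also have "\<dots> = (Lp_norm 2 H)\<^sup>2"
    unfolding fn[symmetric] Lp_norm2_power2 by (simp add: power2_norm_eq_inner)
  finally have KG: "(LINT \<xi>|lborel. K \<xi> \<bullet> G \<xi>) = (Lp_norm 2 H)\<^sup>2" .
  have n: "Lp_norm 2 K = Lp_norm 2 H" "Lp_norm 2 G = Lp_norm 2 H"
    using has_fourier_norm[OF K] has_fourier_norm[OF H] fn by simp_all
  have "(Lp_norm 2 (\<lambda>\<xi>. K \<xi> - G \<xi>))\<^sup>2 = (LINT x|lborel. (norm (K x))\<^sup>2 + (norm (G x))\<^sup>2 - 2 * (K x \<bullet> G x))"
    unfolding Lp_norm2_power2
    by (intro Bochner_Integration.integral_cong refl) (simp add: power2_norm_eq_inner inner_simps inner_commute)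
  also have "\<dots> = (Lp_norm 2 K)\<^sup>2 + (Lp_norm 2 G)\<^sup>2 - 2 * (LINT x|lborel. K x \<bullet> G x)"
    using i by (simp add: Lp_norm2_power2)
  also have "\<dots> = 0" by (simp add: KG n)
  finally have "AE \<xi> in lborel. K \<xi> - G \<xi> = 0"
    by (intro Lp_norm2_zero_AE Lp2_diff KL G) simp
  then have "has_fourier (\<lambda>x. H (- x)) G"
    using Lp_measurable[OF G] by (intro has_fourier_cong[OF K]) auto
  then show ?thesis by blast
qed

lemma has_fourier_fourier: "f \<in> Lp 2 \<Longrightarrow> has_fourier f (fourier f)"
  unfolding fourier_def by (rule someI_ex[OF has_fourier_exists])

lemma has_fourier_inv_fourier: "F \<in> Lp 2 \<Longrightarrow> has_fourier (inv_fourier F) F"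
  unfolding inv_fourier_def by (rule someI_ex[OF has_fourier_surj])

lemma fourier_Lp2: "f \<in> Lp 2 \<Longrightarrow> fourier f \<in> Lp 2"
  using has_fourier_fourier has_fourierD(2) by blast

lemma fourier_norm: "f \<in> Lp 2 \<Longrightarrow> Lp_norm 2 (fourier f) = Lp_norm 2 f"
  using has_fourier_fourier has_fourier_norm by blast

lemma fourier_eq_AE: "has_fourier f F \<Longrightarrow> AE \<xi> in lborel. fourier f \<xi> = F \<xi>"
  by (rule has_fourier_unique[OF has_fourier_fourier[OF has_fourierD(1)]]) auto

subsection \<open>A single Fourier mode\<close>

text \<open>The mean value inequality for derivatives taken within \<open>{0..}\<close>, the form in
  which the equation provides them; at inner points they are two-sided derivatives.\<close>

lemma half_line_increment_bound:
  fixes f :: "real \<Rightarrow> 'a::real_normed_vector"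
  assumes st: "0 \<le> s" "s \<le> t"
    and f: "\<And>x. x \<ge> 0 \<Longrightarrow> (f has_vector_derivative f' x) (at x within {0..})"
    and g: "\<And>x. x \<ge> 0 \<Longrightarrow> (g has_real_derivative g' x) (at x within {0..})"
    and le: "\<And>x. s \<le> x \<Longrightarrow> x \<le> t \<Longrightarrow> norm (f' x) \<le> g' x"
  shows "norm (f t - f s) \<le> g t - g s"
proof (cases "s = t")
  case False
  have at: "at x within {0..} = at x" if "x > 0" for x :: real
    using that by (intro at_within_interior) (simp add: interior_real_atLeast)
  have "continuous_on {0..} f"
    by (rule continuous_on_vector_derivative) (use f in auto)
  moreover have "continuous_on {0..} g"
    by (rule continuous_on_vector_derivative) (use g in \<open>auto simp: has_real_derivative_iff_has_vector_derivative\<close>)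
  ultimately show ?thesis
    using st False f g at le
    by (intro differentiable_bound_general[where f'=f' and \<phi>'=g'])
      (auto elim: continuous_on_subset simp: has_real_derivative_iff_has_vector_derivative dest: order_le_less_trans,
       (metis at less_imp_le order_le_less_trans)+)
qed simp

text \<open>The equation after Liouville's substitution as a first-order system, with \<rho> for the
  length of the frequency. Derivatives are one-sided at 0.\<close>

definition damped_mode :: "real \<Rightarrow> real \<Rightarrow> (real \<Rightarrow> complex) \<Rightarrow> (real \<Rightarrow> complex) \<Rightarrow> bool" where
  "damped_mode \<mu> \<rho> V V' \<longleftrightarrow> (\<forall>t\<ge>0. (V has_vector_derivative V' t) (at t within {0..}) \<and>
     (V' has_vector_derivative - (\<rho>\<^sup>2 *\<^sub>R V t) - (\<mu> / (1 + t)\<^sup>2) *\<^sub>R V t) (at t within {0..}))"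

text \<open>The factor \<open>(1+t)^(mu1/2)\<close> has logarithmic derivative
  \<open>mu1/(2(1+t))\<close>, half the damping coefficient, so the first-order terms cancel. What
  remains of the factor is the potential \<open>(mu1/2 - mu1^2/4)/(1+t)^2\<close>, which joins the
  term with \<open>mu2\<close> to give \<mu>.\<close>

lemma damped_mode_Liouville:
  fixes U U' :: "real \<Rightarrow> complex"
  assumes U: "\<And>t. t \<ge> 0 \<Longrightarrow> (U has_vector_derivative U' t) (at t within {0..})"
    and U': "\<And>t. t \<ge> 0 \<Longrightarrow> (U' has_vector_derivative - (\<rho>\<^sup>2 *\<^sub>R U t) - (\<mu>1 / (1 + t)) *\<^sub>R U' t
       - (\<mu>2 / (1 + t)\<^sup>2) *\<^sub>R U t) (at t within {0..})"
    and mu: "\<mu> = \<mu>1 * (2 - \<mu>1) / 4 + \<mu>2"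
  shows "damped_mode \<mu> \<rho> (\<lambda>t. (1 + t) powr (\<mu>1 / 2) *\<^sub>R U t)
     (\<lambda>t. (1 + t) powr (\<mu>1 / 2) *\<^sub>R (U' t + (\<mu>1 / (2 * (1 + t))) *\<^sub>R U t))"
  unfolding damped_mode_def
proof (intro allI impI conjI)
  fix t :: real assume t: "t \<ge> 0"
  define P where "P = (1 + t) powr (\<mu>1 / 2)"
  have dP: "((\<lambda>t. (1 + t) powr (\<mu>1 / 2)) has_real_derivative P * (\<mu>1 / (2 * (1 + t)))) (at t within {0..})"
  proof -
    have \<tau>: "1 + t > 0" using t by simp
    have eq: "(\<mu>1 / 2) * (1 + t) powr (\<mu>1 / 2 - 1) = P * (\<mu>1 / (2 * (1 + t)))"
      unfolding P_def powr_diff using \<tau> by simp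
    show ?thesis unfolding eq[symmetric] using \<tau> by (auto intro!: derivative_eq_intros)
  qed
  have dq: "((\<lambda>t. \<mu>1 / (2 * (1 + t))) has_real_derivative - \<mu>1 / (2 * (1 + t)\<^sup>2)) (at t within {0..})"
  proof -
    have "((\<lambda>t. c / (1 + t)) has_real_derivative - c / (1 + t)\<^sup>2) (at t within {0..})" for c :: real
      using t by (auto intro!: derivative_eq_intros simp: power2_eq_square)
    from this[of "\<mu>1 / 2"] show ?thesis by simp
  qed
  show "((\<lambda>t. (1 + t) powr (\<mu>1 / 2) *\<^sub>R U t) has_vector_derivative
      (1 + t) powr (\<mu>1 / 2) *\<^sub>R (U' t + (\<mu>1 / (2 * (1 + t))) *\<^sub>R U t)) (at t within {0..})"
    by (rule has_vector_derivative_eq_rhs[OF has_vector_derivative_scaleR[OF dP U[OF t]]])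
      (simp add: P_def algebra_simps)
  have e: "\<mu> = \<mu>1 / 2 - \<mu>1\<^sup>2 / 4 + \<mu>2" using mu by (simp add: power2_eq_square right_diff_distrib diff_divide_distrib)
  show "((\<lambda>t. (1 + t) powr (\<mu>1 / 2) *\<^sub>R (U' t + (\<mu>1 / (2 * (1 + t))) *\<^sub>R U t)) has_vector_derivative
      - (\<rho>\<^sup>2 *\<^sub>R (1 + t) powr (\<mu>1 / 2) *\<^sub>R U t) - (\<mu> / (1 + t)\<^sup>2) *\<^sub>R (1 + t) powr (\<mu>1 / 2) *\<^sub>R U t) (at t within {0..})"
  proof (rule has_vector_derivative_eq_rhs[OF has_vector_derivative_scaleR[OF dP
        has_vector_derivative_add[OF U'[OF t] has_vector_derivative_scaleR[OF dq U[OF t]]]]])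
    define a h m2 where "a = \<mu>1 / (2 * (1 + t))" and "h = \<mu>1 / (2 * (1 + t)\<^sup>2)" and "m2 = \<mu>2 / (1 + t)\<^sup>2"
    have e1: "\<mu>1 / (1 + t) = a + a"
      unfolding a_def mult_2[symmetric] times_divide_eq_right by (rule mult_divide_mult_cancel_left[symmetric]) simp
    have e2: "- \<mu>1 / (2 * (1 + t)\<^sup>2) = - h" by (simp add: h_def)
    have e3: "\<mu> / (1 + t)\<^sup>2 = m2 + h - a * a"
      using t unfolding e a_def h_def m2_def
      by (simp add: add_divide_distrib diff_divide_distrib power2_eq_square) (simp add: algebra_simps)
    show "(1 + t) powr (\<mu>1 / 2) *\<^sub>R (- (\<rho>\<^sup>2 *\<^sub>R U t) - (\<mu>1 / (1 + t)) *\<^sub>R U' t - (\<mu>2 / (1 + t)\<^sup>2) *\<^sub>R U t +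
          ((\<mu>1 / (2 * (1 + t))) *\<^sub>R U' t + (- \<mu>1 / (2 * (1 + t)\<^sup>2)) *\<^sub>R U t)) +
        (P * (\<mu>1 / (2 * (1 + t)))) *\<^sub>R (U' t + (\<mu>1 / (2 * (1 + t))) *\<^sub>R U t) =
        - (\<rho>\<^sup>2 *\<^sub>R (1 + t) powr (\<mu>1 / 2) *\<^sub>R U t) - (\<mu> / (1 + t)\<^sup>2) *\<^sub>R (1 + t) powr (\<mu>1 / 2) *\<^sub>R U t"
      unfolding e1 e2 e3 P_def[symmetric] a_def[symmetric] m2_def[symmetric]
      by (simp add: scaleR_conv_of_real algebra_simps)
  qed
qed

text \<open>Only the potential changes the free energy \<open>E\<close>, and
  \<open>2 rho |V| |V'| <= E\<close> bounds the relative rate of change by \<open>c/(1+t)^2\<close>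
  with \<open>c = |mu|/rho\<close>. The integrating factor \<open>exp (c/(1+t))\<close> absorbs
  exactly this rate, and it is at least 1 at the later time.\<close>

lemma damped_mode_energy:
  assumes ode: "damped_mode \<mu> \<rho> V V'" and \<rho>: "\<rho> > 0" and st: "0 \<le> s" "s \<le> t"
  shows "\<rho>\<^sup>2 * (norm (V t))\<^sup>2 + (norm (V' t))\<^sup>2
    \<le> exp (\<bar>\<mu>\<bar> / (\<rho> * (1 + s))) * (\<rho>\<^sup>2 * (norm (V s))\<^sup>2 + (norm (V' s))\<^sup>2)"
proof -
  define E where "E t = \<rho>\<^sup>2 * (V t \<bullet> V t) + V' t \<bullet> V' t" for t
  define c where "c = \<bar>\<mu>\<bar> / \<rho>"
  have c: "c \<ge> 0" "\<bar>\<mu>\<bar> = c * \<rho>" using \<rho> by (simp_all add: c_def)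
  define h where "h t = exp (c / (1 + t))" for t
  note ip = bounded_bilinear.has_vector_derivative[OF bounded_bilinear_inner]
  have dE: "(E has_real_derivative - (2 * \<mu> / (1 + x)\<^sup>2) * (V' x \<bullet> V x)) (at x within {0..})" if x: "x \<ge> 0" for x
  proof -
    have V: "(V has_vector_derivative V' x) (at x within {0..})"
      and V': "(V' has_vector_derivative - (\<rho>\<^sup>2 *\<^sub>R V x) - (\<mu> / (1 + x)\<^sup>2) *\<^sub>R V x) (at x within {0..})"
      using ode x by (auto simp: damped_mode_def)
    show ?thesis
      unfolding E_def[abs_def] has_real_derivative_iff_has_vector_derivative
      by (rule has_vector_derivative_eq_rhs[OF has_vector_derivative_add[OF
            has_vector_derivative_mult_right[OF ip[OF V V]] ip[OF V' V']]])
         (simp add: inner_simps inner_commute algebra_simps)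
  qed
  have dh: "(h has_real_derivative - (c / (1 + x)\<^sup>2) * h x) (at x within {0..})" if "x \<ge> 0" for x
    unfolding h_def[abs_def] using that
    by (auto intro!: derivative_eq_intros simp: power2_eq_square)
  have dEh: "((\<lambda>x. E x * h x) has_real_derivative
       E x * (- (c / (1 + x)\<^sup>2) * h x) + (- (2 * \<mu> / (1 + x)\<^sup>2) * (V' x \<bullet> V x)) * h x) (at x within {0..})"
    if "x \<ge> 0" for x using DERIV_mult'[OF dE[OF that] dh[OF that]] .
  have E0: "0 \<le> E x" for x by (simp add: E_def)
  have "E t * h t \<le> E s * h s"
  proof (rule DERIV_nonpos_imp_decreasing_open[OF st(2)])
    fix x assume x: "s < x" "x < t"
    then have "at x within {0..} = at x"
      using st by (intro at_within_interior) (simp add: interior_real_atLeast)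
    moreover have "E x * (- (c / (1 + x)\<^sup>2) * h x) + (- (2 * \<mu> / (1 + x)\<^sup>2) * (V' x \<bullet> V x)) * h x \<le> 0"
    proof -
      have "- (2 * \<mu> * (V' x \<bullet> V x)) \<le> 2 * \<bar>\<mu>\<bar> * (norm (V' x) * norm (V x))"
      proof -
        have "- (2 * \<mu> * (V' x \<bullet> V x)) \<le> \<bar>2 * \<mu> * (V' x \<bullet> V x)\<bar>" by linarith
        also have "\<dots> = 2 * \<bar>\<mu>\<bar> * \<bar>V' x \<bullet> V x\<bar>" by (simp add: abs_mult)
        also have "\<dots> \<le> 2 * \<bar>\<mu>\<bar> * (norm (V' x) * norm (V x))"
          by (intro mult_left_mono Cauchy_Schwarz_ineq2) simp
        finally show ?thesis .
      qed
      also have "\<dots> \<le> c * E x"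
      proof -
        have "0 \<le> (\<rho> * norm (V x) - norm (V' x))\<^sup>2" by simp
        then have "2 * (norm (V' x) * norm (V x)) * \<rho> \<le> E x"
          by (simp add: E_def power2_norm_eq_inner[symmetric] power2_diff power_mult_distrib mult_ac)
        then have "c * (2 * (norm (V' x) * norm (V x)) * \<rho>) \<le> c * E x" using c(1) by (rule mult_left_mono)
        then show ?thesis by (simp add: c(2) mult_ac)
      qed
      finally have "- (2 * \<mu> * (V' x \<bullet> V x)) - c * E x \<le> 0" by simp
      then have "(- (2 * \<mu> * (V' x \<bullet> V x)) - c * E x) * (h x / (1 + x)\<^sup>2) \<le> 0"
        by (intro mult_nonpos_nonneg) (auto simp: h_def)
      also have "(- (2 * \<mu> * (V' x \<bullet> V x)) - c * E x) * (h x / (1 + x)\<^sup>2) =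
        E x * (- (c / (1 + x)\<^sup>2) * h x) + (- (2 * \<mu> / (1 + x)\<^sup>2) * (V' x \<bullet> V x)) * h x"
        using x st by (simp add: field_simps)
      finally show ?thesis .
    qed
    moreover have "x \<ge> 0" using x st by simp
    ultimately show "\<exists>y. DERIV (\<lambda>x. E x * h x) x :> y \<and> y \<le> 0"
      using dEh[of x] by auto
  next
    have "continuous_on {0..} (\<lambda>x. E x * h x)"
      by (rule continuous_on_vector_derivative)
        (use dEh in \<open>auto simp: has_real_derivative_iff_has_vector_derivative\<close>)
    then show "continuous_on {s..t} (\<lambda>x. E x * h x)"
      by (rule continuous_on_subset) (use st in auto)
  qed
  moreover have "E t * 1 \<le> E t * h t"
    using E0 st c by (intro mult_left_mono) (auto simp: h_def)
  ultimately have "E t \<le> h s * E s" by (simp add: mult.commute)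
  then show ?thesis by (simp add: E_def h_def c_def power2_norm_eq_inner)
qed

lemma damped_mode_high:
  assumes ode: "damped_mode \<mu> \<rho> V V'" and \<rho>: "\<rho> > 0" and st: "0 \<le> s" "s \<le> t" and hi: "1 \<le> \<rho> * (1 + s)"
  shows "\<rho> * norm (V t) \<le> exp \<bar>\<mu>\<bar> * (\<rho> * norm (V s) + norm (V' s))"
proof (rule power2_le_imp_le)
  have "(\<rho> * norm (V t))\<^sup>2 \<le> \<rho>\<^sup>2 * (norm (V t))\<^sup>2 + (norm (V' t))\<^sup>2"
    by (simp add: power_mult_distrib)
  also have "\<dots> \<le> exp (\<bar>\<mu>\<bar> / (\<rho> * (1 + s))) * (\<rho>\<^sup>2 * (norm (V s))\<^sup>2 + (norm (V' s))\<^sup>2)"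
    by (rule damped_mode_energy[OF ode \<rho> st])
  \<comment> \<open>The exponent is at most \<open>|mu|\<close> because
    \<open>rho (1 + s) >= 1\<close>; doubling it makes the whole bound a square.\<close>
  also have "\<dots> \<le> exp (2 * \<bar>\<mu>\<bar>) * (\<rho> * norm (V s) + norm (V' s))\<^sup>2"
  proof (intro mult_mono)
    have "\<bar>\<mu>\<bar> / (\<rho> * (1 + s)) \<le> \<bar>\<mu>\<bar> / 1" using hi by (intro divide_left_mono) auto
    then show "exp (\<bar>\<mu>\<bar> / (\<rho> * (1 + s))) \<le> exp (2 * \<bar>\<mu>\<bar>)" by simp
    show "\<rho>\<^sup>2 * (norm (V s))\<^sup>2 + (norm (V' s))\<^sup>2 \<le> (\<rho> * norm (V s) + norm (V' s))\<^sup>2"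
      using \<rho> by (simp add: power2_sum power_mult_distrib)
  qed auto
  also have "\<dots> = (exp \<bar>\<mu>\<bar> * (\<rho> * norm (V s) + norm (V' s)))\<^sup>2"
    by (simp add: power_mult_distrib exp_double)
  finally show "(\<rho> * norm (V t))\<^sup>2 \<le> (exp \<bar>\<mu>\<bar> * (\<rho> * norm (V s) + norm (V' s)))\<^sup>2" .
qed (use \<rho> in simp)

text \<open>The bound degenerates as \<rho> tends to 0. It serves to make the profiles of each
  single frequency converge.\<close>

lemma damped_mode_bounded:
  assumes ode: "damped_mode \<mu> \<rho> V V'" and \<rho>: "\<rho> > 0"
  shows "\<exists>S\<ge>0. \<forall>t\<ge>0. norm (V t) \<le> S"
proof -
  define K where "K = exp (\<bar>\<mu>\<bar> / (\<rho> * (1 + 0))) * (\<rho>\<^sup>2 * (norm (V 0))\<^sup>2 + (norm (V' 0))\<^sup>2)"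
  have "norm (V t) \<le> sqrt K / \<rho>" if "t \<ge> 0" for t
  proof -
    have "(\<rho> * norm (V t))\<^sup>2 \<le> K"
      using damped_mode_energy[OF ode \<rho> _ that] unfolding K_def
      by (simp add: power_mult_distrib) (smt (verit) zero_le_power2)
    then have "\<rho> * norm (V t) \<le> sqrt K" by (rule real_le_rsqrt)
    then show ?thesis using \<rho> by (simp add: field_simps)
  qed
  moreover have "sqrt K / \<rho> \<ge> 0" using \<rho> by (simp add: K_def)
  ultimately show ?thesis by blast
qed

text \<open>The Cauchy data \<open>(\<rho> F, G)\<close> at time 0 of the free wave that agrees with the mode at time \<open>t\<close>.\<close>

definition profile_A :: "real \<Rightarrow> complex \<Rightarrow> complex \<Rightarrow> real \<Rightarrow> complex" where
  "profile_A \<rho> v v' t = (\<rho> * cos (\<rho> * t)) *\<^sub>R v - sin (\<rho> * t) *\<^sub>R v'"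

definition profile_B :: "real \<Rightarrow> complex \<Rightarrow> complex \<Rightarrow> real \<Rightarrow> complex" where
  "profile_B \<rho> v v' t = (\<rho> * sin (\<rho> * t)) *\<^sub>R v + cos (\<rho> * t) *\<^sub>R v'"

text \<open>Variation of constants: along a solution the free part of the motion cancels, and the
  derivative of a profile is the forcing \<open>mu V/(1+x)^2\<close> times a sine or cosine, up to
  sign. The difference \<open>1/(1+s) - 1/(1+t)\<close> is the integral of
  \<open>(1+x)^(-2)\<close>.\<close>

lemma profile_increment:
  assumes ode: "damped_mode \<mu> \<rho> V V'" and st: "0 \<le> s" "s \<le> t" and S: "\<And>x. s \<le> x \<Longrightarrow> x \<le> t \<Longrightarrow> norm (V x) \<le> S"
  shows "norm (profile_A \<rho> (V t) (V' t) t - profile_A \<rho> (V s) (V' s) s) \<le> \<bar>\<mu>\<bar> * S * (1 / (1 + s) - 1 / (1 + t))"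
    and "norm (profile_B \<rho> (V t) (V' t) t - profile_B \<rho> (V s) (V' s) s) \<le> \<bar>\<mu>\<bar> * S * (1 / (1 + s) - 1 / (1 + t))"
proof -
  have V: "(V has_vector_derivative V' x) (at x within {0..})"
    and V': "(V' has_vector_derivative - (\<rho>\<^sup>2 *\<^sub>R V x) - (\<mu> / (1 + x)\<^sup>2) *\<^sub>R V x) (at x within {0..})"
    if "x \<ge> 0" for x using ode that by (auto simp: damped_mode_def)
  have g: "((\<lambda>x. - (\<bar>\<mu>\<bar> * S / (1 + x))) has_real_derivative \<bar>\<mu>\<bar> * S / (1 + x)\<^sup>2) (at x within {0..})" if "x \<ge> 0" for x
    using that by (auto intro!: derivative_eq_intros simp: power2_eq_square)
  have c: "((\<lambda>x. \<rho> * cos (\<rho> * x)) has_real_derivative - \<rho>\<^sup>2 * sin (\<rho> * x)) (at x within {0..})"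
    "((\<lambda>x. \<rho> * sin (\<rho> * x)) has_real_derivative \<rho>\<^sup>2 * cos (\<rho> * x)) (at x within {0..})"
    "((\<lambda>x. sin (\<rho> * x)) has_real_derivative \<rho> * cos (\<rho> * x)) (at x within {0..})"
    "((\<lambda>x. cos (\<rho> * x)) has_real_derivative - \<rho> * sin (\<rho> * x)) (at x within {0..})" for x
    by (auto intro!: derivative_eq_intros simp: power2_eq_square)
  have dA: "((\<lambda>x. profile_A \<rho> (V x) (V' x) x) has_vector_derivative (\<mu> / (1 + x)\<^sup>2 * sin (\<rho> * x)) *\<^sub>R V x) (at x within {0..})"
    if "x \<ge> 0" for x
    unfolding profile_A_def
    by (rule has_vector_derivative_eq_rhs[OF has_vector_derivative_diff[OF has_vector_derivative_scaleR[OF c(1) V[OF that]]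
          has_vector_derivative_scaleR[OF c(3) V'[OF that]]]])
      (simp add: algebra_simps)
  have dB: "((\<lambda>x. profile_B \<rho> (V x) (V' x) x) has_vector_derivative (- (\<mu> / (1 + x)\<^sup>2) * cos (\<rho> * x)) *\<^sub>R V x) (at x within {0..})"
    if "x \<ge> 0" for x
    unfolding profile_B_def
    by (rule has_vector_derivative_eq_rhs[OF has_vector_derivative_add[OF has_vector_derivative_scaleR[OF c(2) V[OF that]]
          has_vector_derivative_scaleR[OF c(4) V'[OF that]]]])
      (simp add: algebra_simps)
  have le: "\<bar>\<mu>\<bar> * \<bar>y\<bar> * norm (V x) / (1 + x)\<^sup>2 \<le> \<bar>\<mu>\<bar> * S / (1 + x)\<^sup>2" if "s \<le> x" "x \<le> t" "\<bar>y\<bar> \<le> 1" for x y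
  proof -
    have "\<bar>\<mu>\<bar> / (1 + x)\<^sup>2 * \<bar>y\<bar> * norm (V x) \<le> \<bar>\<mu>\<bar> / (1 + x)\<^sup>2 * 1 * S"
      using S[OF that(1,2)] that(3) by (intro mult_mono) auto
    then show ?thesis by simp
  qed
  have eq: "- (\<bar>\<mu>\<bar> * S / (1 + t)) - - (\<bar>\<mu>\<bar> * S / (1 + s)) = \<bar>\<mu>\<bar> * S * (1 / (1 + s) - 1 / (1 + t))"
    by (simp add: algebra_simps)
  show "norm (profile_A \<rho> (V t) (V' t) t - profile_A \<rho> (V s) (V' s) s) \<le> \<bar>\<mu>\<bar> * S * (1 / (1 + s) - 1 / (1 + t))"
    unfolding eq[symmetric] by (rule half_line_increment_bound[OF st dA g]) (auto simp: abs_mult intro!: le)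
  show "norm (profile_B \<rho> (V t) (V' t) t - profile_B \<rho> (V s) (V' s) s) \<le> \<bar>\<mu>\<bar> * S * (1 / (1 + s) - 1 / (1 + t))"
    unfolding eq[symmetric] by (rule half_line_increment_bound[OF st dB g]) (auto simp: abs_mult intro!: le)
qed

text \<open>In the variables \<open>(rho v, v')\<close> the free evolution is a rotation by the
  angle \<open>rho t\<close>, and passing to the profile undoes it.\<close>

lemma profile_inverse:
  "\<rho> *\<^sub>R v = cos (\<rho> * t) *\<^sub>R profile_A \<rho> v v' t + sin (\<rho> * t) *\<^sub>R profile_B \<rho> v v' t"
  "v' = - sin (\<rho> * t) *\<^sub>R profile_A \<rho> v v' t + cos (\<rho> * t) *\<^sub>R profile_B \<rho> v v' t"
proof -
  have sc: "cos (\<rho> * t) * cos (\<rho> * t) = 1 - sin (\<rho> * t) * sin (\<rho> * t)"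
    using sin_cos_squared_add[of "\<rho> * t"] by (simp add: power2_eq_square)
  have "cos (\<rho> * t) *\<^sub>R profile_A \<rho> v v' t + sin (\<rho> * t) *\<^sub>R profile_B \<rho> v v' t
     = ((sin (\<rho> * t))\<^sup>2 + (cos (\<rho> * t))\<^sup>2) *\<^sub>R (\<rho> *\<^sub>R v)"
    unfolding profile_A_def profile_B_def by (simp add: algebra_simps sc power2_eq_square)
  then show "\<rho> *\<^sub>R v = cos (\<rho> * t) *\<^sub>R profile_A \<rho> v v' t + sin (\<rho> * t) *\<^sub>R profile_B \<rho> v v' t" by simp
  have "- sin (\<rho> * t) *\<^sub>R profile_A \<rho> v v' t + cos (\<rho> * t) *\<^sub>R profile_B \<rho> v v' t
     = ((sin (\<rho> * t))\<^sup>2 + (cos (\<rho> * t))\<^sup>2) *\<^sub>R v'"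
    unfolding profile_A_def profile_B_def by (simp add: algebra_simps sc power2_eq_square)
  then show "v' = - sin (\<rho> * t) *\<^sub>R profile_A \<rho> v v' t + cos (\<rho> * t) *\<^sub>R profile_B \<rho> v v' t" by simp
qed

text \<open>The limit is expressed along the integers so that, as a function of the frequency, it
  can later be recognised as the limit of a sequence of measurable functions.\<close>

lemma tail_convergent:
  fixes f :: "real \<Rightarrow> complex"
  assumes S: "S \<ge> 0" and f: "\<And>s t. 0 \<le> s \<Longrightarrow> s \<le> t \<Longrightarrow> norm (f t - f s) \<le> S * (1 / (1 + s) - 1 / (1 + t))"
  shows "(f \<longlongrightarrow> lim (\<lambda>n. f (real n))) at_top"
proof -
  have le: "norm (f t - f s) \<le> S / (1 + s)" if "0 \<le> s" "s \<le> t" for s t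
  proof -
    have "S * (1 / (1 + s) - 1 / (1 + t)) \<le> S * (1 / (1 + s))"
      using S that by (intro mult_left_mono) auto
    then show ?thesis using f[OF that] by simp
  qed
  have z: "((\<lambda>s. S / (1 + s)) \<longlongrightarrow> 0) at_top"
    by (intro tendsto_divide_0[OF tendsto_const] filterlim_at_top_imp_at_infinity
        filterlim_tendsto_add_at_top[OF tendsto_const] filterlim_ident)
  have "Cauchy (\<lambda>n. f (real n))"
  proof (rule CauchyI')
    fix e :: real assume "e > 0"
    have "(\<lambda>n. S / (1 + real n)) \<longlonglongrightarrow> 0" using filterlim_compose[OF z filterlim_real_sequentially] .
    from LIMSEQ_D[OF this \<open>e > 0\<close>] obtain N where "\<And>n. n \<ge> N \<Longrightarrow> \<bar>S / (1 + real n)\<bar> < e" by auto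
    then have "norm (f (real m) - f (real n)) < e" if "m \<ge> N" "n > m" for m n
      using le[of "real m" "real n"] that norm_minus_commute[of "f (real m)" "f (real n)"]
      by (smt (verit) of_nat_0_le_iff of_nat_less_iff)
    then show "\<exists>M. \<forall>m\<ge>M. \<forall>n>m. dist (f (real m)) (f (real n)) < e" unfolding dist_norm by blast
  qed
  then have L: "(\<lambda>n. f (real n)) \<longlonglongrightarrow> lim (\<lambda>n. f (real n))"
    by (simp add: Cauchy_convergent convergent_LIMSEQ_iff[symmetric])
  have "norm (f s - lim (\<lambda>n. f (real n))) \<le> S / (1 + s)" if s: "s \<ge> 0" for s
  proof (rule LIMSEQ_le_const2)
    show "(\<lambda>n. norm (f s - f (real n))) \<longlonglongrightarrow> norm (f s - lim (\<lambda>n. f (real n)))"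
      by (intro tendsto_intros L)
    show "\<exists>N. \<forall>n\<ge>N. norm (f s - f (real n)) \<le> S / (1 + s)"
      by (intro exI[of _ "nat \<lceil>s\<rceil>"]) (auto simp: norm_minus_commute[of "f s"] intro!: le s)
  qed
  then have "((\<lambda>s. f s - lim (\<lambda>n. f (real n))) \<longlongrightarrow> 0) at_top"
    by (intro Lim_null_comparison[OF _ z]) (auto intro!: eventually_at_top_linorderI[of 0])
  then show ?thesis by (simp add: LIM_zero_iff)
qed

section \<open>Comparison with Euler's equation at low frequencies\<close>

definition cpow :: "complex \<Rightarrow> real \<Rightarrow> complex" where
  "cpow c t = exp (of_real (ln (1 + t)) * c)"

lemma cpow_0 [simp]: "cpow c 0 = 1"
  by (simp add: cpow_def)

lemma cpow_add: "cpow (c + d) t = cpow c t * cpow d t"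
  by (simp add: cpow_def exp_add[symmetric] algebra_simps)

lemma norm_cpow: "t \<ge> 0 \<Longrightarrow> norm (cpow c t) = (1 + t) powr Re c"
  by (simp add: cpow_def powr_def mult.commute)

lemma cpow_has_vector_derivative:
  assumes "t \<ge> 0"
  shows "(cpow c has_vector_derivative (c / of_real (1 + t)) * cpow c t) (at t within {0..})"
proof -
  have "((\<lambda>t. ln (1 + t)) has_real_derivative 1 / (1 + t)) (at t within {0..})"
    using assms by (auto intro!: derivative_eq_intros)
  then have "((\<lambda>t. of_real (ln (1 + t)) * c) has_vector_derivative of_real (1 / (1 + t)) * c) (at t within {0..})"
    by (intro has_vector_derivative_mult_left has_vector_derivative_of_real)
  from field_vector_diff_chain_within[OF this, of exp] have
    "((exp \<circ> (\<lambda>t. of_real (ln (1 + t)) * c)) has_vector_derivative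
      of_real (1 / (1 + t)) * c * exp (of_real (ln (1 + t)) * c)) (at t within {0..})"
    by (auto intro: DERIV_exp has_field_derivative_at_within)
  then show ?thesis by (simp add: cpow_def[abs_def] o_def)
qed

text \<open>In the low frequency zone \<open>\<rho> (1 + t) \<le> 1\<close> the mode is a perturbation of the solutions
  \<open>(1 + t) powr \<beta>\<close> and \<open>(1 + t) powr (1 - \<beta>)\<close> of the equation with \<open>\<rho> = 0\<close>. The function \<open>k\<close> is a
  primitive of \<open>(1 + t) powr (- 2 \<beta>)\<close>, so that \<open>(1 + t) powr \<beta> * k\<close> is a second solution.\<close>

lemma damped_mode_low:
  fixes \<beta> :: complex
  assumes ode: "damped_mode \<mu> \<rho> V V'" and \<rho>: "\<rho> > 0" and T: "T \<ge> 0" "\<rho> * (1 + T) \<le> 1"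
    and \<beta>: "\<beta> * (1 - \<beta>) = of_real \<mu>" "Re \<beta> \<ge> 1/2"
    and k: "\<And>t. t \<ge> 0 \<Longrightarrow> (k has_vector_derivative cpow (- 2 * \<beta>) t) (at t within {0..})" "k 0 = 0"
    and K: "\<And>t. 0 \<le> t \<Longrightarrow> t \<le> T \<Longrightarrow> norm (k t) \<le> K"
  defines "M \<equiv> 4/3 * (norm (V 0) + norm (V' 0 - \<beta> * V 0) * K)"
  shows "norm (V T) \<le> (1 + T) powr Re \<beta> * M"
    and "norm (V' T) \<le> (1 + T) powr (- Re \<beta>) * norm (V' 0 - \<beta> * V 0) + (\<rho>\<^sup>2 * (1 + T) + norm \<beta> / (1 + T)) * ((1 + T) powr Re \<beta> * M)"
proof -
  define b where "b = Re \<beta>"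
  have b: "b \<ge> 1/2" using \<beta> by (simp add: b_def)
  \<comment> \<open>Reduction of order. \<open>W\<close> is the quotient of \<open>V\<close> by the
    solution \<open>(1+t)^beta\<close> of Euler's equation, and \<open>Q\<close> is
    \<open>(1+t)^(2 beta) W'\<close>, which would be constant if \<rho> were 0.\<close>
  define W where "W t = cpow (- \<beta>) t * V t" for t
  define Q where "Q t = cpow \<beta> t * (V' t - (\<beta> / of_real (1 + t)) * V t)" for t
  have V: "(V has_vector_derivative V' x) (at x within {0..})"
    and V': "(V' has_vector_derivative - (\<rho>\<^sup>2 *\<^sub>R V x) - (\<mu> / (1 + x)\<^sup>2) *\<^sub>R V x) (at x within {0..})"
    if "x \<ge> 0" for x using ode that by (auto simp: damped_mode_def)
  have VW: "V t = cpow \<beta> t * W t" and V'Q: "V' t = cpow (- \<beta>) t * Q t + (\<beta> / of_real (1 + t)) * V t" for t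
    unfolding W_def Q_def mult.assoc[symmetric] cpow_add[symmetric] by (simp_all add: cpow_def)
  have dW: "(W has_vector_derivative cpow (- 2 * \<beta>) x * Q x) (at x within {0..})" if x: "x \<ge> 0" for x
    unfolding W_def[abs_def]
  proof (rule has_vector_derivative_eq_rhs[OF has_vector_derivative_mult[OF cpow_has_vector_derivative[OF x] V[OF x]]])
    have e: "cpow (- 2 * \<beta>) x * cpow \<beta> x = cpow (- \<beta>) x"
      unfolding cpow_add[symmetric] by simp
    show "cpow (- \<beta>) x * V' x + - \<beta> / of_real (1 + x) * cpow (- \<beta>) x * V x = cpow (- 2 * \<beta>) x * Q x"
      unfolding Q_def mult.assoc[symmetric] e by (simp add: algebra_simps)
  qed
  have dQ: "(Q has_vector_derivative - (\<rho>\<^sup>2 *\<^sub>R (cpow \<beta> x * V x))) (at x within {0..})" if x: "x \<ge> 0" for x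
    unfolding Q_def[abs_def]
  proof (rule has_vector_derivative_eq_rhs[OF has_vector_derivative_mult[OF cpow_has_vector_derivative[OF x]
          has_vector_derivative_diff[OF V'[OF x] has_vector_derivative_mult[OF _ V[OF x]]]]])
    have "((\<lambda>t. \<beta> * of_real (1 / (1 + t))) has_vector_derivative \<beta> * of_real (- 1 / (1 + x)\<^sup>2)) (at x within {0..})"
      using x by (intro has_vector_derivative_mult_right has_vector_derivative_of_real)
        (auto intro!: derivative_eq_intros simp: power2_eq_square)
    then show "((\<lambda>t. \<beta> / of_real (1 + t)) has_vector_derivative \<beta> * of_real (- 1 / (1 + x)\<^sup>2)) (at x within {0..})"
      by simp
    define \<tau> :: complex where "\<tau> = of_real (1 + x)"
    have "of_real (1 + x) \<noteq> (0::complex)" using x unfolding of_real_eq_0_iff by simp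
    then have \<tau>: "\<tau> \<noteq> 0" by (simp only: \<tau>_def not_False_eq_True)
    have m: "of_real (\<mu> / (1 + x)\<^sup>2) = \<beta> * (1 - \<beta>) / \<tau>\<^sup>2" by (simp add: \<tau>_def \<beta>)
    have i: "of_real (- 1 / (1 + x)\<^sup>2) = - 1 / \<tau>\<^sup>2" by (simp add: \<tau>_def)
    show "cpow \<beta> x * (- (\<rho>\<^sup>2 *\<^sub>R V x) - (\<mu> / (1 + x)\<^sup>2) *\<^sub>R V x -
         (\<beta> / of_real (1 + x) * V' x + \<beta> * of_real (- 1 / (1 + x)\<^sup>2) * V x)) +
        \<beta> / of_real (1 + x) * cpow \<beta> x * (V' x - \<beta> / of_real (1 + x) * V x) =
        - (\<rho>\<^sup>2 *\<^sub>R (cpow \<beta> x * V x))"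
      unfolding scaleR_conv_of_real m i \<tau>_def[symmetric] using \<tau>
      by (simp add: field_simps power2_eq_square)
  qed
  have nW: "norm (V t) = (1 + t) powr b * norm (W t)" if "t \<ge> 0" for t
    using that by (subst VW) (simp add: norm_mult norm_cpow b_def)
  have "continuous_on {0..} W"
    by (rule continuous_on_vector_derivative) (use dW in auto)
  then have "continuous_on {0..T} (\<lambda>t. norm (W t))"
    by (intro continuous_on_norm) (auto elim: continuous_on_subset)
  \<comment> \<open>The maximum \<open>N\<close> of \<open>|W|\<close> on the zone gets bounded in
    terms of itself with factor 1/4; absorbing this term gives the 4/3 in \<open>M\<close>.\<close>
  from continuous_attains_sup[OF _ _ this] T obtain t0 where t0: "0 \<le> t0" "t0 \<le> T"
    and max: "\<And>t. 0 \<le> t \<Longrightarrow> t \<le> T \<Longrightarrow> norm (W t) \<le> norm (W t0)" by auto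
  define N where "N = norm (W t0)"
  have N0: "N \<ge> 0" by (simp add: N_def)
  have dpow: "((\<lambda>x. (c / a) * (1 + x) powr a) has_real_derivative c * (1 + x) powr (a - 1)) (at x within {0..})"
    if "x \<ge> 0" "a > 0" for x c a :: real
    using that by (auto intro!: derivative_eq_intros)
  have Qle: "norm (Q t - Q 0) \<le> \<rho>\<^sup>2 * N * (1 + t) powr (2 * b + 1) / (2 * b + 1)" if t: "0 \<le> t" "t \<le> T" for t
  proof -
    have "norm (Q t - Q 0) \<le> (\<rho>\<^sup>2 * N / (2 * b + 1)) * (1 + t) powr (2 * b + 1) - (\<rho>\<^sup>2 * N / (2 * b + 1)) * (1 + 0) powr (2 * b + 1)"
    proof (rule half_line_increment_bound[OF order_refl t(1) dQ dpow])
      fix x assume x: "0 \<le> x" "x \<le> t"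
      have "norm (- (\<rho>\<^sup>2 *\<^sub>R (cpow \<beta> x * V x))) = \<rho>\<^sup>2 * norm (W x) * ((1 + x) powr b * (1 + x) powr b)"
        using x by (simp add: norm_mult norm_cpow nW b_def[symmetric] mult_ac)
      also have "\<dots> \<le> \<rho>\<^sup>2 * N * ((1 + x) powr b * (1 + x) powr b)"
        using max[of x] x t by (intro mult_right_mono mult_left_mono) (auto simp: N_def)
      finally show "norm (- (\<rho>\<^sup>2 *\<^sub>R (cpow \<beta> x * V x))) \<le> \<rho>\<^sup>2 * N * (1 + x) powr (2 * b + 1 - 1)"
        by (simp add: powr_add[symmetric])
    qed (use b in auto)
    moreover have "0 \<le> (\<rho>\<^sup>2 * N / (2 * b + 1)) * (1 + 0) powr (2 * b + 1)"
      using b N0 by simp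
    ultimately show ?thesis by simp
  qed
  have rT: "\<rho>\<^sup>2 * (1 + t)\<^sup>2 \<le> 1" if "0 \<le> t" "t \<le> T" for t
  proof -
    have "\<rho> * (1 + t) \<le> \<rho> * (1 + T)" using that \<rho> by (intro mult_left_mono) auto
    then have "\<rho> * (1 + t) \<le> 1" using T by linarith
    then have "(\<rho> * (1 + t))\<^sup>2 \<le> 1" using \<rho> that by (intro power_le_one) auto
    then show ?thesis by (simp add: power_mult_distrib)
  qed
  \<comment> \<open>Subtracting \<open>Q 0 * k t\<close> integrates the part of \<open>W'\<close>
    driven by the initial value of \<open>Q\<close> exactly; the rest is at most
    \<open>rho^2 (1+t)^2 N / 4\<close>.\<close>
  have Wle: "norm (W t) \<le> norm (V 0) + norm (Q 0) * K + N / 4" if t: "0 \<le> t" "t \<le> T" for t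
  proof -
    have "norm ((W t - Q 0 * k t) - (W 0 - Q 0 * k 0)) \<le> (\<rho>\<^sup>2 * N / 2 / 2) * (1 + t) powr 2 - (\<rho>\<^sup>2 * N / 2 / 2) * (1 + 0) powr 2"
    proof (rule half_line_increment_bound[OF order_refl t(1) has_vector_derivative_diff[OF dW
          has_vector_derivative_mult_right[OF k(1)]] dpow])
      fix x assume x: "0 \<le> x" "x \<le> t"
      have "norm (cpow (- 2 * \<beta>) x * Q x - Q 0 * cpow (- 2 * \<beta>) x) = (1 + x) powr (- 2 * b) * norm (Q x - Q 0)"
      proof -
        have "cpow (- 2 * \<beta>) x * Q x - Q 0 * cpow (- 2 * \<beta>) x = cpow (- 2 * \<beta>) x * (Q x - Q 0)"
          by (simp add: algebra_simps)
        then show ?thesis using x by (simp only: norm_mult norm_cpow) (simp add: b_def)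
      qed
      also have "\<dots> \<le> (1 + x) powr (- 2 * b) * (\<rho>\<^sup>2 * N * (1 + x) powr (2 * b + 1) / (2 * b + 1))"
        using x t by (intro mult_left_mono Qle) auto
      also have "\<dots> = \<rho>\<^sup>2 * N * ((1 + x) powr (- 2 * b) * (1 + x) powr (2 * b + 1)) / (2 * b + 1)"
        by simp
      also have "(1 + x) powr (- 2 * b) * (1 + x) powr (2 * b + 1) = 1 + x"
        using x by (simp add: powr_add[symmetric])
      \<comment> \<open>\<open>2b + 1 >= 2\<close> since \<open>b >= 1/2\<close>; together with the
        2 from integrating \<open>1 + x\<close> this makes up the factor 1/4.\<close>
      also have "\<rho>\<^sup>2 * N * (1 + x) / (2 * b + 1) \<le> \<rho>\<^sup>2 * N * (1 + x) / 2"
        using b x N0 by (intro divide_left_mono mult_nonneg_nonneg) auto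
      finally show "norm (cpow (- 2 * \<beta>) x * Q x - Q 0 * cpow (- 2 * \<beta>) x) \<le> \<rho>\<^sup>2 * N / 2 * (1 + x) powr (2 - 1)"
        using x by simp
    qed auto
    also have "\<dots> \<le> N / 4 * (\<rho>\<^sup>2 * (1 + t)\<^sup>2)"
      using t N0 by (simp add: powr_numeral)
    also have "\<dots> \<le> N / 4 * 1"
      using rT[OF t] N0 by (intro mult_left_mono) auto
    finally have *: "norm ((W t - Q 0 * k t) - W 0) \<le> N / 4" using k(2) by simp
    have "W t = ((W t - Q 0 * k t) - W 0) + (W 0 + Q 0 * k t)" by simp
    then have "norm (W t) \<le> norm ((W t - Q 0 * k t) - W 0) + norm (W 0 + Q 0 * k t)"
      by (metis norm_triangle_ineq)
    also have "\<dots> \<le> N / 4 + (norm (W 0) + norm (Q 0) * norm (k t))"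
      using * norm_triangle_ineq[of "W 0" "Q 0 * k t"] by (simp add: norm_mult)
    also have "\<dots> \<le> N / 4 + (norm (V 0) + norm (Q 0) * K)"
      using K[OF t] by (intro add_left_mono add_mono mult_left_mono) (auto simp: W_def)
    finally show ?thesis by simp
  qed
  have Q0: "Q 0 = V' 0 - \<beta> * V 0" by (simp add: Q_def)
  have NM: "N \<le> M" using Wle[OF t0] unfolding M_def Q0[symmetric] N_def by simp
  show VT: "norm (V T) \<le> (1 + T) powr Re \<beta> * M"
    using max[OF T(1) order_refl] NM nW[OF T(1)] unfolding b_def[symmetric] N_def[symmetric]
    by (simp add: mult_left_mono)
  have "norm (V' T) \<le> norm (cpow (- \<beta>) T * Q T) + norm ((\<beta> / of_real (1 + T)) * V T)"
    by (subst V'Q) (rule norm_triangle_ineq)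
  also have "norm (cpow (- \<beta>) T * Q T) = (1 + T) powr (- b) * norm (Q T)"
    using T by (simp add: norm_mult norm_cpow b_def)
  also have "norm ((\<beta> / of_real (1 + T)) * V T) = norm \<beta> / (1 + T) * norm (V T)"
  proof -
    have "norm (of_real (1 + T) :: complex) = 1 + T" using T by (simp only: norm_of_real)
    then show ?thesis by (simp only: norm_mult norm_divide)
  qed
  also have "\<dots> \<le> norm \<beta> / (1 + T) * ((1 + T) powr b * M)"
    using VT T unfolding b_def[symmetric] by (intro mult_left_mono) auto
  also have "(1 + T) powr (- b) * norm (Q T) \<le> (1 + T) powr (- b) * (norm (Q 0) + \<rho>\<^sup>2 * M * (1 + T) powr (2 * b + 1))"
  proof (rule mult_left_mono)
    have "norm (Q T) \<le> norm (Q 0) + norm (Q T - Q 0)"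
      using norm_triangle_ineq[of "Q 0" "Q T - Q 0"] by simp
    also have "norm (Q T - Q 0) \<le> \<rho>\<^sup>2 * N * (1 + T) powr (2 * b + 1) / (2 * b + 1)"
      by (rule Qle) (use T in auto)
    also have "\<dots> \<le> \<rho>\<^sup>2 * N * (1 + T) powr (2 * b + 1) / 1"
      using b N0 by (intro divide_left_mono mult_nonneg_nonneg) auto
    also have "\<dots> \<le> \<rho>\<^sup>2 * M * (1 + T) powr (2 * b + 1)"
      using NM by (simp add: mult_left_mono mult_right_mono)
    finally show "norm (Q T) \<le> norm (Q 0) + \<rho>\<^sup>2 * M * (1 + T) powr (2 * b + 1)" by simp
  qed simp
  also have "(1 + T) powr (- b) * (norm (Q 0) + \<rho>\<^sup>2 * M * (1 + T) powr (2 * b + 1))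
     = (1 + T) powr (- b) * norm (Q 0) + \<rho>\<^sup>2 * (1 + T) * ((1 + T) powr b * M)"
  proof -
    have "(1 + T) powr (- b) * (1 + T) powr (2 * b + 1) = (1 + T) powr b * (1 + T)"
    proof -
      have "(1 + T) powr (- b) * (1 + T) powr (2 * b + 1) = (1 + T) powr (b + 1)"
        unfolding powr_add[symmetric] by simp
      also have "\<dots> = (1 + T) powr b * (1 + T) powr 1" by (rule powr_add)
      also have "(1 + T) powr 1 = 1 + T" using T by simp
      finally show ?thesis .
    qed
    then have "((1 + T) powr (- b) * (1 + T) powr (2 * b + 1)) * (\<rho>\<^sup>2 * M) = ((1 + T) powr b * (1 + T)) * (\<rho>\<^sup>2 * M)"
      by (rule arg_cong)
    then show ?thesis by (simp only: distrib_left mult_ac)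
  qed
  finally show "norm (V' T) \<le> (1 + T) powr (- Re \<beta>) * norm (V' 0 - \<beta> * V 0) + (\<rho>\<^sup>2 * (1 + T) + norm \<beta> / (1 + T)) * ((1 + T) powr Re \<beta> * M)"
    unfolding Q0 b_def by (simp add: algebra_simps)
qed

lemma Re_nu_nonneg: "0 \<le> Re (nu \<mu>)"
  by (simp add: nu_def)

lemma nu_squared: "(nu \<mu>)\<^sup>2 = of_real (1/4 - \<mu>)"
proof (cases "\<mu> \<le> 1/4")
  case True
  then have "(sqrt (1 - 4 * \<mu>))\<^sup>2 = 1 - 4 * \<mu>" by simp
  then have "(complex_of_real (sqrt (1 - 4 * \<mu>)))\<^sup>2 = of_real (1 - 4 * \<mu>)"
    unfolding of_real_power[symmetric] by simp
  with True show ?thesis by (simp add: nu_def power_divide field_simps)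
next
  case False
  then have "(sqrt (4 * \<mu> - 1))\<^sup>2 = 4 * \<mu> - 1" by simp
  then have "(complex_of_real (sqrt (4 * \<mu> - 1)))\<^sup>2 = of_real (4 * \<mu> - 1)"
    unfolding of_real_power[symmetric] by simp
  with False show ?thesis by (simp add: nu_def power_divide power_mult_distrib field_simps)
qed

lemma nu_eq_0_iff: "nu \<mu> = 0 \<longleftrightarrow> \<mu> = 1/4"
proof -
  have "nu \<mu> = 0 \<longleftrightarrow> (nu \<mu>)\<^sup>2 = 0" by simp
  also have "\<dots> \<longleftrightarrow> 1/4 - \<mu> = 0" unfolding nu_squared of_real_eq_0_iff ..
  finally show ?thesis by auto
qed

lemma cpow_minus_one: "t \<ge> 0 \<Longrightarrow> cpow (- 1) t = of_real (1 / (1 + t))"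
proof -
  assume t: "t \<ge> 0"
  have "cpow (- 1) t = exp (of_real (- ln (1 + t)))" by (simp add: cpow_def)
  also have "\<dots> = of_real (exp (- ln (1 + t)))" by (rule exp_of_real)
  also have "exp (- ln (1 + t)) = 1 / (1 + t)" using t by (simp add: exp_minus divide_inverse)
  finally show ?thesis .
qed

text \<open>For \<open>mu = 1/4\<close> the two exponents of Euler's equation coincide, the
  integrand is \<open>1/(1+t)\<close> and the primitive is a logarithm: the origin of
  \<open>delta\<close>. Otherwise the primitive involves a power with exponent
  \<open>gamma = - 2 nu\<close>, bounded because \<open>Re nu >= 0\<close>.\<close>

lemma second_solution_exists:
  fixes \<mu> :: real
  defines "\<beta> \<equiv> 1/2 + nu \<mu>"
  shows "\<exists>k C. C \<ge> 0 \<and> (\<forall>t\<ge>0. (k has_vector_derivative cpow (- 2 * \<beta>) t) (at t within {0..})) \<and> k 0 = 0 \<and>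
     (\<forall>t\<ge>0. norm (k t) \<le> C * (1 + ln (1 + t)) powr delta \<mu>)"
proof (cases "\<mu> = 1/4")
  case True
  then have \<beta>: "- 2 * \<beta> = -1" using nu_eq_0_iff[of \<mu>] by (simp add: \<beta>_def)
  have c: "cpow (-1) t = of_real (1 / (1 + t))" if "t \<ge> 0" for t
    by (rule cpow_minus_one[OF that])
  show ?thesis
  proof (intro exI[of _ "\<lambda>t. of_real (ln (1 + t))"] exI[of _ "1::real"] conjI allI impI)
    fix t :: real assume t: "t \<ge> 0"
    show "((\<lambda>t. of_real (ln (1 + t))) has_vector_derivative cpow (- 2 * \<beta>) t) (at t within {0..})"
      unfolding \<beta> c[OF t] using t by (intro has_vector_derivative_of_real) (auto intro!: derivative_eq_intros)
    show "norm (complex_of_real (ln (1 + t))) \<le> 1 * (1 + ln (1 + t)) powr delta \<mu>"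
      using t True by (simp add: delta_def)
  qed simp_all
next
  case False
  define \<gamma> where "\<gamma> = 1 - 2 * \<beta>"
  have \<gamma>: "\<gamma> \<noteq> 0" "Re \<gamma> \<le> 0" using nu_eq_0_iff[of \<mu>] False Re_nu_nonneg[of \<mu>] by (simp_all add: \<gamma>_def \<beta>_def)
  have c: "cpow (- 2 * \<beta>) t = (1 / of_real (1 + t)) * cpow \<gamma> t" if "t \<ge> 0" for t
  proof -
    have "cpow (-1) t = of_real (1 / (1 + t))"
      by (rule cpow_minus_one[OF that])
    moreover have "- 2 * \<beta> = -1 + \<gamma>" by (simp add: \<gamma>_def)
    ultimately show ?thesis by (simp only: cpow_add of_real_divide of_real_1)
  qed
  show ?thesis
  proof (intro exI[of _ "\<lambda>t. (cpow \<gamma> t - 1) / \<gamma>"] exI[of _ "2 / norm \<gamma>"] conjI allI impI)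
    fix t :: real assume t: "t \<ge> 0"
    have "((\<lambda>t. (cpow \<gamma> t - 1) / \<gamma>) has_vector_derivative (\<gamma> / of_real (1 + t) * cpow \<gamma> t - 0) / \<gamma>) (at t within {0..})"
      by (intro has_vector_derivative_divide has_vector_derivative_diff cpow_has_vector_derivative[OF t] has_vector_derivative_const)
    then show "((\<lambda>t. (cpow \<gamma> t - 1) / \<gamma>) has_vector_derivative cpow (- 2 * \<beta>) t) (at t within {0..})"
      unfolding c[OF t] using \<gamma>(1) by simp
    have "norm (cpow \<gamma> t) \<le> 1"
      unfolding norm_cpow[OF t] using powr_mono[OF \<gamma>(2), of "1 + t"] t by simp
    then have "norm (cpow \<gamma> t - 1) \<le> 2"
      using norm_triangle_ineq4[of "cpow \<gamma> t" 1] by simp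
    moreover have "(1 + ln (1 + t)) powr delta \<mu> = 1"
    proof -
      have "1 + ln (1 + t) > 0" using t ln_ge_zero[of "1 + t"] by linarith
      then show ?thesis using False by (simp add: delta_def)
    qed
    ultimately show "norm ((cpow \<gamma> t - 1) / \<gamma>) \<le> 2 / norm \<gamma> * (1 + ln (1 + t)) powr delta \<mu>"
      by (simp add: norm_divide divide_right_mono)
  qed simp_all
qed

lemma delta_nonneg: "0 \<le> delta \<mu>"
  by (simp add: delta_def)

text \<open>For \<open>rho >= 1\<close> the energy estimate starts at time 0; for
  \<open>rho (1 + t) <= 1\<close> the comparison with Euler's equation lasts up to \<open>t\<close>;
  in between the two are joined at the time \<open>T\<close> with \<open>rho (1 + T) = 1\<close>.
  The power of the minimum records how long the mode was allowed to grow.\<close>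

proposition damped_mode_bound:
  shows "\<exists>C>0. \<forall>\<rho>>0. \<forall>V V'. damped_mode \<mu> \<rho> V V' \<longrightarrow> (\<forall>t\<ge>0. norm (V t) \<le>
     C * (1 + ln (1 + t)) powr delta \<mu> * min (1 + t) (max 1 (1 / \<rho>)) powr (1/2 + Re (nu \<mu>)) * (norm (V 0) + norm (V' 0)))"
proof -
  define \<beta> where "\<beta> = 1/2 + nu \<mu>"
  define b where "b = 1/2 + Re (nu \<mu>)"
  define L where "L t = (1 + ln (1 + t)) powr delta \<mu>" for t
  have b: "b = Re \<beta>" "b \<ge> 1/2" using Re_nu_nonneg[of \<mu>] by (simp_all add: b_def \<beta>_def)
  have \<beta>\<mu>: "\<beta> * (1 - \<beta>) = of_real \<mu>"
  proof -
    have "\<beta> * (1 - \<beta>) = 1/4 - (nu \<mu>)\<^sup>2" by (simp add: \<beta>_def power2_eq_square field_simps)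
    then show ?thesis unfolding nu_squared by simp
  qed
  have L1: "1 \<le> L t" if "t \<ge> 0" for t
    using that unfolding L_def by (intro ge_one_powr_ge_zero delta_nonneg) auto
  have Lmono: "L s \<le> L t" if "0 \<le> s" "s \<le> t" for s t
    using that unfolding L_def by (intro powr_mono2 delta_nonneg) (auto intro: add_nonneg_nonneg)
  obtain k Ck where k: "\<And>t. t \<ge> 0 \<Longrightarrow> (k has_vector_derivative cpow (- 2 * \<beta>) t) (at t within {0..})" "k 0 = 0"
    and Ck: "Ck \<ge> 0" "\<And>t. t \<ge> 0 \<Longrightarrow> norm (k t) \<le> Ck * L t"
    using second_solution_exists[of \<mu>] unfolding \<beta>_def L_def by auto
  \<comment> \<open>The constant of the low zone: \<open>4/3\<close> comes from the absorption,
    \<open>1 + |beta|\<close> from bounding \<open>V' 0 - beta V 0\<close> by the data, and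
    \<open>Ck\<close> from the second solution.\<close>
  define C1 where "C1 = 4/3 * (1 + (1 + norm \<beta>) * Ck)"
  have C1: "C1 \<ge> 1" using Ck by (simp add: C1_def add_increasing2)
  \<comment> \<open>The second summand is for frequencies that pass from the low zone to the high
    one; it also dominates \<open>exp |mu|\<close>, the constant for
    \<open>rho >= 1\<close>.\<close>
  define C where "C = C1 + exp \<bar>\<mu>\<bar> * ((2 + norm \<beta>) * C1 + (1 + norm \<beta>))"
  have C: "C \<ge> C1" "C \<ge> exp \<bar>\<mu>\<bar> * ((2 + norm \<beta>) * C1 + (1 + norm \<beta>))" "C \<ge> exp \<bar>\<mu>\<bar>"
  proof -
    have "0 \<le> exp \<bar>\<mu>\<bar> * ((2 + norm \<beta>) * C1 + (1 + norm \<beta>))" using C1 by simp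
    then show "C \<ge> C1" by (simp add: C_def)
    show *: "C \<ge> exp \<bar>\<mu>\<bar> * ((2 + norm \<beta>) * C1 + (1 + norm \<beta>))" using C1 by (simp add: C_def)
    have "exp \<bar>\<mu>\<bar> * 1 \<le> exp \<bar>\<mu>\<bar> * ((2 + norm \<beta>) * C1 + (1 + norm \<beta>))"
      using C1 by (intro mult_left_mono) (auto intro!: add_increasing)
    from order_trans[OF this *] show "C \<ge> exp \<bar>\<mu>\<bar>" by simp
  qed
  have main: "norm (V t) \<le> C * L t * min (1 + t) (max 1 (1 / \<rho>)) powr b * (norm (V 0) + norm (V' 0))"
    if \<rho>: "\<rho> > 0" and ode: "damped_mode \<mu> \<rho> V V'" and t: "t \<ge> 0" for \<rho> V V' t
  proof -
    define D where "D = norm (V 0) + norm (V' 0)"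
    define q where "q = norm (V' 0 - \<beta> * V 0)"
    have D0: "D \<ge> 0" by (simp add: D_def)
    have q: "q \<le> (1 + norm \<beta>) * D"
    proof -
      have "q \<le> norm (V' 0) + norm \<beta> * norm (V 0)"
        unfolding q_def using norm_triangle_ineq4[of "V' 0" "\<beta> * V 0"] by (simp add: norm_mult)
      also have "\<dots> \<le> 1 * D + norm \<beta> * D"
        by (intro add_mono mult_left_mono) (auto simp: D_def)
      finally show ?thesis by (simp add: algebra_simps)
    qed
    have MT: "4/3 * (norm (V 0) + q * (Ck * L T)) \<le> C1 * L T * D" if T: "T \<ge> 0" for T
    proof -
      have "norm (V 0) + q * (Ck * L T) \<le> L T * D + ((1 + norm \<beta>) * D) * (Ck * L T)"
      proof (intro add_mono mult_right_mono q)
        have "1 * D \<le> L T * D" using L1[OF T] D0 by (intro mult_right_mono) auto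
        then show "norm (V 0) \<le> L T * D" by (simp add: D_def) (smt (verit) norm_ge_zero)
        show "0 \<le> Ck * L T" using Ck L1[OF T] by simp
      qed
      then show ?thesis by (simp add: C1_def algebra_simps)
    qed
    have low: "norm (V T) \<le> (1 + T) powr b * (C1 * L T * D)"
       "norm (V' T) \<le> (1 + T) powr (- b) * q + (\<rho>\<^sup>2 * (1 + T) + norm \<beta> / (1 + T)) * ((1 + T) powr b * (C1 * L T * D))"
      if T: "T \<ge> 0" "\<rho> * (1 + T) \<le> 1" for T
    proof -
      have K: "norm (k x) \<le> Ck * L T" if "0 \<le> x" "x \<le> T" for x
        using Ck(2)[OF that(1)] mult_left_mono[OF Lmono[OF that] Ck(1)] by linarith
      have l: "norm (V T) \<le> (1 + T) powr b * (4/3 * (norm (V 0) + q * (Ck * L T)))"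
        "norm (V' T) \<le> (1 + T) powr (- b) * q + (\<rho>\<^sup>2 * (1 + T) + norm \<beta> / (1 + T)) * ((1 + T) powr b * (4/3 * (norm (V 0) + q * (Ck * L T))))"
        unfolding q_def b(1)
        by (rule damped_mode_low[OF ode \<rho> T \<beta>\<mu> b(2)[unfolded b(1)] k K]; simp)+
      show "norm (V T) \<le> (1 + T) powr b * (C1 * L T * D)"
        by (rule order_trans[OF l(1)], intro mult_left_mono MT T) auto
      show "norm (V' T) \<le> (1 + T) powr (- b) * q + (\<rho>\<^sup>2 * (1 + T) + norm \<beta> / (1 + T)) * ((1 + T) powr b * (C1 * L T * D))"
        by (rule order_trans[OF l(2)], intro add_left_mono mult_left_mono MT T) (use T in auto)
    qed
    consider (high) "\<rho> \<ge> 1" | (low) "\<rho> < 1" "\<rho> * (1 + t) \<le> 1" | (mid) "\<rho> < 1" "\<rho> * (1 + t) > 1" by linarith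
    then show ?thesis unfolding D_def[symmetric]
    proof cases
      case high
      have m: "min (1 + t) (max 1 (1 / \<rho>)) = 1" using high t by (simp add: field_simps)
      have "\<rho> * norm (V t) \<le> exp \<bar>\<mu>\<bar> * (\<rho> * norm (V 0) + norm (V' 0))"
        using damped_mode_high[OF ode \<rho> order_refl t] high by simp
      also have "\<dots> \<le> exp \<bar>\<mu>\<bar> * (\<rho> * D)"
        using high mult_right_mono[OF high, of "norm (V' 0)"] by (intro mult_left_mono) (auto simp: D_def algebra_simps)
      finally have "\<rho> * norm (V t) \<le> \<rho> * (exp \<bar>\<mu>\<bar> * D)" by (simp add: mult_ac)
      then have "norm (V t) \<le> exp \<bar>\<mu>\<bar> * D" using \<rho> by simp
      also have "\<dots> \<le> (C * L t) * D"
      proof (rule mult_right_mono[OF _ D0])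
        have "exp \<bar>\<mu>\<bar> * 1 \<le> C * L t"
          using C(3) L1[OF t] by (intro mult_mono order_trans[OF _ C(3)]) auto
        then show "exp \<bar>\<mu>\<bar> \<le> C * L t" by simp
      qed
      finally show "norm (V t) \<le> C * L t * min (1 + t) (max 1 (1 / \<rho>)) powr b * D" unfolding m by simp
    next
      case low
      have "1 + t \<le> 1 / \<rho>" using low \<rho> by (simp add: field_simps)
      then have m: "min (1 + t) (max 1 (1 / \<rho>)) = 1 + t" by simp
      have "norm (V t) \<le> C1 * (L t * (1 + t) powr b * D)"
        using \<open>\<And>T. 0 \<le> T \<Longrightarrow> \<rho> * (1 + T) \<le> 1 \<Longrightarrow> norm (V T) \<le> (1 + T) powr b * (C1 * L T * D)\<close>[OF t low(2)]
        by (simp add: mult_ac)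
      also have "\<dots> \<le> C * (L t * (1 + t) powr b * D)"
        using C(1) L1[OF t] D0 by (intro mult_right_mono) auto
      finally show "norm (V t) \<le> C * L t * min (1 + t) (max 1 (1 / \<rho>)) powr b * D" unfolding m by (simp add: mult_ac)
    next
      case mid
      \<comment> \<open>The time at which the mode leaves the low zone; it is nonnegative because
        \<open>rho < 1\<close>.\<close>
      define T where "T = 1 / \<rho> - 1"
      have T: "T \<ge> 0" "\<rho> * (1 + T) = 1" "1 + T = 1 / \<rho>" "T \<le> t"
        using mid \<rho> by (auto simp: T_def field_simps)
      define X where "X = (1 / \<rho>) powr b"
      have X0: "X \<ge> 0" by (simp add: X_def)
      have m: "min (1 + t) (max 1 (1 / \<rho>)) = 1 / \<rho>" using T mid \<rho> by (simp add: field_simps)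
      define Y where "Y = C1 * L T * D"
      have Y: "Y \<le> C1 * (L t * D)" "Y \<ge> 0"
        unfolding Y_def using C1 Lmono[OF T(1) T(4)] L1[OF T(1)] D0
        by (auto simp: mult.assoc intro!: mult_left_mono mult_right_mono)
      have v: "norm (V T) \<le> X * Y" unfolding X_def Y_def T(3)[symmetric] using low(1)[OF T(1)] T(2) by simp
      have "norm (V' T) \<le> (1 / \<rho>) powr (- b) * q + (\<rho> + norm \<beta> * \<rho>) * (X * Y)"
        using low(2)[OF T(1)] T(2) \<rho> unfolding X_def Y_def T(3)[symmetric]
        by (simp add: T(3) power2_eq_square)
      \<comment> \<open>Here \<open>b >= 1/2\<close> and \<open>1/rho > 1\<close> enter: the
        exponent \<open>-b\<close> that weighs the initial slope is dominated by
        \<open>b - 1\<close>, the growth exponent of the derivative of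
        \<open>(1+t)^b\<close>.\<close>
      also have "(1 / \<rho>) powr (- b) \<le> \<rho> * X"
      proof -
        have "(1 / \<rho>) powr (- b) \<le> (1 / \<rho>) powr (b - 1)"
          using mid \<rho> b by (intro powr_mono) auto
        also have "\<dots> = \<rho> * X" using \<rho> by (simp add: powr_diff X_def)
        finally show ?thesis .
      qed
      finally have v': "norm (V' T) \<le> \<rho> * X * q + (\<rho> + norm \<beta> * \<rho>) * (X * Y)"
        by (simp add: q_def mult_right_mono)
      have "\<rho> * norm (V t) \<le> exp \<bar>\<mu>\<bar> * (\<rho> * norm (V T) + norm (V' T))"
        using damped_mode_high[OF ode \<rho> T(1) T(4)] T(2) by simp
      also have "\<dots> \<le> exp \<bar>\<mu>\<bar> * (\<rho> * (X * Y) + (\<rho> * X * q + (\<rho> + norm \<beta> * \<rho>) * (X * Y)))"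
        using v v' \<rho> by (intro mult_left_mono add_mono) auto
      also have "\<dots> = \<rho> * (exp \<bar>\<mu>\<bar> * (X * ((2 + norm \<beta>) * Y + q)))" by (simp add: algebra_simps)
      finally have "norm (V t) \<le> exp \<bar>\<mu>\<bar> * (X * ((2 + norm \<beta>) * Y + q))" using \<rho> by simp
      also have "\<dots> \<le> exp \<bar>\<mu>\<bar> * (X * ((2 + norm \<beta>) * (C1 * (L t * D)) + (1 + norm \<beta>) * (L t * D)))"
      proof (intro mult_left_mono add_mono Y X0)
        have "(1 + norm \<beta>) * (1 * D) \<le> (1 + norm \<beta>) * (L t * D)"
          using L1[OF t] D0 by (intro mult_left_mono mult_right_mono) auto
        then show "q \<le> (1 + norm \<beta>) * (L t * D)" using q by simp
      qed auto
      also have "\<dots> = (exp \<bar>\<mu>\<bar> * ((2 + norm \<beta>) * C1 + (1 + norm \<beta>))) * (L t * X * D)" by (simp add: algebra_simps)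
      also have "\<dots> \<le> C * (L t * X * D)"
        using C(2) L1[OF t] D0 X0 by (intro mult_right_mono) auto
      finally show "norm (V t) \<le> C * L t * min (1 + t) (max 1 (1 / \<rho>)) powr b * D" unfolding m X_def by (simp add: mult_ac)
    qed
  qed
  have "C > 0" using C(1) C1 by linarith
  with main show ?thesis unfolding L_def b_def by blast
qed

subsection \<open>Low frequencies of the data\<close>

definition L1_high :: "('a::euclidean_space \<Rightarrow> complex) \<Rightarrow> real \<Rightarrow> real" where
  "L1_high f \<kappa> = (LINT x|lborel. (if \<kappa> < norm (f x) then norm (f x) else 0))"

definition L2_low :: "('a::euclidean_space \<Rightarrow> complex) \<Rightarrow> real \<Rightarrow> real" where
  "L2_low f \<kappa> = (LINT x|lborel. (if norm (f x) \<le> \<kappa> then (norm (f x))\<^sup>2 else 0))"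

lemma L1_high_integrable:
  fixes f :: "'a::euclidean_space \<Rightarrow> complex"
  assumes f: "f \<in> Lp 2" and \<kappa>: "\<kappa> > 0"
  shows "integrable lborel (\<lambda>x. if \<kappa> < norm (f x) then norm (f x) else 0)"
proof (rule Bochner_Integration.integrable_bound)
  note [measurable] = Lp_measurable[OF f]
  show "integrable lborel (\<lambda>x. (norm (f x))\<^sup>2 / \<kappa>)" using f by (simp add: Lp2_iff)
  show "(\<lambda>x. if \<kappa> < norm (f x) then norm (f x) else 0) \<in> borel_measurable lborel" by measurable
  show "AE x in lborel. norm (if \<kappa> < norm (f x) then norm (f x) else 0) \<le> norm ((norm (f x))\<^sup>2 / \<kappa>)"
    using \<kappa> by (intro AE_I2) (auto simp: field_simps power2_eq_square mult_mono)
qed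

lemma L2_low_integrable:
  fixes f :: "'a::euclidean_space \<Rightarrow> complex"
  assumes f: "f \<in> Lp 2"
  shows "integrable lborel (\<lambda>x. if norm (f x) \<le> \<kappa> then (norm (f x))\<^sup>2 else 0)"
proof (rule Bochner_Integration.integrable_bound)
  note [measurable] = Lp_measurable[OF f]
  show "integrable lborel (\<lambda>x. (norm (f x))\<^sup>2)" using f by (simp add: Lp2_iff)
  show "(\<lambda>x. if norm (f x) \<le> \<kappa> then (norm (f x))\<^sup>2 else 0) \<in> borel_measurable lborel" by measurable
qed (intro AE_I2, auto)

lemma indicator_Lp2_integrable:
  fixes F :: "'a::euclidean_space \<Rightarrow> complex"
  assumes F: "F \<in> Lp 2" and [measurable]: "E \<in> sets borel"
  shows "integrable lborel (\<lambda>\<xi>. indicator E \<xi> * (norm (F \<xi>))\<^sup>2)"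
proof (rule Bochner_Integration.integrable_bound)
  note [measurable] = Lp_measurable[OF F]
  show "integrable lborel (\<lambda>x. (norm (F x))\<^sup>2)" using F by (simp add: Lp2_iff)
  show "(\<lambda>\<xi>. indicator E \<xi> * (norm (F \<xi>))\<^sup>2) \<in> borel_measurable lborel" by measurable
qed (intro AE_I2, auto simp: indicator_def)

text \<open>Splitting \<open>f\<close> at height \<open>\<kappa>\<close> replaces the Hausdorff--Young inequality: the large part is
  handled by the trivial \<open>L\<^sup>1\<close>--\<open>L\<^sup>\<infinity>\<close> bound and the small part by Plancherel's theorem.\<close>

lemma fourier_energy_split:
  fixes f :: "'a::euclidean_space \<Rightarrow> complex"
  assumes f: "f \<in> Lp 2" and \<kappa>: "\<kappa> > 0" and E [measurable]: "E \<in> sets borel" and fin: "emeasure lborel E < \<infinity>"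
  shows "(LINT \<xi>|lborel. indicator E \<xi> * (norm (fourier f \<xi>))\<^sup>2)
    \<le> 2 * measure lborel E * (L1_high f \<kappa>)\<^sup>2 + 2 * L2_low f \<kappa>"
proof -
  note [measurable] = Lp_measurable[OF f]
  define f1 where "f1 x = (if \<kappa> < norm (f x) then f x else 0)" for x
  define f2 where "f2 x = (if norm (f x) \<le> \<kappa> then f x else 0)" for x
  have m [measurable]: "f1 \<in> borel_measurable borel" "f2 \<in> borel_measurable borel"
    unfolding f1_def[abs_def] f2_def[abs_def] by measurable
  have L: "f1 \<in> Lp 2" "f2 \<in> Lp 2"
    by (rule Lp2_mono(1)[OF f]; simp add: f1_def f2_def)+
  have n1: "norm (f1 x) = (if \<kappa> < norm (f x) then norm (f x) else 0)" for x by (simp add: f1_def)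
  have n2: "(norm (f2 x))\<^sup>2 = (if norm (f x) \<le> \<kappa> then (norm (f x))\<^sup>2 else 0)" for x by (simp add: f2_def)
  have i1: "integrable lborel f1"
    by (rule integrable_norm_cancel) (use L1_high_integrable[OF f \<kappa>] in \<open>simp_all add: n1\<close>)
  have "(\<lambda>x. 1 * f1 x + 1 * f2 x) = f" by (auto simp: f1_def f2_def)
  moreover have "has_fourier (\<lambda>x. 1 * f1 x + 1 * f2 x) (\<lambda>\<xi>. 1 * FT f1 \<xi> + 1 * fourier f2 \<xi>)"
    by (intro has_fourier_lincomb has_fourier_FT i1 L has_fourier_fourier)
  ultimately have ae: "AE \<xi> in lborel. fourier f \<xi> = FT f1 \<xi> + fourier f2 \<xi>"
    using fourier_eq_AE[of f "\<lambda>\<xi>. FT f1 \<xi> + fourier f2 \<xi>"] by simp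
  have b1: "norm (FT f1 \<xi>) \<le> L1_high f \<kappa>" for \<xi>
    using FT_bound[OF i1] by (simp add: L1_high_def n1)
  have F2: "fourier f2 \<in> Lp 2" by (rule fourier_Lp2[OF L(2)])
  have iE: "integrable lborel (indicator E :: 'a \<Rightarrow> real)"
    using fin by (intro integrable_real_indicator) auto
  have "(LINT \<xi>|lborel. indicator E \<xi> * (norm (fourier f \<xi>))\<^sup>2)
    \<le> (LINT \<xi>|lborel. 2 * (L1_high f \<kappa>)\<^sup>2 * indicator E \<xi> + 2 * (norm (fourier f2 \<xi>))\<^sup>2)"
  proof (rule integral_mono_AE)
    show "integrable lborel (\<lambda>\<xi>. indicator E \<xi> * (norm (fourier f \<xi>))\<^sup>2)"
      by (rule indicator_Lp2_integrable[OF fourier_Lp2[OF f] E])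
    show "integrable lborel (\<lambda>\<xi>. 2 * (L1_high f \<kappa>)\<^sup>2 * indicator E \<xi> + 2 * (norm (fourier f2 \<xi>))\<^sup>2)"
      using iE F2 by (auto simp: Lp2_iff)
    show "AE \<xi> in lborel. indicator E \<xi> * (norm (fourier f \<xi>))\<^sup>2
        \<le> 2 * (L1_high f \<kappa>)\<^sup>2 * indicator E \<xi> + 2 * (norm (fourier f2 \<xi>))\<^sup>2"
      using ae
    proof eventually_elim
      case (elim \<xi>)
      have "norm (fourier f \<xi>) \<le> L1_high f \<kappa> + norm (fourier f2 \<xi>)"
        unfolding elim using norm_triangle_ineq[of "FT f1 \<xi>" "fourier f2 \<xi>"] b1[of \<xi>] by linarith
      then have "(norm (fourier f \<xi>))\<^sup>2 \<le> (L1_high f \<kappa> + norm (fourier f2 \<xi>))\<^sup>2"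
        by (rule power_mono) simp
      also have "\<dots> \<le> 2 * (L1_high f \<kappa>)\<^sup>2 + 2 * (norm (fourier f2 \<xi>))\<^sup>2"
        using sum_squares_bound[of "L1_high f \<kappa>" "norm (fourier f2 \<xi>)"] by (simp add: power2_sum)
      finally show ?case by (auto simp: indicator_def)
    qed
  qed
  also have "\<dots> = 2 * (L1_high f \<kappa>)\<^sup>2 * measure lborel E + 2 * (Lp_norm 2 (fourier f2))\<^sup>2"
    using iE F2 by (subst Bochner_Integration.integral_add) (auto simp: Lp2_iff Lp_norm2_power2)
  also have "(Lp_norm 2 (fourier f2))\<^sup>2 = L2_low f \<kappa>"
    unfolding fourier_norm[OF L(2)] Lp_norm2_power2 L2_low_def n2 ..
  finally show ?thesis by (simp add: mult_ac)
qed

text \<open>Where \<open>|f|\<close> exceeds \<kappa>, it is at most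
  \<open>kappa^(1-r) |f|^r\<close>, since \<open>1 - r <= 0\<close>.\<close>

lemma L1_high_le:
  fixes f :: "'a::euclidean_space \<Rightarrow> complex"
  assumes f: "f \<in> Lp 2" "f \<in> Lp r" and \<kappa>: "\<kappa> > 0" and r: "1 \<le> r"
  shows "L1_high f \<kappa> \<le> \<kappa> powr (1 - r) * (LINT x|lborel. norm (f x) powr r)"
proof -
  have "L1_high f \<kappa> \<le> (LINT x|lborel. \<kappa> powr (1 - r) * norm (f x) powr r)"
    unfolding L1_high_def
  proof (rule integral_mono[OF L1_high_integrable[OF f(1) \<kappa>]])
    show "integrable lborel (\<lambda>x. \<kappa> powr (1 - r) * norm (f x) powr r)" using f by (simp add: Lp_def)
    fix x
    show "(if \<kappa> < norm (f x) then norm (f x) else 0) \<le> \<kappa> powr (1 - r) * norm (f x) powr r"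
    proof (cases "\<kappa> < norm (f x)")
      case True
      have "norm (f x) = norm (f x) powr (1 - r) * norm (f x) powr r"
        using True \<kappa> by (simp add: powr_add[symmetric])
      also have "\<dots> \<le> \<kappa> powr (1 - r) * norm (f x) powr r"
        using True \<kappa> r by (intro mult_right_mono powr_mono2') auto
      finally show ?thesis using True by simp
    qed (use \<kappa> in simp)
  qed
  then show ?thesis by simp
qed

text \<open>Where \<open>|f|\<close> is at most \<kappa>, its square is at most
  \<open>kappa^(2-r) |f|^r\<close>, since \<open>2 - r > 0\<close>.\<close>

lemma L2_low_le:
  fixes f :: "'a::euclidean_space \<Rightarrow> complex"
  assumes f: "f \<in> Lp 2" "f \<in> Lp r" and \<kappa>: "\<kappa> > 0" and r: "r < 2"
  shows "L2_low f \<kappa> \<le> \<kappa> powr (2 - r) * (LINT x|lborel. norm (f x) powr r)"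
proof -
  have "L2_low f \<kappa> \<le> (LINT x|lborel. \<kappa> powr (2 - r) * norm (f x) powr r)"
    unfolding L2_low_def
  proof (rule integral_mono[OF L2_low_integrable[OF f(1)]])
    show "integrable lborel (\<lambda>x. \<kappa> powr (2 - r) * norm (f x) powr r)" using f by (simp add: Lp_def)
    fix x
    show "(if norm (f x) \<le> \<kappa> then (norm (f x))\<^sup>2 else 0) \<le> \<kappa> powr (2 - r) * norm (f x) powr r"
    proof (cases "norm (f x) \<le> \<kappa> \<and> f x \<noteq> 0")
      case True
      have "(norm (f x))\<^sup>2 = norm (f x) powr (2 - r) * norm (f x) powr r"
        using True by (simp add: powr_add[symmetric] powr_numeral)
      also have "\<dots> \<le> \<kappa> powr (2 - r) * norm (f x) powr r"
        using True r by (intro mult_right_mono powr_mono2) auto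
      finally show ?thesis using True by simp
    qed (use \<kappa> in auto)
  qed
  then show ?thesis by simp
qed

lemma L1_high_nonneg: "0 \<le> L1_high f \<kappa>"
  unfolding L1_high_def by (intro integral_nonneg_AE) auto

text \<open>The splitting heights used below contain powers of the integral of \<open>|f|^r\<close>;
  this settles the case in which they would vanish.\<close>

lemma fourier_energy_zero:
  fixes f :: "'a::euclidean_space \<Rightarrow> complex"
  assumes f: "f \<in> Lp 2" "f \<in> Lp r" and A: "(LINT x|lborel. norm (f x) powr r) = 0"
  shows "AE \<xi> in lborel. fourier f \<xi> = 0"
proof -
  have "AE x in lborel. norm (f x) powr r = 0"
    using A f by (subst integral_nonneg_eq_0_iff_AE[symmetric]) (auto simp: Lp_def)
  then have "AE x in lborel. f x = 0" by (simp add: powr_eq_0_iff)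
  then have "Lp_norm 2 f = Lp_norm 2 (\<lambda>x::'a. 0)"
    using Lp_measurable[OF f(1)] by (intro Lp_norm2_cong_AE) auto
  then have "Lp_norm 2 (fourier f) = 0"
    unfolding fourier_norm[OF f(1)] by (simp add: Lp_norm2_eq[of "\<lambda>x::'a. 0"])
  then show ?thesis by (rule Lp_norm2_zero_AE[OF fourier_Lp2[OF f(1)]])
qed

lemma Lp_norm_power2_eq: "r > 0 \<Longrightarrow> (Lp_norm r f)\<^sup>2 = (LINT x|lborel. norm (f x) powr r) powr (2 / r)"
  by (simp add: Lp_norm_def powr_powr flip: powr_numeral)

lemma measure_cball_scaled: "R \<ge> 0 \<Longrightarrow> measure lborel (cball (0::'a::euclidean_space) R) = unit_ball_vol DIM('a) * R ^ DIM('a)"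
  using content_cball[of R "0::'a"] by (simp add: measure_completion)

text \<open>The height with \<open>kappa^r = R^d * (integral of |f|^r)\<close> makes both parts of
  the splitting contribute the same power of \<open>R\<close>, and reproduces the exponent that
  Hausdorff-Young followed by Hoelder on the ball would give.\<close>

lemma fourier_energy_ball:
  fixes f :: "'a::euclidean_space \<Rightarrow> complex"
  assumes f: "f \<in> Lp 2" "f \<in> Lp r" and r: "1 \<le> r" "r < 2" and R: "R > 0"
  shows "(LINT \<xi>|lborel. indicator (cball 0 R) \<xi> * (norm (fourier f \<xi>))\<^sup>2)
    \<le> (2 * unit_ball_vol DIM('a) + 2) * R powr (real DIM('a) * (2 - r) / r) * (Lp_norm r f)\<^sup>2"
proof -
  define A where "A = (LINT x|lborel. norm (f x) powr r)"
  define v where "v = unit_ball_vol (real DIM('a))"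
  have v: "v \<ge> 0" by (simp add: v_def)
  have A0: "A \<ge> 0" unfolding A_def by (intro integral_nonneg_AE) auto
  have cb [measurable]: "cball (0::'a) R \<in> sets borel" by simp
  show ?thesis
  proof (cases "A = 0")
    case True
    have "(LINT \<xi>|lborel. indicator (cball 0 R) \<xi> * (norm (fourier f \<xi>))\<^sup>2) = (LINT \<xi>|(lborel::'a measure). 0)"
      using fourier_energy_zero[OF f True[unfolded A_def]] fourier_Lp2[OF f(1), THEN Lp_measurable]
      by (intro integral_cong_AE) auto
    then show ?thesis using v by (simp add: v_def)
  next
    case False
    with A0 have A: "A > 0" by simp
    define B where "B = R ^ DIM('a) * A"
    have B: "B > 0" using A R by (simp add: B_def)
    define \<kappa> where "\<kappa> = B powr (1 / r)"
    have \<kappa>: "\<kappa> > 0" using B by (simp add: \<kappa>_def)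
    have \<kappa>r: "\<kappa> powr r = B" using B r by (simp add: \<kappa>_def powr_powr)
    have "(LINT \<xi>|lborel. indicator (cball 0 R) \<xi> * (norm (fourier f \<xi>))\<^sup>2)
       \<le> 2 * measure lborel (cball (0::'a) R) * (L1_high f \<kappa>)\<^sup>2 + 2 * L2_low f \<kappa>"
      by (rule fourier_energy_split[OF f(1) \<kappa> cb]) (simp add: emeasure_compact_finite[unfolded infinity_ennreal_def])
    also have "\<dots> \<le> 2 * (v * R ^ DIM('a)) * (\<kappa> powr (1 - r) * A)\<^sup>2 + 2 * (\<kappa> powr (2 - r) * A)"
      unfolding measure_cball_scaled[OF less_imp_le[OF R]] A_def v_def using R r
      by (intro add_mono mult_left_mono power_mono L1_high_le L2_low_le f \<kappa> L1_high_nonneg) auto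
    also have "2 * (v * R ^ DIM('a)) * (\<kappa> powr (1 - r) * A)\<^sup>2 = 2 * v * (\<kappa> powr (2 - r) * A)"
    proof -
      have "R ^ DIM('a) * (\<kappa> powr (1 - r) * A)\<^sup>2 = B * (\<kappa> powr (1 - r) * \<kappa> powr (1 - r)) * A"
        by (simp add: B_def power2_eq_square mult_ac)
      also have "B * (\<kappa> powr (1 - r) * \<kappa> powr (1 - r)) = \<kappa> powr (2 - r)"
        unfolding \<kappa>r[symmetric] powr_add[symmetric] by simp
      finally show ?thesis by (simp add: mult_ac)
    qed
    also have "2 * v * (\<kappa> powr (2 - r) * A) + 2 * (\<kappa> powr (2 - r) * A) = (2 * v + 2) * (\<kappa> powr (2 - r) * A)"
      by (simp add: algebra_simps)
    also have "\<kappa> powr (2 - r) * A = R powr (real DIM('a) * (2 - r) / r) * (Lp_norm r f)\<^sup>2"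
    proof -
      have "\<kappa> powr (2 - r) = B powr ((2 - r) / r)" by (simp add: \<kappa>_def powr_powr)
      also have "\<dots> = (R powr real DIM('a)) powr ((2 - r) / r) * A powr ((2 - r) / r)"
        unfolding B_def using R A by (simp add: powr_mult powr_realpow)
      also have "(R powr real DIM('a)) powr ((2 - r) / r) = R powr (real DIM('a) * (2 - r) / r)"
        by (simp add: powr_powr)
      finally have "\<kappa> powr (2 - r) * A = R powr (real DIM('a) * (2 - r) / r) * (A powr ((2 - r) / r) * A powr 1)"
        using A by simp
      also have "A powr ((2 - r) / r) * A powr 1 = A powr (2 / r)"
        unfolding powr_add[symmetric] using r by (simp add: field_simps)
      finally show ?thesis using r by (simp add: Lp_norm_power2_eq A_def)
    qed
    finally show ?thesis by (simp add: v_def mult_ac)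
  qed
qed

section \<open>Geometric sums and the endpoint of the low frequency estimate\<close>

lemma geometric_sum_le_threshold:
  fixes q X :: real
  assumes q: "q > 1" and X: "X \<ge> 0"
  shows "(\<Sum>k\<le>K. if q ^ k \<le> X then q ^ k else 0) \<le> q / (q - 1) * X"
proof (induction K)
  case 0
  have "1 \<le> q / (q - 1)" using q by simp
  then have "1 * X \<le> q / (q - 1) * X" using X by (rule mult_right_mono)
  moreover have "(\<Sum>k\<le>0. if q ^ k \<le> X then q ^ k else 0) = (if 1 \<le> X then 1 else 0)" by (subst atMost_0) simp
  moreover have "(if 1 \<le> X then 1 else 0) \<le> X" using X by simp
  ultimately show ?case by linarith
next
  case (Suc K)
  show ?case
  proof (cases "q ^ Suc K \<le> X")
    case True
    have "(\<Sum>k\<le>Suc K. if q ^ k \<le> X then q ^ k else 0) \<le> (\<Sum>k\<le>Suc K. q ^ k)"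
      using q by (intro sum_mono) auto
    also have "\<dots> = (q ^ Suc (Suc K) - 1) / (q - 1)"
      using q by (subst lessThan_Suc_atMost[symmetric], subst geometric_sum) auto
    also have "\<dots> \<le> q * q ^ Suc K / (q - 1)"
      using q by (intro divide_right_mono) auto
    also have "\<dots> \<le> q * X / (q - 1)"
      using q True by (intro divide_right_mono mult_left_mono) auto
    finally show ?thesis by simp
  qed (use Suc in simp)
qed

text \<open>Powers of \<open>p < 1\<close> below a threshold form a tail of the geometric series,
  whose sum is comparable with its first term.\<close>

lemma geometric_sum_below_threshold:
  fixes p Y :: real
  assumes p: "0 < p" "p < 1"
  shows "(\<Sum>k\<le>K. if p ^ k < Y then p ^ k else 0) \<le> max 0 (Y / (1 - p))"
proof -
  \<comment> \<open>The claim is sharpened for the induction: the tail \<open>p^(K+1)/(1-p)\<close>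
    that is still missing is subtracted. As long as \<open>p^K\<close> is not below
    \<open>Y\<close>, no power has been counted.\<close>
  have "(\<Sum>k\<le>K. if p ^ k < Y then p ^ k else 0) \<le> (if p ^ K < Y then (Y - p ^ Suc K) / (1 - p) else 0)"
  proof (induction K)
    case 0
    then show ?case using p by (auto simp: field_simps)
  next
    case (Suc K)
    show ?case
    proof (cases "p ^ Suc K < Y")
      case True
      have e: "p ^ Suc K = (p ^ Suc K - p ^ Suc (Suc K)) / (1 - p)" using p by (simp add: field_simps)
      have "(\<Sum>k\<le>Suc K. if p ^ k < Y then p ^ k else 0)
          \<le> (if p ^ K < Y then (Y - p ^ Suc K) / (1 - p) else 0) + p ^ Suc K"
        using Suc True by simp
      also have "\<dots> \<le> (Y - p ^ Suc K) / (1 - p) + p ^ Suc K"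
        using True p by auto
      also have "\<dots> = (Y - p ^ Suc (Suc K)) / (1 - p)"
        by (subst (2) e) (simp add: add_divide_distrib[symmetric])
      finally show ?thesis using True by simp
    next
      case False
      have "p ^ Suc K \<le> p ^ K" using p by (simp add: mult_left_le_one_le)
      then have "\<not> p ^ K < Y" using False by linarith
      then show ?thesis using Suc False by simp
    qed
  qed
  also have "\<dots> \<le> max 0 (Y / (1 - p))"
  proof -
    have "(Y - p ^ Suc K) / (1 - p) \<le> Y / (1 - p)"
      using p by (intro divide_right_mono) auto
    then show ?thesis by (simp add: max_def)
  qed
  finally show ?thesis .
qed

text \<open>Lets a sum of squares over shells be replaced by the square of a single integral, in
  which the sum can be taken pointwise.\<close>

lemma sum_squares_le_square_sum:
  fixes a :: "nat \<Rightarrow> real"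
  assumes "\<And>k. a k \<ge> 0"
  shows "(\<Sum>k\<le>K. (a k)\<^sup>2) \<le> (\<Sum>k\<le>K. a k)\<^sup>2"
proof (induction K)
  case (Suc K)
  have "0 \<le> 2 * (\<Sum>k\<le>K. a k) * a (Suc K)" using assms by (intro mult_nonneg_nonneg sum_nonneg) auto
  then show ?case using Suc unfolding sum.atMost_Suc power2_sum by linarith
qed simp

text \<open>The endpoint case of the low frequency estimate. Choosing the splitting height depending on
  the dyadic shell and summing geometric series pointwise in \<open>x\<close> avoids the logarithm that summing
  the bounds of \<open>fourier_energy_ball\<close> would give.\<close>

lemma fourier_energy_shells_endpoint:
  fixes f :: "'a::euclidean_space \<Rightarrow> complex"
  assumes f: "f \<in> Lp 2" "f \<in> Lp r" and r: "1 < r" "r < 2"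
    and E: "\<And>k. E k \<in> sets borel" "\<And>k. E k \<subseteq> cball (0::'a) ((1/2) ^ k)"
  defines "q \<equiv> 2 powr (real DIM('a) * (2 - r) / r)" and "p \<equiv> 2 powr (real DIM('a) * (1 - r) / r)"
  shows "(\<Sum>k\<le>K. q ^ k * (LINT \<xi>|lborel. indicator (E k) \<xi> * (norm (fourier f \<xi>))\<^sup>2))
    \<le> (2 * unit_ball_vol DIM('a) * (1 / (1 - p))\<^sup>2 + 2 * (q / (q - 1))) * (Lp_norm r f)\<^sup>2"
proof -
  define A where "A = (LINT x|lborel. norm (f x) powr r)"
  define v where "v = unit_ball_vol (real DIM('a))"
  have v: "v \<ge> 0" by (simp add: v_def)
  have A0: "A \<ge> 0" unfolding A_def by (intro integral_nonneg_AE) auto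
  have d: "real DIM('a) > 0" by simp
  have q: "q > 1" unfolding q_def using r d by (intro gr_one_powr) auto
  \<comment> \<open>This is where \<open>r > 1\<close> matters: for \<open>r = 1\<close> the ratio
    \<open>p\<close> would be 1, and the geometric series would diverge.\<close>
  have "real DIM('a) * (1 - r) / r < 0" using r d by (intro divide_neg_pos mult_pos_neg) auto
  then have p: "0 < p" "p < 1"
    unfolding p_def using powr_less_mono[of "real DIM('a) * (1 - r) / r" 0 2] by auto
  note [measurable] = Lp_measurable[OF f(1)]
  have fr: "integrable lborel (\<lambda>x. norm (f x) powr r)" using f(2) by (simp add: Lp_def)
  have I0: "(LINT \<xi>|lborel. indicator (E k) \<xi> * (norm (fourier f \<xi>))\<^sup>2) \<ge> 0" for k
    by (intro integral_nonneg_AE) auto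
  show ?thesis
  proof (cases "A = 0")
    case True
    have "(LINT \<xi>|lborel. indicator (E k) \<xi> * (norm (fourier f \<xi>))\<^sup>2) = (LINT \<xi>|(lborel::'a measure). 0)" for k
    proof -
      note [measurable] = E(1)[of k] fourier_Lp2[OF f(1), THEN Lp_measurable]
      show ?thesis using fourier_energy_zero[OF f True[unfolded A_def]] by (intro integral_cong_AE) auto
    qed
    then show ?thesis using v q by (simp add: v_def)
  next
    case False
    with A0 have A: "A > 0" by simp
    define a where "a = A powr (1 / r)"
    have a: "a > 0" using A by (simp add: a_def)
    have ar: "a powr r = A" using A r by (simp add: a_def powr_powr)
    \<comment> \<open>Both ratios are powers of \<open>g = 2^(d/r)\<close>, namely
      \<open>q = g^(2-r)\<close> and \<open>p = g^(1-r)\<close>; a threshold for \<open>g^k\<close>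
      translates into one for either.\<close>
    define g where "g = 2 powr (real DIM('a) / r)"
    have g: "g > 0" by (simp add: g_def)
    have qg: "q ^ k = (g ^ k) powr (2 - r)" and pg: "p ^ k = (g ^ k) powr (1 - r)" for k
      by (simp_all add: q_def p_def g_def powr_realpow[symmetric] powr_powr mult_ac)
    have qp: "q ^ k * ((1/2) ^ k) ^ DIM('a) = (p ^ k)\<^sup>2" for k
    proof -
      have "((1/2) ^ k) ^ DIM('a) = (g ^ k) powr (- r)"
        using r by (simp add: g_def powr_realpow[symmetric] powr_powr powr_minus_divide power_one_over power_mult[symmetric] mult.commute flip: powr_realpow)
      then show ?thesis
        unfolding qg pg power2_eq_square powr_add[symmetric] by (simp only: powr_add[symmetric]) (simp add: algebra_simps)
    qed
    \<comment> \<open>The balancing height of \<open>fourier_energy_ball\<close> for the radius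
      \<open>2^(-k)\<close>: \<open>(h k)^r = 2^(-d k) A\<close>.\<close>
    define h where "h k = a / g ^ k" for k
    have h: "h k > 0" for k using a g by (simp add: h_def)
    have split: "(LINT \<xi>|lborel. indicator (E k) \<xi> * (norm (fourier f \<xi>))\<^sup>2)
       \<le> 2 * (v * ((1/2) ^ k) ^ DIM('a)) * (L1_high f (h k))\<^sup>2 + 2 * L2_low f (h k)" for k
    proof -
      note [measurable] = E(1)[of k]
      have fin: "emeasure lborel (cball (0::'a) ((1/2) ^ k)) < \<infinity>"
        by (simp add: emeasure_compact_finite[unfolded infinity_ennreal_def])
      have "emeasure lborel (E k) < \<infinity>"
        using emeasure_mono[OF E(2)[of k], of lborel] fin by (simp add: order_le_less_trans)
      from fourier_energy_split[OF f(1) h E(1) this, of k]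
      have "(LINT \<xi>|lborel. indicator (E k) \<xi> * (norm (fourier f \<xi>))\<^sup>2)
         \<le> 2 * measure lborel (E k) * (L1_high f (h k))\<^sup>2 + 2 * L2_low f (h k)" .
      also have "measure lborel (E k) \<le> v * ((1/2) ^ k) ^ DIM('a)"
      proof -
        have "measure lborel (E k) \<le> measure lborel (cball (0::'a) ((1/2) ^ k))"
          by (rule measure_mono_fmeasurable[OF E(2)]) (use E(1) fin in \<open>auto simp: fmeasurable_def\<close>)
        then show ?thesis by (simp add: measure_cball_scaled v_def)
      qed
      finally show ?thesis by (simp add: mult_right_mono)
    qed
    have "(\<Sum>k\<le>K. q ^ k * (LINT \<xi>|lborel. indicator (E k) \<xi> * (norm (fourier f \<xi>))\<^sup>2))
      \<le> (\<Sum>k\<le>K. q ^ k * (2 * (v * ((1/2) ^ k) ^ DIM('a)) * (L1_high f (h k))\<^sup>2 + 2 * L2_low f (h k)))"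
      using q by (intro sum_mono mult_left_mono split) auto
    also have "\<dots> = (\<Sum>k\<le>K. 2 * v * (p ^ k * L1_high f (h k))\<^sup>2 + 2 * (q ^ k * L2_low f (h k)))"
      by (intro sum.cong refl) (simp add: power_mult_distrib qp[symmetric] algebra_simps)
    also have "\<dots> = 2 * v * (\<Sum>k\<le>K. (p ^ k * L1_high f (h k))\<^sup>2) + 2 * (\<Sum>k\<le>K. q ^ k * L2_low f (h k))"
      by (simp add: sum.distrib sum_distrib_left)
    also have "(\<Sum>k\<le>K. (p ^ k * L1_high f (h k))\<^sup>2) \<le> (\<Sum>k\<le>K. p ^ k * L1_high f (h k))\<^sup>2"
      using p by (intro sum_squares_le_square_sum) (simp add: L1_high_nonneg)
    also have "(\<Sum>k\<le>K. p ^ k * L1_high f (h k))\<^sup>2 \<le> (1 / (1 - p) * a)\<^sup>2"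
    proof (rule power_mono)
      have "(\<Sum>k\<le>K. p ^ k * L1_high f (h k)) = (LINT x|lborel. (\<Sum>k\<le>K. p ^ k * (if h k < norm (f x) then norm (f x) else 0)))"
        unfolding L1_high_def using L1_high_integrable[OF f(1) h] by (subst Bochner_Integration.integral_sum) auto
      also have "\<dots> \<le> (LINT x|lborel. 1 / (1 - p) * a powr (1 - r) * norm (f x) powr r)"
      proof (rule integral_mono)
        show "integrable lborel (\<lambda>x. \<Sum>k\<le>K. p ^ k * (if h k < norm (f x) then norm (f x) else 0))"
          using L1_high_integrable[OF f(1) h] by (intro Bochner_Integration.integrable_sum integrable_mult_right)
        show "integrable lborel (\<lambda>x. 1 / (1 - p) * a powr (1 - r) * norm (f x) powr r)"
          using fr by simp
        fix x
        show "(\<Sum>k\<le>K. p ^ k * (if h k < norm (f x) then norm (f x) else 0)) \<le> 1 / (1 - p) * a powr (1 - r) * norm (f x) powr r"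
        proof (cases "f x = 0")
          case True
          have "(\<Sum>k\<le>K. p ^ k * (if h k < norm (f x) then norm (f x) else 0)) = 0"
            by (intro sum.neutral) (simp add: True)
          then show ?thesis using True by simp
        next
          case False
          define y where "y = norm (f x)"
          have y: "y > 0" using False by (simp add: y_def)
          \<comment> \<open>For fixed \<open>x\<close> only shells with \<open>g^k > a/y\<close>
            contribute, that is, with \<open>p^k\<close> below a threshold, as
            \<open>1 - r < 0\<close>.\<close>
          have "(\<Sum>k\<le>K. p ^ k * (if h k < y then y else 0)) \<le> (\<Sum>k\<le>K. if p ^ k < (a / y) powr (1 - r) then p ^ k else 0) * y"
            unfolding sum_distrib_right
          proof (rule sum_mono)
            fix k
            have "p ^ k < (a / y) powr (1 - r)" if "h k < y"
            proof -
              have "a / y < g ^ k" using that y g by (simp add: h_def field_simps)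
              then show ?thesis unfolding pg using r a y by (intro powr_less_mono2_neg) auto
            qed
            then show "p ^ k * (if h k < y then y else 0) \<le> (if p ^ k < (a / y) powr (1 - r) then p ^ k else 0) * y"
              using p y by auto
          qed
          also have "\<dots> \<le> (max 0 ((a / y) powr (1 - r) / (1 - p))) * y"
            using y by (intro mult_right_mono geometric_sum_below_threshold p) auto
          also have "\<dots> = 1 / (1 - p) * a powr (1 - r) * (y powr (r - 1) * y)"
            using p a y by (simp add: powr_divide powr_minus_divide[of y "r - 1", simplified] powr_diff)
          also have "y powr (r - 1) * y = y powr r" using y by (simp add: powr_diff)
          finally show ?thesis unfolding y_def .
        qed
      qed
      also have "\<dots> = 1 / (1 - p) * (a powr (1 - r) * a powr r)" by (simp add: A_def[symmetric] ar)
      also have "a powr (1 - r) * a powr r = a" unfolding powr_add[symmetric] using a by simp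
      finally show "(\<Sum>k\<le>K. p ^ k * L1_high f (h k)) \<le> 1 / (1 - p) * a" .
      show "0 \<le> (\<Sum>k\<le>K. p ^ k * L1_high f (h k))"
        using p by (intro sum_nonneg mult_nonneg_nonneg L1_high_nonneg) auto
    qed
    also have "(\<Sum>k\<le>K. q ^ k * L2_low f (h k)) \<le> q / (q - 1) * a\<^sup>2"
    proof -
      have "(\<Sum>k\<le>K. q ^ k * L2_low f (h k)) = (LINT x|lborel. (\<Sum>k\<le>K. q ^ k * (if norm (f x) \<le> h k then (norm (f x))\<^sup>2 else 0)))"
        unfolding L2_low_def using L2_low_integrable[OF f(1)] by (subst Bochner_Integration.integral_sum) auto
      also have "\<dots> \<le> (LINT x|lborel. q / (q - 1) * a powr (2 - r) * norm (f x) powr r)"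
      proof (rule integral_mono)
        show "integrable lborel (\<lambda>x. \<Sum>k\<le>K. q ^ k * (if norm (f x) \<le> h k then (norm (f x))\<^sup>2 else 0))"
          using L2_low_integrable[OF f(1)] by (intro Bochner_Integration.integrable_sum integrable_mult_right)
        show "integrable lborel (\<lambda>x. q / (q - 1) * a powr (2 - r) * norm (f x) powr r)"
          using fr by simp
        fix x
        show "(\<Sum>k\<le>K. q ^ k * (if norm (f x) \<le> h k then (norm (f x))\<^sup>2 else 0)) \<le> q / (q - 1) * a powr (2 - r) * norm (f x) powr r"
        proof (cases "f x = 0")
          case False
          define y where "y = norm (f x)"
          have y: "y > 0" using False by (simp add: y_def)
          \<comment> \<open>Here the contributing shells have \<open>g^k <= a/y\<close>, so an
            increasing geometric sum is cut off and comparable with its largest term.\<close>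
          have "(\<Sum>k\<le>K. q ^ k * (if y \<le> h k then y\<^sup>2 else 0)) \<le> (\<Sum>k\<le>K. if q ^ k \<le> (a / y) powr (2 - r) then q ^ k else 0) * y\<^sup>2"
            unfolding sum_distrib_right
          proof (rule sum_mono)
            fix k
            have "q ^ k \<le> (a / y) powr (2 - r)" if "y \<le> h k"
            proof -
              have "g ^ k \<le> a / y" using that y g by (simp add: h_def field_simps)
              then show ?thesis unfolding qg using r g by (intro powr_mono2) auto
            qed
            then show "q ^ k * (if y \<le> h k then y\<^sup>2 else 0) \<le> (if q ^ k \<le> (a / y) powr (2 - r) then q ^ k else 0) * y\<^sup>2"
              using q by auto
          qed
          also have "\<dots> \<le> (q / (q - 1) * (a / y) powr (2 - r)) * y\<^sup>2"
            by (intro mult_right_mono geometric_sum_le_threshold q) auto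
          also have "\<dots> = q / (q - 1) * a powr (2 - r) * (y\<^sup>2 / y powr (2 - r))"
            using a y by (simp add: powr_divide)
          also have "y\<^sup>2 / y powr (2 - r) = y powr r"
            using y by (simp add: powr_diff powr_numeral)
          finally show ?thesis unfolding y_def .
        next
          case True
          have "(\<Sum>k\<le>K. q ^ k * (if norm (f x) \<le> h k then (norm (f x))\<^sup>2 else 0)) = 0"
            by (intro sum.neutral) (simp add: True)
          then show ?thesis using True by simp
        qed
      qed
      also have "\<dots> = q / (q - 1) * (a powr (2 - r) * a powr r)" by (simp add: A_def[symmetric] ar)
      also have "a powr (2 - r) * a powr r = a\<^sup>2" unfolding powr_add[symmetric] using a by (simp add: powr_numeral)
      finally show ?thesis .
    qed
    also have "2 * v * (1 / (1 - p) * a)\<^sup>2 + 2 * (q / (q - 1) * a\<^sup>2) = (2 * v * (1 / (1 - p))\<^sup>2 + 2 * (q / (q - 1))) * a\<^sup>2"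
      unfolding power_mult_distrib by (simp only: distrib_left mult_ac)
    also have "a\<^sup>2 = (Lp_norm r f)\<^sup>2" by (simp add: a_def A_def Lp_norm_def)
    finally show ?thesis using v by (simp add: v_def mult_left_mono)
  qed
qed

section \<open>Dyadic shells and the weighted norm of the data\<close>

definition mode_weight :: "real \<Rightarrow> real \<Rightarrow> real \<Rightarrow> real" where
  "mode_weight b \<rho> \<tau> = min \<tau> (max 1 (1 / \<rho>)) powr b"

text \<open>The growth in L^2 of the weighted data, without the logarithm due to
  \<open>delta\<close>. The square root of the logarithm stems from adding the energies of about
  \<open>log tau\<close> shells with equal bounds.\<close>

definition growth_rate :: "nat \<Rightarrow> real \<Rightarrow> real \<Rightarrow> real \<Rightarrow> real" where
  "growth_rate d r \<mu> \<tau> =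
     (if alpha d r \<mu> < 0 \<or> alpha d r \<mu> = 0 \<and> r > 1 then 1
      else if alpha d r \<mu> = 0 then (1 + ln \<tau>) powr (1/2)
      else \<tau> powr (alpha d r \<mu>))"

lemma growth_rate_ge_1: "\<tau> \<ge> 1 \<Longrightarrow> 1 \<le> growth_rate d r \<mu> \<tau>"
  by (auto simp: growth_rate_def intro!: ge_one_powr_ge_zero)

lemma dyadic_scale_exists:
  fixes \<tau> :: real
  assumes "\<tau> \<ge> 1"
  obtains K :: nat where "2 ^ K \<le> \<tau>" "\<tau> < 2 ^ Suc K"
proof -
  obtain n where n: "\<tau> < 2 ^ n" using real_arch_pow[of 2 \<tau>] by auto
  define m where "m = (LEAST n. \<tau> < 2 ^ n)"
  have m: "\<tau> < 2 ^ m" unfolding m_def by (rule LeastI[of _ n]) (rule n)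
  then have "m \<noteq> 0" using assms by (intro notI) simp
  then obtain K where K: "m = Suc K" by (cases m) auto
  have "\<not> \<tau> < 2 ^ K" using not_less_Least[of K "\<lambda>n. \<tau> < 2 ^ n"] K unfolding m_def by simp
  then show ?thesis using that[of K] m K by simp
qed

definition shell :: "nat \<Rightarrow> 'a::euclidean_space set" where
  "shell k = {\<xi>. (1/2) ^ Suc k < norm \<xi> \<and> norm \<xi> \<le> (1/2) ^ k}"

lemma shell_borel [measurable]: "shell k \<in> sets borel"
  unfolding shell_def by measurable

lemma shell_subset: "shell k \<subseteq> cball 0 ((1/2) ^ k)"
  by (auto simp: shell_def)

text \<open>For \<open>|xi| > 1\<close> the weight is 1, on \<open>shell k\<close> it is at most
  \<open>2^((k+1) b)\<close>, and closer to the origin the bound \<open>tau < 2^(K+1)\<close> takes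
  over. Squared, these are 1, \<open>Q * Q^k\<close> and \<open>Q^(K+1)\<close>. At the origin the
  default value of \<open>1 / 0\<close> makes the weight 1, so the last case covers it too.\<close>

lemma mode_weight_dyadic:
  fixes \<xi> :: "'a::euclidean_space"
  assumes \<tau>: "2 ^ K \<le> \<tau>" "\<tau> < 2 ^ Suc K" and b: "b \<ge> 0"
  defines "Q \<equiv> 2 powr (2 * b)"
  shows "(mode_weight b (norm \<xi>) \<tau>)\<^sup>2 \<le> 1 + (\<Sum>k\<le>K. Q * Q ^ k * indicator (shell k) \<xi>)
     + Q ^ Suc K * indicator (cball 0 ((1/2) ^ Suc K)) \<xi>"
proof -
  define \<rho> where "\<rho> = norm \<xi>"
  have Q: "Q > 0" by (simp add: Q_def)
  have \<tau>1: "\<tau> \<ge> 1" using \<tau>(1) one_le_power[of "2::real" K] by linarith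
  define m where "m = min \<tau> (max 1 (1 / \<rho>))"
  have m1: "m \<ge> 1" using \<tau>1 by (simp add: m_def)
  have w: "(mode_weight b (norm \<xi>) \<tau>)\<^sup>2 = m powr (2 * b)"
    unfolding mode_weight_def \<rho>_def[symmetric] m_def[symmetric] power2_eq_square powr_add[symmetric] by simp
  have QQ: "m powr (2 * b) \<le> Q ^ Suc k" if "m \<le> 2 ^ Suc k" for k
  proof -
    have "m powr (2 * b) \<le> (2 ^ Suc k) powr (2 * b)"
      using that m1 b by (intro powr_mono2) auto
    also have "\<dots> = Q ^ Suc k"
      unfolding Q_def by (simp only: powr_realpow[symmetric] powr_powr zero_less_numeral powr_gt_zero) (simp add: mult_ac)
    finally show ?thesis .
  qed
  have s0: "0 \<le> (\<Sum>k\<le>K. Q * Q ^ k * indicator (shell k) \<xi>)"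
    using Q by (intro sum_nonneg) auto
  have i0: "0 \<le> Q ^ Suc K * indicator (cball 0 ((1/2) ^ Suc K)) \<xi>" using Q by simp
  consider "\<rho> > 1" | "\<rho> \<le> (1/2) ^ Suc K" | "\<rho> \<le> 1" "\<rho> > (1/2) ^ Suc K" by linarith
  then show ?thesis unfolding w
  proof cases
    case 1
    then have "m = 1" using \<tau>1 by (simp add: m_def)
    then show "m powr (2 * b) \<le> 1 + (\<Sum>k\<le>K. Q * Q ^ k * indicator (shell k) \<xi>)
     + Q ^ Suc K * indicator (cball 0 ((1/2) ^ Suc K)) \<xi>" using s0 i0 by simp
  next
    case 2
    have "m \<le> 2 ^ Suc K" using \<tau>(2) by (simp add: m_def)
    from QQ[OF this] have "m powr (2 * b) \<le> Q ^ Suc K * indicator (cball 0 ((1/2) ^ Suc K)) \<xi>"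
      using 2 by (simp add: \<rho>_def)
    then show "m powr (2 * b) \<le> 1 + (\<Sum>k\<le>K. Q * Q ^ k * indicator (shell k) \<xi>)
     + Q ^ Suc K * indicator (cball 0 ((1/2) ^ Suc K)) \<xi>" using s0 by simp
  next
    case 3
    define k where "k = (LEAST k. (1/2) ^ Suc k < \<rho>)"
    have k: "(1/2) ^ Suc k < \<rho>" "k \<le> K"
      unfolding k_def by (rule LeastI[of _ K], rule 3(2)) (rule Least_le, rule 3(2))
    have "\<rho> \<le> (1/2) ^ k"
    proof (cases k)
      case (Suc j)
      have "\<not> (1/2) ^ Suc j < \<rho>" using not_less_Least[of j "\<lambda>k. (1/2) ^ Suc k < \<rho>"] Suc unfolding k_def by simp
      then show ?thesis unfolding Suc by simp
    qed (use 3 in simp)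
    then have sh: "\<xi> \<in> shell k" using k by (simp add: shell_def \<rho>_def)
    have \<rho>0: "\<rho> > 0" using k(1) by (rule less_trans[rotated]) simp
    have "1 / \<rho> \<le> 1 / (1/2) ^ Suc k" using k(1) by (intro divide_left_mono) (auto intro!: mult_pos_pos \<rho>0)
    also have "\<dots> = 2 ^ Suc k" by (simp add: power_one_over)
    finally have "m \<le> 2 ^ Suc k"
      using one_le_power[of "2::real" "Suc k"] unfolding m_def by (intro min.coboundedI2) simp
    from QQ[OF this] have "m powr (2 * b) \<le> Q * Q ^ k * indicator (shell k) \<xi>" using sh by simp
    also have "\<dots> \<le> (\<Sum>k\<le>K. Q * Q ^ k * indicator (shell k) \<xi>)"
      using Q k(2) by (intro member_le_sum[of k "{..K}" "\<lambda>k. Q * Q ^ k * indicator (shell k) \<xi>"]) auto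
    finally show "m powr (2 * b) \<le> 1 + (\<Sum>k\<le>K. Q * Q ^ k * indicator (shell k) \<xi>)
     + Q ^ Suc K * indicator (cball 0 ((1/2) ^ Suc K)) \<xi>" using i0 by simp
  qed
qed

text \<open>Counts the shells down to frequency \<open>1/tau\<close>; the factor 2 compensates for
  \<open>ln 2 < 1\<close>.\<close>

lemma ln_dyadic_bound:
  assumes "2 ^ K \<le> (\<tau>::real)"
  shows "real (Suc K) \<le> 2 * (1 + ln \<tau>)"
proof -
  have "ln (2 ^ K) \<le> ln \<tau>" using assms by (subst ln_le_cancel_iff) (auto intro: less_le_trans[of 0 "2 ^ K"])
  then have "real K * ln 2 \<le> ln \<tau>" by (simp add: ln_realpow)
  moreover have "real K * (1/2) \<le> real K * ln 2"
    using ln2_ge_two_thirds by (intro mult_left_mono) auto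
  ultimately show ?thesis by simp
qed

text \<open>On the ball of radius \<open>2^(-k)\<close> the weight \<open>Q^k\<close> times the
  energy is of order \<open>z^k\<close> with \<open>z = 2^(2 alpha)\<close>. Summation over
  \<open>k\<close> gives a constant, the number of shells or a multiple of the last term, according
  to the sign of alpha. For alpha = 0 and \<open>r > 1\<close> counting shells would lose a
  logarithm, and the endpoint estimate replaces it.\<close>

lemma dyadic_energy_sum:
  fixes \<mu> r :: real
  assumes r: "1 \<le> r" "r < 2"
  defines "b \<equiv> 1/2 + Re (nu \<mu>)"
  defines "Q \<equiv> 2 powr (2 * b)"
  shows "\<exists>C\<ge>0. \<forall>f \<in> Lp 2 \<inter> Lp r. \<forall>K \<tau>. 2 ^ K \<le> \<tau> \<longrightarrow>
    (\<Sum>k\<le>K. Q * Q ^ k * (LINT \<xi>|lborel. indicator (shell k :: 'a::euclidean_space set) \<xi> * (norm (fourier f \<xi>))\<^sup>2))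
     + Q ^ Suc K * (LINT \<xi>|lborel. indicator (cball 0 ((1/2) ^ Suc K)) \<xi> * (norm (fourier f \<xi>))\<^sup>2)
     \<le> C * (growth_rate DIM('a) r \<mu> \<tau>)\<^sup>2 * (Lp_norm r f)\<^sup>2"
proof -
  define \<sigma> where "\<sigma> = real DIM('a) * (2 - r) / r"
  define \<alpha> where "\<alpha> = alpha DIM('a) r \<mu>"
  have \<alpha>: "2 * \<alpha> = 2 * b - \<sigma>" using r by (simp add: \<alpha>_def alpha_def b_def \<sigma>_def field_simps)
  define z where "z = 2 powr (2 * \<alpha>)"
  have z: "z > 0" by (simp add: z_def)
  have Q: "Q > 0" by (simp add: Q_def)
  define c0 where "c0 = 2 * unit_ball_vol (real DIM('a)) + 2"
  have c0: "c0 \<ge> 0" by (simp add: c0_def)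
  have Qz: "Q ^ k * ((1/2) ^ k) powr \<sigma> = z ^ k" for k
  proof -
    have "((1/2) ^ k) powr \<sigma> = 2 powr (- \<sigma> * real k)"
      by (simp add: power_one_over powr_realpow[symmetric] powr_divide powr_powr powr_minus_divide mult.commute)
    moreover have "Q ^ k = 2 powr (2 * b * real k)" "z ^ k = 2 powr (2 * \<alpha> * real k)"
      unfolding Q_def z_def by (simp_all add: powr_realpow[symmetric] powr_powr)
    ultimately show ?thesis unfolding \<alpha> by (simp add: powr_add[symmetric] algebra_simps)
  qed
  define I where "I f E = (LINT \<xi>|lborel. indicator E \<xi> * (norm (fourier f \<xi>))\<^sup>2)" for f :: "'a \<Rightarrow> complex" and E
  have ball: "Q ^ k * I f (cball 0 ((1/2) ^ k)) \<le> c0 * z ^ k * (Lp_norm r f)\<^sup>2" if f: "f \<in> Lp 2" "f \<in> Lp r" for f :: "'a \<Rightarrow> complex" and k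
  proof -
    have "I f (cball 0 ((1/2) ^ k)) \<le> c0 * ((1/2) ^ k) powr \<sigma> * (Lp_norm r f)\<^sup>2"
      unfolding I_def c0_def \<sigma>_def by (rule fourier_energy_ball[OF f r]) simp
    then have "Q ^ k * I f (cball 0 ((1/2) ^ k)) \<le> Q ^ k * (c0 * ((1/2) ^ k) powr \<sigma> * (Lp_norm r f)\<^sup>2)"
      using Q by (intro mult_left_mono) auto
    also have "\<dots> = c0 * (Q ^ k * ((1/2) ^ k) powr \<sigma>) * (Lp_norm r f)\<^sup>2" by simp
    finally show ?thesis unfolding Qz .
  qed
  have mono: "I f E \<le> I f E'" if "f \<in> Lp 2" "E \<in> sets borel" "E' \<in> sets borel" "E \<subseteq> E'" for f E E'
    unfolding I_def using that fourier_Lp2[OF that(1)]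
    by (intro integral_mono indicator_Lp2_integrable) (auto simp: indicator_def)
  have shells: "(\<Sum>k\<le>K. Q * Q ^ k * I f (shell k)) \<le> Q * (c0 * (\<Sum>k\<le>K. z ^ k) * (Lp_norm r f)\<^sup>2)"
    if f: "f \<in> Lp 2" "f \<in> Lp r" for f :: "'a \<Rightarrow> complex" and K
  proof -
    have "(\<Sum>k\<le>K. Q * Q ^ k * I f (shell k)) \<le> (\<Sum>k\<le>K. Q * (c0 * z ^ k * (Lp_norm r f)\<^sup>2))"
    proof (rule sum_mono)
      fix k
      have "Q ^ k * I f (shell k) \<le> Q ^ k * I f (cball 0 ((1/2) ^ k))"
        using Q f by (intro mult_left_mono mono shell_subset) auto
      also have "\<dots> \<le> c0 * z ^ k * (Lp_norm r f)\<^sup>2" by (rule ball[OF f])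
      finally have "Q * (Q ^ k * I f (shell k)) \<le> Q * (c0 * z ^ k * (Lp_norm r f)\<^sup>2)"
        using Q by (intro mult_left_mono) auto
      then show "Q * Q ^ k * I f (shell k) \<le> Q * (c0 * z ^ k * (Lp_norm r f)\<^sup>2)" by (simp add: mult.assoc)
    qed
    also have "\<dots> = Q * (c0 * (\<Sum>k\<le>K. z ^ k) * (Lp_norm r f)\<^sup>2)"
      by (simp add: sum_distrib_left sum_distrib_right)
    finally show ?thesis .
  qed
  \<comment> \<open>Covers the three cases in which summing the bounds for balls is good enough;
    what is left is an estimate for the geometric series in \<open>z\<close>.\<close>
  have gen: "\<exists>C\<ge>0. \<forall>f \<in> Lp 2 \<inter> Lp r. \<forall>K \<tau>. 2 ^ K \<le> \<tau> \<longrightarrow>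
    (\<Sum>k\<le>K. Q * Q ^ k * I f (shell k :: 'a set)) + Q ^ Suc K * I f (cball 0 ((1/2) ^ Suc K))
     \<le> C * (growth_rate DIM('a) r \<mu> \<tau>)\<^sup>2 * (Lp_norm r f)\<^sup>2"
    if B: "B \<ge> 0" and le: "\<And>K \<tau>. 2 ^ K \<le> \<tau> \<Longrightarrow> (\<Sum>k\<le>K. z ^ k) \<le> B * (growth_rate DIM('a) r \<mu> \<tau>)\<^sup>2"
      "\<And>K \<tau>. 2 ^ K \<le> \<tau> \<Longrightarrow> z ^ Suc K \<le> B * (growth_rate DIM('a) r \<mu> \<tau>)\<^sup>2" for B
  proof (intro exI[of _ "Q * c0 * B + c0 * B"] conjI ballI allI impI)
    show "0 \<le> Q * c0 * B + c0 * B" using Q c0 B by simp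
    fix f :: "'a \<Rightarrow> complex" and K :: nat and \<tau> :: real
    assume f: "f \<in> Lp 2 \<inter> Lp r" and \<tau>: "2 ^ K \<le> \<tau>"
    define G where "G = (growth_rate DIM('a) r \<mu> \<tau>)\<^sup>2"
    have "(\<Sum>k\<le>K. Q * Q ^ k * I f (shell k)) \<le> Q * (c0 * (\<Sum>k\<le>K. z ^ k) * (Lp_norm r f)\<^sup>2)"
      using shells f by blast
    also have "\<dots> \<le> Q * (c0 * (B * G) * (Lp_norm r f)\<^sup>2)"
      unfolding G_def using Q c0 by (intro mult_left_mono mult_right_mono le \<tau>) auto
    finally have 1: "(\<Sum>k\<le>K. Q * Q ^ k * I f (shell k)) \<le> Q * (c0 * (B * G) * (Lp_norm r f)\<^sup>2)" .
    have "Q ^ Suc K * I f (cball 0 ((1/2) ^ Suc K)) \<le> c0 * z ^ Suc K * (Lp_norm r f)\<^sup>2"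
      using ball f by blast
    also have "\<dots> \<le> c0 * (B * G) * (Lp_norm r f)\<^sup>2"
      unfolding G_def using c0 by (intro mult_left_mono mult_right_mono le \<tau>) auto
    finally show "(\<Sum>k\<le>K. Q * Q ^ k * I f (shell k)) + Q ^ Suc K * I f (cball 0 ((1/2) ^ Suc K))
     \<le> (Q * c0 * B + c0 * B) * (growth_rate DIM('a) r \<mu> \<tau>)\<^sup>2 * (Lp_norm r f)\<^sup>2"
      using 1 unfolding G_def by (simp add: algebra_simps)
  qed
  have tau1: "\<tau> \<ge> 1" if "2 ^ K \<le> \<tau>" for K and \<tau> :: real
    using that one_le_power[of "2::real" K] by linarith
  have G1: "1 \<le> (growth_rate DIM('a) r \<mu> \<tau>)\<^sup>2" if "2 ^ K \<le> \<tau>" for K \<tau>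
    using growth_rate_ge_1[OF tau1[OF that]] by (simp add: one_le_power)
  consider "\<alpha> < 0" | "\<alpha> = 0" "r > 1" | "\<alpha> = 0" "r = 1" | "\<alpha> > 0" using r by linarith
  then show ?thesis unfolding I_def[symmetric]
  proof cases
    case 1
    have z1: "z < 1" using powr_less_mono[of "2 * \<alpha>" 0 2] 1 by (simp add: z_def)
    show "\<exists>C\<ge>0. \<forall>f \<in> Lp 2 \<inter> Lp r. \<forall>K \<tau>. 2 ^ K \<le> \<tau> \<longrightarrow>
    (\<Sum>k\<le>K. Q * Q ^ k * I f (shell k :: 'a set)) + Q ^ Suc K * I f (cball 0 ((1/2) ^ Suc K))
     \<le> C * (growth_rate DIM('a) r \<mu> \<tau>)\<^sup>2 * (Lp_norm r f)\<^sup>2"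
    proof (rule gen[of "1 / (1 - z)"])
      have i: "1 \<le> 1 / (1 - z)" using z z1 by simp
      then show "0 \<le> 1 / (1 - z)" by linarith
      fix K :: nat and \<tau> :: real assume t: "2 ^ K \<le> \<tau>"
      have *: "1 / (1 - z) * 1 \<le> 1 / (1 - z) * (growth_rate DIM('a) r \<mu> \<tau>)\<^sup>2"
        by (rule mult_left_mono[OF G1[OF t]]) (use i in linarith)
      have "(\<Sum>k\<le>K. z ^ k) = (1 - z ^ Suc K) / (1 - z)"
        using z1 by (simp add: sum_gp0)
      also have "\<dots> \<le> 1 / (1 - z)" using z z1 by (intro divide_right_mono) auto
      finally show "(\<Sum>k\<le>K. z ^ k) \<le> 1 / (1 - z) * (growth_rate DIM('a) r \<mu> \<tau>)\<^sup>2" using * by linarith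
      have "z ^ Suc K \<le> 1" using z z1 by (intro power_le_one) auto
      then show "z ^ Suc K \<le> 1 / (1 - z) * (growth_rate DIM('a) r \<mu> \<tau>)\<^sup>2" using * i by linarith
    qed
  next
    case 3
    have z1: "z = 1" using 3 by (simp add: z_def)
    show "\<exists>C\<ge>0. \<forall>f \<in> Lp 2 \<inter> Lp r. \<forall>K \<tau>. 2 ^ K \<le> \<tau> \<longrightarrow>
    (\<Sum>k\<le>K. Q * Q ^ k * I f (shell k :: 'a set)) + Q ^ Suc K * I f (cball 0 ((1/2) ^ Suc K))
     \<le> C * (growth_rate DIM('a) r \<mu> \<tau>)\<^sup>2 * (Lp_norm r f)\<^sup>2"
    proof (rule gen[of 2])
      fix K :: nat and \<tau> :: real assume t: "2 ^ K \<le> \<tau>"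
      have "0 \<le> ln \<tau>" using tau1[OF t] by simp
      then have g: "(growth_rate DIM('a) r \<mu> \<tau>)\<^sup>2 = 1 + ln \<tau>"
        using 3 by (simp add: growth_rate_def \<alpha>_def powr_half_sqrt)
      show "(\<Sum>k\<le>K. z ^ k) \<le> 2 * (growth_rate DIM('a) r \<mu> \<tau>)\<^sup>2"
        unfolding g z1 using ln_dyadic_bound[OF t] by simp
      show "z ^ Suc K \<le> 2 * (growth_rate DIM('a) r \<mu> \<tau>)\<^sup>2"
        unfolding z1 using G1[OF t] by simp
    qed simp
  next
    case 4
    have z1: "z > 1" unfolding z_def using 4 by (intro gr_one_powr) auto
    show "\<exists>C\<ge>0. \<forall>f \<in> Lp 2 \<inter> Lp r. \<forall>K \<tau>. 2 ^ K \<le> \<tau> \<longrightarrow>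
    (\<Sum>k\<le>K. Q * Q ^ k * I f (shell k :: 'a set)) + Q ^ Suc K * I f (cball 0 ((1/2) ^ Suc K))
     \<le> C * (growth_rate DIM('a) r \<mu> \<tau>)\<^sup>2 * (Lp_norm r f)\<^sup>2"
    proof (rule gen[of "z / (z - 1) + z"])
      show "0 \<le> z / (z - 1) + z" using z1 by simp
      fix K :: nat and \<tau> :: real assume t: "2 ^ K \<le> \<tau>"
      have g: "(growth_rate DIM('a) r \<mu> \<tau>)\<^sup>2 = \<tau> powr (2 * \<alpha>)"
        using 4 tau1[OF t] by (simp add: growth_rate_def \<alpha>_def power2_eq_square powr_add[symmetric])
      have "z ^ K = (2 ^ K) powr (2 * \<alpha>)"
        unfolding z_def by (simp add: powr_realpow[symmetric] powr_powr mult_ac)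
      also have "\<dots> \<le> \<tau> powr (2 * \<alpha>)" using t 4 by (intro powr_mono2) auto
      finally have zK: "z ^ K \<le> \<tau> powr (2 * \<alpha>)" .
      have "(\<Sum>k\<le>K. z ^ k) = (z ^ Suc K - 1) / (z - 1)"
        using z1 by (subst lessThan_Suc_atMost[symmetric], subst geometric_sum) auto
      also have "\<dots> \<le> z * z ^ K / (z - 1)" using z1 by (intro divide_right_mono) auto
      also have "\<dots> = z / (z - 1) * z ^ K" by simp
      also have "\<dots> \<le> (z / (z - 1) + z) * \<tau> powr (2 * \<alpha>)"
        using z1 zK by (intro mult_mono) auto
      finally show "(\<Sum>k\<le>K. z ^ k) \<le> (z / (z - 1) + z) * (growth_rate DIM('a) r \<mu> \<tau>)\<^sup>2" unfolding g .
      have "z ^ Suc K = z * z ^ K" by simp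
      also have "\<dots> \<le> (z / (z - 1) + z) * \<tau> powr (2 * \<alpha>)"
        using z1 zK by (intro mult_mono) auto
      finally show "z ^ Suc K \<le> (z / (z - 1) + z) * (growth_rate DIM('a) r \<mu> \<tau>)\<^sup>2" unfolding g .
    qed
  next
    case 2
    have z1: "z = 1" using 2 by (simp add: z_def)
    \<comment> \<open>For alpha = 0 the weight ratio \<open>Q\<close> coincides with the ratio
      \<open>q\<close> of the endpoint estimate, which therefore applies to the weighted sum over
      shells.\<close>
    have \<sigma>: "2 * b = \<sigma>" using \<alpha> 2 by simp
    define p where "p = 2 powr (real DIM('a) * (1 - r) / r)"
    define C5 where "C5 = 2 * unit_ball_vol (real DIM('a)) * (1 / (1 - p))\<^sup>2 + 2 * (Q / (Q - 1))"
    have Q1: "Q > 1" unfolding Q_def \<sigma> \<sigma>_def using r by (intro gr_one_powr) auto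
    have C5: "C5 \<ge> 0" using Q1 by (simp add: C5_def)
    show "\<exists>C\<ge>0. \<forall>f \<in> Lp 2 \<inter> Lp r. \<forall>K \<tau>. 2 ^ K \<le> \<tau> \<longrightarrow>
    (\<Sum>k\<le>K. Q * Q ^ k * I f (shell k :: 'a set)) + Q ^ Suc K * I f (cball 0 ((1/2) ^ Suc K))
     \<le> C * (growth_rate DIM('a) r \<mu> \<tau>)\<^sup>2 * (Lp_norm r f)\<^sup>2"
    proof (intro exI[of _ "Q * C5 + c0"] conjI ballI allI impI)
      show "0 \<le> Q * C5 + c0" using Q C5 c0 by simp
      fix f :: "'a \<Rightarrow> complex" and K :: nat and \<tau> :: real
      assume f: "f \<in> Lp 2 \<inter> Lp r" and \<tau>: "2 ^ K \<le> \<tau>"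
      have g: "(growth_rate DIM('a) r \<mu> \<tau>)\<^sup>2 = 1" using 2 by (simp add: growth_rate_def \<alpha>_def)
      have "(\<Sum>k\<le>K. Q ^ k * I f (shell k)) \<le> C5 * (Lp_norm r f)\<^sup>2"
        unfolding I_def C5_def p_def Q_def \<sigma> \<sigma>_def
        using f by (intro fourier_energy_shells_endpoint 2 r shell_borel shell_subset) auto
      then have "Q * (\<Sum>k\<le>K. Q ^ k * I f (shell k)) \<le> Q * (C5 * (Lp_norm r f)\<^sup>2)"
        using Q by (intro mult_left_mono) auto
      moreover have "Q ^ Suc K * I f (cball 0 ((1/2) ^ Suc K)) \<le> c0 * z ^ Suc K * (Lp_norm r f)\<^sup>2"
        using ball f by blast
      ultimately show "(\<Sum>k\<le>K. Q * Q ^ k * I f (shell k)) + Q ^ Suc K * I f (cball 0 ((1/2) ^ Suc K))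
         \<le> (Q * C5 + c0) * (growth_rate DIM('a) r \<mu> \<tau>)\<^sup>2 * (Lp_norm r f)\<^sup>2"
        unfolding g z1 by (simp add: sum_distrib_left mult.assoc distrib_right)
    qed
  qed
qed

text \<open>The pointwise dyadic bound for the squared weight is integrated against the energy
  density. The summand 1 costs the L^2 norm of \<open>f\<close>, which is absorbed because the
  growth rate is at least 1.\<close>

proposition weighted_data_bound:
  fixes \<mu> r :: real
  assumes r: "1 \<le> r" "r < 2"
  shows "\<exists>C>0. \<forall>f \<in> Lp 2 \<inter> Lp r. \<forall>\<tau>\<ge>1.
    (\<lambda>\<xi>::'a::euclidean_space. of_real (mode_weight (1/2 + Re (nu \<mu>)) (norm \<xi>) \<tau>) * fourier f \<xi>) \<in> Lp 2 \<and>
    Lp_norm 2 (\<lambda>\<xi>. of_real (mode_weight (1/2 + Re (nu \<mu>)) (norm \<xi>) \<tau>) * fourier f \<xi>)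
      \<le> C * growth_rate DIM('a) r \<mu> \<tau> * (Lp_norm 2 f + Lp_norm r f)"
proof -
  define b where "b = 1/2 + Re (nu \<mu>)"
  have b: "b \<ge> 0" using Re_nu_nonneg[of \<mu>] by (simp add: b_def)
  define Q where "Q = 2 powr (2 * b)"
  obtain C where C: "C \<ge> 0" and le: "\<And>f K \<tau>. f \<in> Lp 2 \<inter> Lp r \<Longrightarrow> 2 ^ K \<le> \<tau> \<Longrightarrow>
    (\<Sum>k\<le>K. Q * Q ^ k * (LINT \<xi>|lborel. indicator (shell k :: 'a::euclidean_space set) \<xi> * (norm (fourier f \<xi>))\<^sup>2))
     + Q ^ Suc K * (LINT \<xi>|lborel. indicator (cball 0 ((1/2) ^ Suc K)) \<xi> * (norm (fourier f \<xi>))\<^sup>2)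
     \<le> C * (growth_rate DIM('a) r \<mu> \<tau>)\<^sup>2 * (Lp_norm r f)\<^sup>2"
    using dyadic_energy_sum[OF r, where 'a='a and \<mu>=\<mu>] unfolding Q_def b_def by blast
  have main: "(\<lambda>\<xi>. of_real (mode_weight b (norm \<xi>) \<tau>) * fourier f \<xi>) \<in> Lp 2 \<and>
    Lp_norm 2 (\<lambda>\<xi>. of_real (mode_weight b (norm \<xi>) \<tau>) * fourier f \<xi>)
      \<le> sqrt (1 + C) * growth_rate DIM('a) r \<mu> \<tau> * (Lp_norm 2 f + Lp_norm r f)"
    if f: "f \<in> Lp 2 \<inter> Lp r" and \<tau>: "\<tau> \<ge> 1" for f :: "'a \<Rightarrow> complex" and \<tau>
  proof -
    obtain K where K: "2 ^ K \<le> \<tau>" "\<tau> < 2 ^ Suc K" using dyadic_scale_exists[OF \<tau>] .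
    have f2: "f \<in> Lp 2" using f by simp
    note F = fourier_Lp2[OF f2]
    note [measurable] = Lp_measurable[OF F]
    have cb [measurable]: "cball (0::'a) ((1/2) ^ Suc K) \<in> sets borel" by simp
    define G where "G = growth_rate DIM('a) r \<mu> \<tau>"
    have G1: "G \<ge> 1" unfolding G_def by (rule growth_rate_ge_1[OF \<tau>])
    have wm [measurable]: "(\<lambda>\<xi>::'a. mode_weight b (norm \<xi>) \<tau>) \<in> borel_measurable borel"
      unfolding mode_weight_def by measurable
    define H where "H \<xi> = (norm (fourier f \<xi>))\<^sup>2 + (\<Sum>k\<le>K. Q * Q ^ k * (indicator (shell k) \<xi> * (norm (fourier f \<xi>))\<^sup>2))
      + Q ^ Suc K * (indicator (cball 0 ((1/2) ^ Suc K)) \<xi> * (norm (fourier f \<xi>))\<^sup>2)" for \<xi>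
    have i: "integrable lborel (\<lambda>\<xi>. (norm (fourier f \<xi>))\<^sup>2)" using F by (simp add: Lp2_iff)
    have i2: "integrable lborel (\<lambda>\<xi>. \<Sum>k\<le>K. Q * Q ^ k * (indicator (shell k) \<xi> * (norm (fourier f \<xi>))\<^sup>2))"
      by (intro Bochner_Integration.integrable_sum integrable_mult_right indicator_Lp2_integrable[OF F] shell_borel)
    have i3: "integrable lborel (\<lambda>\<xi>. Q ^ Suc K * (indicator (cball 0 ((1/2) ^ Suc K)) \<xi> * (norm (fourier f \<xi>))\<^sup>2))"
      by (intro integrable_mult_right indicator_Lp2_integrable[OF F] cb)
    have Hi: "integrable lborel H"
      unfolding H_def[abs_def] by (intro Bochner_Integration.integrable_add i i2 i3)
    have "(LINT \<xi>|lborel. H \<xi>) = (Lp_norm 2 f)\<^sup>2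
      + ((\<Sum>k\<le>K. Q * Q ^ k * (LINT \<xi>|lborel. indicator (shell k) \<xi> * (norm (fourier f \<xi>))\<^sup>2))
      + Q ^ Suc K * (LINT \<xi>|lborel. indicator (cball 0 ((1/2) ^ Suc K)) \<xi> * (norm (fourier f \<xi>))\<^sup>2))"
      unfolding H_def fourier_norm[OF f2, symmetric] Lp_norm2_power2
      using i i2 i3 indicator_Lp2_integrable[OF F shell_borel]
      by (subst Bochner_Integration.integral_add, simp, simp, subst Bochner_Integration.integral_add, simp, simp,
          subst Bochner_Integration.integral_sum) auto
    also have "\<dots> \<le> (Lp_norm 2 f)\<^sup>2 + C * G\<^sup>2 * (Lp_norm r f)\<^sup>2"
      unfolding G_def by (intro add_left_mono le f K)
    also have "\<dots> \<le> G\<^sup>2 * (Lp_norm 2 f + Lp_norm r f)\<^sup>2 + C * G\<^sup>2 * (Lp_norm 2 f + Lp_norm r f)\<^sup>2"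
    proof (intro add_mono mult_left_mono power_mono)
      have "1 * (Lp_norm 2 f)\<^sup>2 \<le> G\<^sup>2 * (Lp_norm 2 f + Lp_norm r f)\<^sup>2"
        using G1 by (intro mult_mono power_mono) (auto simp: one_le_power)
      then show "(Lp_norm 2 f)\<^sup>2 \<le> G\<^sup>2 * (Lp_norm 2 f + Lp_norm r f)\<^sup>2" by simp
    qed (use C in auto)
    also have "\<dots> = (sqrt (1 + C) * G * (Lp_norm 2 f + Lp_norm r f))\<^sup>2"
      using C by (simp add: power_mult_distrib distrib_right)
    finally have HI: "(LINT \<xi>|lborel. H \<xi>) \<le> (sqrt (1 + C) * G * (Lp_norm 2 f + Lp_norm r f))\<^sup>2" .
    have pw: "(norm (of_real (mode_weight b (norm \<xi>) \<tau>) * fourier f \<xi>))\<^sup>2 \<le> H \<xi>" for \<xi>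
    proof -
      have "(norm (of_real (mode_weight b (norm \<xi>) \<tau>) * fourier f \<xi>))\<^sup>2
        = (mode_weight b (norm \<xi>) \<tau>)\<^sup>2 * (norm (fourier f \<xi>))\<^sup>2"
        by (simp add: norm_mult power_mult_distrib)
      also have "\<dots> \<le> (1 + (\<Sum>k\<le>K. Q * Q ^ k * indicator (shell k) \<xi>) + Q ^ Suc K * indicator (cball 0 ((1/2) ^ Suc K)) \<xi>)
          * (norm (fourier f \<xi>))\<^sup>2"
        unfolding Q_def by (intro mult_right_mono mode_weight_dyadic K b) simp
      also have "\<dots> = H \<xi>" by (simp add: H_def algebra_simps sum_distrib_left sum_distrib_right)
      finally show ?thesis .
    qed
    have "(\<integral>\<^sup>+\<xi>. ennreal ((norm (of_real (mode_weight b (norm \<xi>) \<tau>) * fourier f \<xi>))\<^sup>2) \<partial>lborel) \<le> (\<integral>\<^sup>+\<xi>. ennreal (H \<xi>) \<partial>lborel)"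
      by (intro nn_integral_mono ennreal_leI pw)
    also have "\<dots> = ennreal (LINT \<xi>|lborel. H \<xi>)"
      using pw by (intro nn_integral_eq_integral Hi) (auto intro: order_trans[OF zero_le_power2])
    also have "\<dots> \<le> ennreal ((sqrt (1 + C) * G * (Lp_norm 2 f + Lp_norm r f))\<^sup>2)" by (rule ennreal_leI[OF HI])
    finally have *: "(\<integral>\<^sup>+\<xi>. ennreal ((norm (of_real (mode_weight b (norm \<xi>) \<tau>) * fourier f \<xi>))\<^sup>2) \<partial>lborel)
      \<le> ennreal ((sqrt (1 + C) * G * (Lp_norm 2 f + Lp_norm r f))\<^sup>2)" .
    have "0 \<le> sqrt (1 + C) * G * (Lp_norm 2 f + Lp_norm r f)"
      using C G1 by (intro mult_nonneg_nonneg add_nonneg_nonneg) auto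
    from Lp2_boundI[OF _ * this] show ?thesis by (simp add: G_def)
  qed
  have "sqrt (1 + C) > 0" using C by simp
  with main show ?thesis unfolding b_def by blast
qed

subsection \<open>Scattering\<close>

lemma has_vector_derivative_quotient:
  fixes f :: "real \<Rightarrow> complex"
  assumes "(f has_vector_derivative D) (at t within S)"
  shows "((\<lambda>s. (f s - f t) / of_real (s - t)) \<longlongrightarrow> D) (at t within S)"
proof -
  have "((\<lambda>y. (1 / norm (y - t)) *\<^sub>R (f y - (f t + (y - t) *\<^sub>R D))) \<longlongrightarrow> 0) (at t within S)"
    using assms unfolding has_vector_derivative_def has_derivative_within by simp
  then have L: "((\<lambda>y. norm ((1 / norm (y - t)) *\<^sub>R (f y - (f t + (y - t) *\<^sub>R D)))) \<longlongrightarrow> 0) (at t within S)"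
    by (rule tendsto_norm_zero)
  have "((\<lambda>s. (f s - f t) / of_real (s - t) - D) \<longlongrightarrow> 0) (at t within S)"
  proof (rule Lim_null_comparison[OF _ L])
    have "norm ((f s - f t) / of_real (s - t) - D) = norm ((1 / norm (s - t)) *\<^sub>R (f s - (f t + (s - t) *\<^sub>R D)))"
      if "s \<noteq> t" for s
    proof -
      have "(f s - f t) / of_real (s - t) - D = (f s - (f t + (s - t) *\<^sub>R D)) / of_real (s - t)"
        using that by (simp add: field_simps scaleR_conv_of_real)
      then show ?thesis
        by (simp only: norm_divide norm_of_real norm_scaleR) (simp add: divide_inverse mult.commute)
    qed
    then show "\<forall>\<^sub>F s in at t within S. norm ((f s - f t) / of_real (s - t) - D)
        \<le> norm ((1 / norm (s - t)) *\<^sub>R (f s - (f t + (s - t) *\<^sub>R D)))"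
      by (auto simp: eventually_at_filter intro!: always_eventually)
  qed
  then show ?thesis by (simp add: LIM_zero_iff)
qed

text \<open>The approach is from the right, the side available at \<open>t = 0\<close>.\<close>

lemma filterlim_right_approach:
  "filterlim (\<lambda>n. t + 1 / real (Suc n)) (at t within {t..}) sequentially"
proof -
  have "(\<lambda>n. t + 1 / real (Suc n)) \<longlonglongrightarrow> t + 0"
    by (intro tendsto_intros lim_1_over_n[THEN LIMSEQ_Suc])
  then show ?thesis by (auto simp: filterlim_at)
qed

text \<open>The notion of solution links only \<open>U\<close> to the transforms of
  \<open>u\<close>; this identifies the derivative as well. The L^2 difference quotients of
  \<open>u\<close> converge to \<open>u' t\<close>, so their transforms converge almost everywhere
  along a subsequence, and the pointwise limit is \<open>U'\<close>.\<close>

lemma fourier_time_derivative: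
  fixes u u' :: "real \<Rightarrow> 'a::euclidean_space \<Rightarrow> complex"
  assumes C1: "C1_L2 u u'" and t: "t \<ge> 0"
    and U: "\<And>s. s \<ge> 0 \<Longrightarrow> AE \<xi> in lborel. U s \<xi> = fourier (u s) \<xi>"
    and U': "AE \<xi> in lborel. ((\<lambda>s. U s \<xi>) has_vector_derivative U' \<xi>) (at t within {0..})"
  shows "AE \<xi> in lborel. U' \<xi> = fourier (u' t) \<xi>"
proof -
  define s where "s n = t + 1 / real (Suc n)" for n
  have s: "s n \<ge> 0" "s n - t \<noteq> 0" for n using t by (simp_all add: s_def)
  have sl: "filterlim s (at t within {0..}) sequentially"
    unfolding s_def
    by (rule filterlim_mono[OF filterlim_right_approach at_le order_refl]) (use t in auto)
  have uL: "u x \<in> Lp 2" "u' x \<in> Lp 2" if "x \<ge> 0" for x using C1 that by (auto simp: C1_L2_def)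
  define q where "q n x = (u (s n) x - u t x) / complex_of_real (s n - t)" for n x
  define Q where "Q n \<xi> = (fourier (u (s n)) \<xi> - fourier (u t) \<xi>) / complex_of_real (s n - t)" for n \<xi>
  have hq: "has_fourier (q n) (Q n)" for n
  proof -
    have "has_fourier (\<lambda>x. 1 / complex_of_real (s n - t) * u (s n) x + (- 1 / complex_of_real (s n - t)) * u t x)
      (\<lambda>\<xi>. 1 / complex_of_real (s n - t) * fourier (u (s n)) \<xi> + (- 1 / complex_of_real (s n - t)) * fourier (u t) \<xi>)"
      by (intro has_fourier_lincomb has_fourier_fourier uL s t)
    then show ?thesis by (simp add: q_def[abs_def] Q_def[abs_def] diff_divide_distrib)
  qed
  have "has_fourier (\<lambda>x. 1 * q n x + (-1) * u' t x) (\<lambda>\<xi>. 1 * Q n \<xi> + (-1) * fourier (u' t) \<xi>)" for n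
    by (intro has_fourier_lincomb hq has_fourier_fourier uL t)
  from has_fourier_norm[OF this]
  have n: "Lp_norm 2 (\<lambda>\<xi>. Q n \<xi> - fourier (u' t) \<xi>) = Lp_norm 2 (\<lambda>x. q n x - u' t x)" for n by simp
  have "((\<lambda>s. Lp_norm 2 (\<lambda>x. (u s x - u t x) / complex_of_real (s - t) - u' t x)) \<longlongrightarrow> 0) (at t within {0..})"
    using C1 t by (auto simp: C1_L2_def)
  from filterlim_compose[OF this sl] have "(\<lambda>n. Lp_norm 2 (\<lambda>\<xi>. Q n \<xi> - fourier (u' t) \<xi>)) \<longlonglongrightarrow> 0"
    unfolding n q_def .
  from Lp2_tendsto_AE_subseq[OF has_fourierD(2)[OF hq] fourier_Lp2[OF uL(2)[OF t]] this]
  obtain \<phi> :: "nat \<Rightarrow> nat" where \<phi>: "strict_mono \<phi>" and ae: "AE \<xi> in lborel. (\<lambda>n. Q (\<phi> n) \<xi>) \<longlonglongrightarrow> fourier (u' t) \<xi>"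
    by blast
  \<comment> \<open>The versions agree off a null set that depends on the time, so only countably
    many times can be used at once.\<close>
  have "AE \<xi> in lborel. \<forall>n. U (s n) \<xi> = fourier (u (s n)) \<xi>"
    unfolding AE_all_countable using U s by blast
  then show ?thesis using ae U[OF t] U'
  proof eventually_elim
    case (elim \<xi>)
    have "(\<lambda>n. (U (s n) \<xi> - U t \<xi>) / of_real (s n - t)) \<longlonglongrightarrow> U' \<xi>"
      by (rule filterlim_compose[OF has_vector_derivative_quotient[OF elim(4)] sl])
    then have "(\<lambda>n. Q n \<xi>) \<longlonglongrightarrow> U' \<xi>" using elim by (simp add: Q_def)
    from LIMSEQ_subseq_LIMSEQ[OF this \<phi>] have "(\<lambda>n. Q (\<phi> n) \<xi>) \<longlonglongrightarrow> U' \<xi>" by (simp add: o_def)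
    then show ?case using LIMSEQ_unique elim(2) by blast
  qed
qed

text \<open>The datum \<open>mu1/2 u0 + u1\<close> is the value at 0 of the derivative of
  \<open>(1+t)^(mu1/2) u\<close>. \<open>V\<close> and \<open>V'\<close> obey the mode equation at
  all times off one null set, whereas their identification with transforms of \<open>u\<close> costs
  a null set for each \<open>t\<close>.\<close>

lemma wave_solution_modes:
  fixes u u' :: "real \<Rightarrow> 'a::euclidean_space \<Rightarrow> complex"
  assumes sol: "wave_solution \<mu>1 \<mu>2 u0 u1 u u'" and mu: "\<mu> = \<mu>1 * (2 - \<mu>1) / 4 + \<mu>2"
    and u0: "u0 \<in> Lp 2" and u1: "u1 \<in> Lp 2"
  shows "\<exists>V V'. (\<forall>t\<ge>0. AE \<xi> in lborel. V t \<xi> = of_real ((1 + t) powr (\<mu>1 / 2)) * fourier (u t) \<xi>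
        \<and> V' t \<xi> = of_real ((1 + t) powr (\<mu>1 / 2)) * (fourier (u' t) \<xi> + of_real (\<mu>1 / (2 * (1 + t))) * fourier (u t) \<xi>))
     \<and> (AE \<xi> in lborel. V 0 \<xi> = fourier u0 \<xi> \<and> V' 0 \<xi> = fourier (\<lambda>x. of_real (\<mu>1 / 2) * u0 x + u1 x) \<xi>
        \<and> damped_mode \<mu> (norm \<xi>) (\<lambda>t. V t \<xi>) (\<lambda>t. V' t \<xi>))"
proof -
  have C1: "C1_L2 u u'" using sol by (simp add: wave_solution_def)
  obtain U U' where U: "\<And>t. t \<ge> 0 \<Longrightarrow> AE \<xi> in lborel. U t \<xi> = fourier (u t) \<xi>"
    and ae: "AE \<xi> in lborel. U 0 \<xi> = fourier u0 \<xi> \<and> U' 0 \<xi> = fourier u1 \<xi> \<and>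
         (\<forall>t\<ge>0. ((\<lambda>s. U s \<xi>) has_vector_derivative U' t \<xi>) (at t within {0..}) \<and>
           ((\<lambda>s. U' s \<xi>) has_vector_derivative
              - ((norm \<xi>)\<^sup>2 *\<^sub>R U t \<xi>) - (\<mu>1 / (1 + t)) *\<^sub>R U' t \<xi> - (\<mu>2 / (1 + t)\<^sup>2) *\<^sub>R U t \<xi>)
              (at t within {0..}))"
    using sol unfolding wave_solution_def by blast
  have U'ae: "AE \<xi> in lborel. U' t \<xi> = fourier (u' t) \<xi>" if t: "t \<ge> 0" for t
    by (rule fourier_time_derivative[OF C1 t U]) (use ae t in auto)
  have "has_fourier (\<lambda>x. of_real (\<mu>1 / 2) * u0 x + 1 * u1 x) (\<lambda>\<xi>. of_real (\<mu>1 / 2) * fourier u0 \<xi> + 1 * fourier u1 \<xi>)"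
    by (intro has_fourier_lincomb has_fourier_fourier u0 u1)
  from fourier_eq_AE[OF this]
  have v1: "AE \<xi> in lborel. fourier (\<lambda>x. of_real (\<mu>1 / 2) * u0 x + u1 x) \<xi> = of_real (\<mu>1 / 2) * fourier u0 \<xi> + fourier u1 \<xi>"
    by simp
  define V where "V t \<xi> = (1 + t) powr (\<mu>1 / 2) *\<^sub>R U t \<xi>" for t \<xi>
  define V' where "V' t \<xi> = (1 + t) powr (\<mu>1 / 2) *\<^sub>R (U' t \<xi> + (\<mu>1 / (2 * (1 + t))) *\<^sub>R U t \<xi>)" for t \<xi>
  show ?thesis
  proof (intro exI conjI allI impI)
    fix t :: real assume t: "t \<ge> 0"
    show "AE \<xi> in lborel. V t \<xi> = of_real ((1 + t) powr (\<mu>1 / 2)) * fourier (u t) \<xi>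
        \<and> V' t \<xi> = of_real ((1 + t) powr (\<mu>1 / 2)) * (fourier (u' t) \<xi> + of_real (\<mu>1 / (2 * (1 + t))) * fourier (u t) \<xi>)"
      using U[OF t] U'ae[OF t] by eventually_elim (simp add: V_def V'_def scaleR_conv_of_real)
  next
    show "AE \<xi> in lborel. V 0 \<xi> = fourier u0 \<xi> \<and> V' 0 \<xi> = fourier (\<lambda>x. of_real (\<mu>1 / 2) * u0 x + u1 x) \<xi>
        \<and> damped_mode \<mu> (norm \<xi>) (\<lambda>t. V t \<xi>) (\<lambda>t. V' t \<xi>)"
      using ae v1
    proof eventually_elim
      case (elim \<xi>)
      have "damped_mode \<mu> (norm \<xi>) (\<lambda>t. V t \<xi>) (\<lambda>t. V' t \<xi>)"
        unfolding V_def V'_def by (rule damped_mode_Liouville[OF _ _ mu]) (use elim in auto)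
      then show ?case using elim by (simp add: V_def V'_def scaleR_conv_of_real add.commute)
    qed
  qed
qed

lemma Lp2_telescope:
  fixes f :: "nat \<Rightarrow> 'a::euclidean_space \<Rightarrow> complex"
  assumes f: "\<And>n. f n \<in> Lp 2"
  shows "Lp_norm 2 (\<lambda>x. f n x - f 0 x) \<le> (\<Sum>j<n. Lp_norm 2 (\<lambda>x. f (Suc j) x - f j x))"
proof (induction n)
  case 0
  then show ?case by (simp add: Lp_norm2_eq)
next
  case (Suc n)
  then show ?case using Lp_norm2_triangle_diff[OF f[of "Suc n"] f[of n] f[of 0]] by simp
qed

text \<open>The times \<open>2 ^ j (1 + t) - 1\<close> turn the integral over \<open>(t, \<infinity>)\<close> in Cook's method into a
  sum, so that only the triangle inequality in \<open>L\<^sup>2\<close> and Fatou's lemma are needed.\<close>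

lemma dyadic_scattering:
  fixes X Xh :: "real \<Rightarrow> 'a::euclidean_space \<Rightarrow> complex" and \<Phi> :: "real \<Rightarrow> 'a \<Rightarrow> complex"
  assumes Xh: "\<And>t. t \<ge> 0 \<Longrightarrow> Xh t \<in> Lp 2"
    and eq: "\<And>t. t \<ge> 0 \<Longrightarrow> AE \<xi> in lborel. X t \<xi> = Xh t \<xi>"
    and m: "m \<ge> 0"
    and inc: "AE \<xi> in lborel. \<forall>s t. 0 \<le> s \<longrightarrow> s \<le> t \<longrightarrow>
        norm (X t \<xi> - X s \<xi>) \<le> m * norm (\<Phi> (1 + t) \<xi>) * (1 / (1 + s) - 1 / (1 + t))"
    and tail: "AE \<xi> in lborel. \<exists>S\<ge>0. \<forall>s t. 0 \<le> s \<longrightarrow> s \<le> t \<longrightarrow>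
        norm (X t \<xi> - X s \<xi>) \<le> S * (1 / (1 + s) - 1 / (1 + t))"
    and \<Phi>: "\<And>\<tau>. \<tau> \<ge> 1 \<Longrightarrow> \<Phi> \<tau> \<in> Lp 2" "\<And>\<tau>. \<tau> \<ge> 1 \<Longrightarrow> Lp_norm 2 (\<Phi> \<tau>) \<le> g \<tau>"
    and h: "\<And>\<tau> n. \<tau> \<ge> 1 \<Longrightarrow> (\<Sum>j<n. (1/2) ^ j * g (2 ^ Suc j * \<tau>)) \<le> h \<tau>"
  shows "\<exists>Xp \<in> Lp 2. \<forall>t\<ge>0. Lp_norm 2 (\<lambda>\<xi>. Xh t \<xi> - Xp \<xi>) \<le> m * h (1 + t) / (1 + t)"
proof -
  note [measurable] = Xh[THEN Lp_measurable]
  \<comment> \<open>\<open>X\<close> obeys the increment bounds off a fixed null set,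
    \<open>Xh\<close> is measurable at each time. Taking the limit of \<open>Xh\<close> along the
    integers makes \<open>Xp\<close> measurable.\<close>
  define Xp where "Xp \<xi> = lim (\<lambda>n. Xh (real n) \<xi>)" for \<xi>
  have Xpm [measurable]: "Xp \<in> borel_measurable borel"
    unfolding Xp_def by (rule borel_measurable_lim_metric) simp
  have "AE \<xi> in lborel. \<forall>n. X (real n) \<xi> = Xh (real n) \<xi>"
    unfolding AE_all_countable using eq by simp
  \<comment> \<open>Convergence cannot be read off from \<open>inc\<close>, because its majorant
    \<open>\<Phi> (1 + t)\<close> may grow with \<open>t\<close>; \<open>tail\<close> offers a bound
    independent of time for each frequency.\<close>
  then have conv: "AE \<xi> in lborel. ((\<lambda>t. X t \<xi>) \<longlongrightarrow> Xp \<xi>) at_top"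
    using tail
  proof eventually_elim
    case (elim \<xi>)
    then obtain S where "S \<ge> 0" "\<And>s t. 0 \<le> s \<Longrightarrow> s \<le> t \<Longrightarrow> norm (X t \<xi> - X s \<xi>) \<le> S * (1 / (1 + s) - 1 / (1 + t))"
      by blast
    from tail_convergent[OF this] show ?case using elim(1) by (simp add: Xp_def)
  qed
  have main: "(\<lambda>\<xi>. Xh t \<xi> - Xp \<xi>) \<in> Lp 2 \<and> Lp_norm 2 (\<lambda>\<xi>. Xh t \<xi> - Xp \<xi>) \<le> m * h (1 + t) / (1 + t)"
    if t: "t \<ge> 0" for t
  proof -
    define \<tau> where "\<tau> = 1 + t"
    have \<tau>: "\<tau> \<ge> 1" using t by (simp add: \<tau>_def)
    \<comment> \<open>\<open>1 + T j\<close> doubles at each step, so \<open>1/(1+s)\<close> drops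
      by half of \<open>2^(-j)/tau\<close> between \<open>T j\<close> and
      \<open>T (Suc j)\<close>.\<close>
    define T where "T j = 2 ^ j * \<tau> - 1" for j :: nat
    have T1: "1 \<le> 2 ^ j * \<tau>" for j using mult_mono[of 1 "2 ^ j" 1 \<tau>] \<tau> by simp
    have T0: "T j \<ge> 0" for j using T1[of j] by (simp add: T_def)
    have T00: "T 0 = t" by (simp add: T_def \<tau>_def)
    have step: "Lp_norm 2 (\<lambda>\<xi>. Xh (T (Suc j)) \<xi> - Xh (T j) \<xi>) \<le> m / \<tau> * ((1/2) ^ j * g (2 ^ Suc j * \<tau>))" for j
    proof -
      define c where "c = m * (1 / (1 + T j) - 1 / (1 + T (Suc j)))"
      have c: "c = m * (1/2) ^ Suc j / \<tau>"
        using \<tau> by (simp add: c_def T_def field_simps)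
      have c0: "c \<ge> 0" using m \<tau> by (simp add: c)
      have TS: "1 + T (Suc j) = 2 ^ Suc j * \<tau>" by (simp add: T_def)
      have "Lp_norm 2 (\<lambda>\<xi>. Xh (T (Suc j)) \<xi> - Xh (T j) \<xi>) \<le> Lp_norm 2 (\<lambda>\<xi>. of_real c * \<Phi> (2 ^ Suc j * \<tau>) \<xi>)"
      proof (rule Lp2_mono(2))
        show "(\<lambda>\<xi>. of_real c * \<Phi> (2 ^ Suc j * \<tau>) \<xi>) \<in> Lp 2"
          by (intro Lp2_cmult \<Phi> T1)
        show "(\<lambda>\<xi>. Xh (T (Suc j)) \<xi> - Xh (T j) \<xi>) \<in> borel_measurable borel"
          using T0 by simp
        show "AE \<xi> in lborel. norm (Xh (T (Suc j)) \<xi> - Xh (T j) \<xi>) \<le> norm (of_real c * \<Phi> (2 ^ Suc j * \<tau>) \<xi>)"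
          using inc eq[OF T0[of j]] eq[OF T0[of "Suc j"]]
        proof eventually_elim
          case (elim \<xi>)
          have "T j \<le> T (Suc j)" using \<tau> by (simp add: T_def)
          then have "norm (X (T (Suc j)) \<xi> - X (T j) \<xi>) \<le> m * norm (\<Phi> (1 + T (Suc j)) \<xi>) * (1 / (1 + T j) - 1 / (1 + T (Suc j)))"
            using elim(1) T0 by blast
          also have "\<dots> = c * norm (\<Phi> (2 ^ Suc j * \<tau>) \<xi>)" unfolding c_def TS by (simp only: mult_ac)
          also have "\<dots> = norm (of_real c * \<Phi> (2 ^ Suc j * \<tau>) \<xi>)" using c0 by (simp only: norm_mult norm_of_real abs_of_nonneg)
          finally show ?case unfolding elim(2,3) .
        qed
      qed
      also have "\<dots> \<le> c * g (2 ^ Suc j * \<tau>)"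
        unfolding Lp_norm2_cmult using c0 \<Phi>(2)[OF T1[of "Suc j"]] by (simp add: mult_left_mono)
      also have "\<dots> \<le> m / \<tau> * ((1/2) ^ j * g (2 ^ Suc j * \<tau>))"
      proof -
        have "c \<le> m / \<tau> * (1/2) ^ j" 
        proof -
          define x where "x = m / \<tau> * (1/2) ^ j"
          have "c = x / 2" "0 \<le> x" using m \<tau> by (simp_all add: c x_def)
          then show ?thesis unfolding x_def[symmetric] by simp
        qed
        moreover have "0 \<le> g (2 ^ Suc j * \<tau>)" using \<Phi>(2)[OF T1[of "Suc j"]] Lp_norm_nonneg order_trans by blast
        ultimately show ?thesis unfolding mult.assoc[symmetric] by (rule mult_right_mono)
      qed
      finally show ?thesis .
    qed
    have bd: "Lp_norm 2 (\<lambda>\<xi>. Xh t \<xi> - Xh (T n) \<xi>) \<le> m * h \<tau> / \<tau>" for n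
    proof -
      have "Lp_norm 2 (\<lambda>\<xi>. Xh (T n) \<xi> - Xh (T 0) \<xi>) \<le> (\<Sum>j<n. Lp_norm 2 (\<lambda>\<xi>. Xh (T (Suc j)) \<xi> - Xh (T j) \<xi>))"
        by (rule Lp2_telescope) (intro Xh T0)
      also have "\<dots> \<le> (\<Sum>j<n. m / \<tau> * ((1/2) ^ j * g (2 ^ Suc j * \<tau>)))" by (intro sum_mono step)
      also have "\<dots> = m / \<tau> * (\<Sum>j<n. (1/2) ^ j * g (2 ^ Suc j * \<tau>))" by (simp add: sum_distrib_left)
      also have "\<dots> \<le> m / \<tau> * h \<tau>" using m \<tau> by (intro mult_left_mono h) auto
      finally show ?thesis unfolding T00 by (simp add: Lp_norm2_minus_commute[of "Xh t"])
    qed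
    have "AE \<xi> in lborel. \<forall>n. X (T n) \<xi> = Xh (T n) \<xi>"
      unfolding AE_all_countable using eq T0 by simp
    then have lim: "AE \<xi> in lborel. (\<lambda>n. Xh t \<xi> - Xh (T n) \<xi>) \<longlonglongrightarrow> Xh t \<xi> - Xp \<xi>"
      using conv
    proof eventually_elim
      case (elim \<xi>)
      have "filterlim (\<lambda>n. 2 ^ n * \<tau> - 1) at_top sequentially"
      proof (rule filterlim_at_top_mono[OF filterlim_real_sequentially], intro always_eventually allI)
        fix n :: nat
        have "real (Suc n) \<le> 2 ^ n" using of_nat_mono[of "Suc n" "2 ^ n", where 'a=real] less_exp[of n] by simp
        also have "\<dots> \<le> 2 ^ n * \<tau>" using \<tau> by simp
        finally show "real n \<le> 2 ^ n * \<tau> - 1" by simp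
      qed
      from filterlim_compose[OF elim(2) this] have "(\<lambda>n. X (T n) \<xi>) \<longlonglongrightarrow> Xp \<xi>" unfolding T_def .
      then show ?case using elim(1) by (intro tendsto_intros) simp
    qed
    show ?thesis
      using Lp2_Fatou[OF Lp2_diff[OF Xh[OF t] Xh[OF T0]] _ lim bd] t by (simp add: \<tau>_def)
  qed
  have "Xp \<in> Lp 2"
    using Lp2_diff[OF Xh[of 0], of "\<lambda>\<xi>. Xh 0 \<xi> - Xp \<xi>"] main[of 0] by simp
  then show ?thesis using main by blast
qed

section \<open>Summation of the growth rate over dyadic times\<close>

lemma summable_quadratic_geometric:
  fixes y :: real
  assumes y: "0 < y" "y < 1"
  shows "summable (\<lambda>j. (real j + 2)\<^sup>2 * y ^ j)"
proof -
  \<comment> \<open>From this index on, the linear and constant terms of \<open>(x + 1)^2\<close>,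
    times \<open>y\<close>, are at most half of the gap \<open>1 - y\<close> times
    \<open>x^2\<close>, so the ratio stays below \<open>(1 + y)/2\<close>.\<close>
  obtain N :: nat where N: "6 * y / (1 - y) \<le> real N" using real_arch_simple by blast
  show ?thesis
  proof (rule summable_ratio_test[of "(1 + y) / 2" N])
    show "(1 + y) / 2 < 1" using y by simp
    fix j :: nat assume j: "N \<le> j"
    define x where "x = real j + 2"
    have x: "x \<ge> 2" by (simp add: x_def)
    have "6 * y / (1 - y) \<le> x" using N j by (simp add: x_def)
    then have xy: "6 * y \<le> x * (1 - y)" using y by (simp add: pos_divide_le_eq)
    have "y * (x + 1)\<^sup>2 = y * x\<^sup>2 + y * (2 * x + 1)" by (simp add: power2_eq_square algebra_simps)
    also have "y * (2 * x + 1) \<le> y * (3 * x)" using x y by (intro mult_left_mono) auto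
    also have "y * (3 * x) \<le> (1 - y) / 2 * x\<^sup>2"
      using mult_right_mono[OF xy, of "x / 2"] x by (simp add: power2_eq_square algebra_simps)
    also have "y * x\<^sup>2 + (1 - y) / 2 * x\<^sup>2 = (1 + y) / 2 * x\<^sup>2" by (simp add: algebra_simps add_divide_distrib diff_divide_distrib)
    finally have "y * (x + 1)\<^sup>2 * y ^ j \<le> (1 + y) / 2 * x\<^sup>2 * y ^ j" using y by (intro mult_right_mono) auto
    then show "norm ((real (Suc j) + 2)\<^sup>2 * y ^ Suc j) \<le> (1 + y) / 2 * norm ((real j + 2)\<^sup>2 * y ^ j)"
      using y by (simp add: x_def abs_mult mult_ac add_ac)
  qed
qed

text \<open>Doubling the time \<open>j + 1\<close> times adds at most \<open>j + 1\<close> to the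
  logarithm and hence costs at most a factor \<open>j + 2\<close>. This serves both the logarithm
  with \<open>delta\<close> and the one inside the growth rate.\<close>

lemma log_dyadic_growth:
  fixes \<tau> p :: real
  assumes \<tau>: "\<tau> \<ge> 1" and p: "0 \<le> p" "p \<le> 1"
  shows "(1 + ln (2 ^ Suc j * \<tau>)) powr p \<le> (1 + ln \<tau>) powr p * (real j + 2)"
proof -
  have l: "ln \<tau> \<ge> 0" using \<tau> by simp
  have "ln (2 ^ Suc j * \<tau>) = real (Suc j) * ln 2 + ln \<tau>"
    using \<tau> by (simp only: ln_mult_pos ln_realpow zero_less_power zero_less_numeral less_le_trans[OF zero_less_one])
  also have "\<dots> \<le> real (Suc j) * 1 + ln \<tau>"
    using ln_2_less_1 by (intro add_right_mono mult_left_mono) auto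
  finally have "1 + ln (2 ^ Suc j * \<tau>) \<le> (1 + ln \<tau>) * (real j + 2)"
  proof -
    assume le: "ln (2 ^ Suc j * \<tau>) \<le> real (Suc j) * 1 + ln \<tau>"
    have "1 + ln (2 ^ Suc j * \<tau>) \<le> real j + 2 + ln \<tau>" using le by simp
    also have "\<dots> \<le> (real j + 2 + ln \<tau>) + (real j * ln \<tau> + ln \<tau>)"
      using l by (intro add_increasing2 add_nonneg_nonneg mult_nonneg_nonneg order_refl) auto
    also have "\<dots> = (1 + ln \<tau>) * (real j + 2)" by (simp add: algebra_simps)
    finally show ?thesis .
  qed
  moreover have "0 \<le> 1 + ln (2 ^ Suc j * \<tau>)"
  proof -
    have "1 \<le> 2 ^ Suc j * \<tau>" using mult_mono[of 1 "2 ^ Suc j" 1 \<tau>] one_le_power[of "2::real" "Suc j"] \<tau> by simp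
    then show ?thesis by (simp only: ln_ge_zero add_nonneg_nonneg zero_le_one)
  qed
  ultimately have "(1 + ln (2 ^ Suc j * \<tau>)) powr p \<le> ((1 + ln \<tau>) * (real j + 2)) powr p"
    using p by (intro powr_mono2) auto
  also have "\<dots> = (1 + ln \<tau>) powr p * (real j + 2) powr p" using l by (simp add: powr_mult)
  also have "(real j + 2) powr p \<le> (real j + 2) powr 1" using p by (intro powr_mono) auto
  finally show ?thesis by (simp add: mult_left_mono)
qed

text \<open>This is where \<open>alpha < 1\<close> is used: each doubling multiplies the growth by
  at most about \<open>2^alpha\<close>, or 1 if alpha is negative, while the dyadic weight halves.
  The logarithms contribute the polynomial factor \<open>(j+2)^2\<close>.\<close>

lemma growth_dyadic_sum:
  assumes a: "alpha d r \<mu> < 1"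
  defines "G \<equiv> \<lambda>\<tau>. growth_rate d r \<mu> \<tau> * (1 + ln \<tau>) powr delta \<mu>"
  shows "\<exists>C\<ge>0. \<forall>\<tau>\<ge>1. \<forall>n. (\<Sum>j<n. (1/2) ^ j * G (2 ^ Suc j * \<tau>)) \<le> C * G \<tau>"
proof -
  \<comment> \<open>With the positive part of alpha all three branches of the growth rate share one
    geometric ratio \<open>y = 2^(a-1) < 1\<close>.\<close>
  define a where "a = max 0 (alpha d r \<mu>)"
  have a: "0 \<le> a" "a < 1" using assms(1) by (auto simp: a_def)
  define y where "y = (1/2) * 2 powr a"
  have "2 powr a < 2 powr 1" using a by (intro powr_less_mono) auto
  then have y: "0 < y" "y < 1" by (simp_all add: y_def)
  define w where "w j = (real j + 2)\<^sup>2 * y ^ j" for j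
  have ws: "summable w" unfolding w_def using y by (rule summable_quadratic_geometric)
  have w0: "w j \<ge> 0" for j using y by (simp add: w_def)
  show ?thesis
  proof (intro exI[of _ "2 powr a * suminf w"] conjI allI impI)
    show "0 \<le> 2 powr a * suminf w" using suminf_nonneg[OF ws w0] by simp
    fix \<tau> :: real and n :: nat assume \<tau>: "\<tau> \<ge> 1"
    have G0: "G \<tau> \<ge> 0" unfolding G_def
      using growth_rate_ge_1[OF \<tau>, of d r \<mu>] by (intro mult_nonneg_nonneg) auto
    have "(1/2) ^ j * G (2 ^ Suc j * \<tau>) \<le> 2 powr a * w j * G \<tau>" for j
    proof -
      have T1: "1 \<le> 2 ^ Suc j * \<tau>" using mult_mono[of 1 "2 ^ Suc j" 1 \<tau>] one_le_power[of "2::real" "Suc j"] \<tau> by simp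
      have p1: "1 \<le> (2 ^ Suc j) powr a" using a by (intro ge_one_powr_ge_zero one_le_power) auto
      have "growth_rate d r \<mu> (2 ^ Suc j * \<tau>) \<le> growth_rate d r \<mu> \<tau> * ((real j + 2) * (2 ^ Suc j) powr a)"
      proof -
        consider "alpha d r \<mu> < 0 \<or> alpha d r \<mu> = 0 \<and> r > 1" | "\<not> (alpha d r \<mu> < 0 \<or> alpha d r \<mu> = 0 \<and> r > 1)" "alpha d r \<mu> = 0"
          | "\<not> (alpha d r \<mu> < 0 \<or> alpha d r \<mu> = 0 \<and> r > 1)" "alpha d r \<mu> > 0" by linarith
        then show ?thesis
        proof cases
          case 1
          have "1 * 1 \<le> (real j + 2) * (2 ^ Suc j) powr a" using p1 by (intro mult_mono) auto
          then show ?thesis using 1 by (simp add: growth_rate_def)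
        next
          case 2
          have "(1 + ln (2 ^ Suc j * \<tau>)) powr (1/2) \<le> (1 + ln \<tau>) powr (1/2) * (real j + 2) * 1"
            using log_dyadic_growth[OF \<tau>, of "1/2" j] by simp
          also have "\<dots> \<le> (1 + ln \<tau>) powr (1/2) * (real j + 2) * (2 ^ Suc j) powr a"
            using p1 by (intro mult_left_mono) auto
          finally show ?thesis using 2 by (simp add: growth_rate_def mult.assoc del: power_Suc)
        next
          case 3
          then have aa: "a = alpha d r \<mu>" by (simp add: a_def)
          have "(2 ^ Suc j * \<tau>) powr a = \<tau> powr a * (1 * (2 ^ Suc j) powr a)" using \<tau> by (simp add: powr_mult)
          also have "\<dots> \<le> \<tau> powr a * ((real j + 2) * (2 ^ Suc j) powr a)"
            by (intro mult_left_mono mult_right_mono) auto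
          finally show ?thesis using 3 unfolding growth_rate_def aa by simp
        qed
      qed
      moreover have "(1 + ln (2 ^ Suc j * \<tau>)) powr delta \<mu> \<le> (1 + ln \<tau>) powr delta \<mu> * (real j + 2)"
        by (rule log_dyadic_growth[OF \<tau>]) (auto simp: delta_def)
      ultimately have "G (2 ^ Suc j * \<tau>) \<le> (growth_rate d r \<mu> \<tau> * ((real j + 2) * (2 ^ Suc j) powr a)) * ((1 + ln \<tau>) powr delta \<mu> * (real j + 2))"
        unfolding G_def using growth_rate_ge_1[OF \<tau>, of d r \<mu>] by (intro mult_mono) auto
      also have "\<dots> = (real j + 2)\<^sup>2 * (2 ^ Suc j) powr a * G \<tau>" by (simp add: G_def power2_eq_square mult_ac)
      finally have "(1/2) ^ j * G (2 ^ Suc j * \<tau>) \<le> (1/2) ^ j * ((real j + 2)\<^sup>2 * (2 ^ Suc j) powr a * G \<tau>)"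
        by (intro mult_left_mono) auto
      also have "\<dots> = 2 powr a * ((real j + 2)\<^sup>2 * ((1/2) ^ j * (2 ^ j) powr a)) * G \<tau>"
        by (simp add: powr_mult mult_ac)
      also have "(1/2) ^ j * (2 ^ j) powr a = y ^ j"
      proof -
        have "(2 ^ j) powr a = (2 powr a) ^ j" by (simp add: powr_realpow[symmetric] powr_powr mult.commute)
        then show ?thesis unfolding y_def power_mult_distrib by simp
      qed
      finally show ?thesis by (simp add: w_def)
    qed
    then have "(\<Sum>j<n. (1/2) ^ j * G (2 ^ Suc j * \<tau>)) \<le> (\<Sum>j<n. 2 powr a * w j * G \<tau>)"
      by (intro sum_mono)
    also have "\<dots> = 2 powr a * (\<Sum>j<n. w j) * G \<tau>" by (simp add: sum_distrib_left sum_distrib_right)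
    also have "\<dots> \<le> 2 powr a * suminf w * G \<tau>"
      using sum_le_suminf[OF ws, of "{..<n}"] w0 G0 by (intro mult_right_mono mult_left_mono) auto
    finally show "(\<Sum>j<n. (1/2) ^ j * G (2 ^ Suc j * \<tau>)) \<le> 2 powr a * suminf w * G \<tau>" .
  qed
qed

section \<open>Majorants for the data and the profiles\<close>

lemma Lp2_norm_fun:
  fixes f :: "'a::euclidean_space \<Rightarrow> complex"
  assumes "f \<in> Lp 2"
  shows "(\<lambda>x. complex_of_real (norm (f x))) \<in> Lp 2" "Lp_norm 2 (\<lambda>x. complex_of_real (norm (f x))) = Lp_norm 2 f"
  using assms by (auto simp: Lp2_iff Lp_norm2_eq)

text \<open>The sum \<open>|f| + |g|\<close>, cast to the complex numbers because \<open>Lp\<close>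
  consists of complex functions, serves as majorant for rotated pairs of functions.\<close>

lemma Lp2_norm_add:
  fixes f g :: "'a::euclidean_space \<Rightarrow> complex"
  assumes "f \<in> Lp 2" "g \<in> Lp 2"
  shows "(\<lambda>x. complex_of_real (norm (f x) + norm (g x))) \<in> Lp 2"
    "Lp_norm 2 (\<lambda>x. complex_of_real (norm (f x) + norm (g x))) \<le> Lp_norm 2 f + Lp_norm 2 g"
  using Lp2_add[OF Lp2_norm_fun(1) Lp2_norm_fun(1), OF assms]
    Lp_norm2_triangle[OF Lp2_norm_fun(1) Lp2_norm_fun(1), OF assms] assms
  by (simp_all add: Lp2_norm_fun(2))

lemma Lp_lincomb:
  fixes f g :: "'a::euclidean_space \<Rightarrow> complex"
  assumes f: "f \<in> Lp r" and g: "g \<in> Lp r" and r: "r \<ge> 0"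
  shows "(\<lambda>x. c * f x + g x) \<in> Lp r"
proof -
  note [measurable] = Lp_measurable[OF f] Lp_measurable[OF g]
  have "integrable lborel (\<lambda>x. norm (c * f x + g x) powr r)"
  proof (rule Bochner_Integration.integrable_bound)
    show "integrable lborel (\<lambda>x. (2 * norm c) powr r * norm (f x) powr r + 2 powr r * norm (g x) powr r)"
      using f g by (intro Bochner_Integration.integrable_add integrable_mult_right) (auto simp: Lp_def)
    have "norm (c * f x + g x) powr r \<le> (2 * norm c) powr r * norm (f x) powr r + 2 powr r * norm (g x) powr r" for x
    proof -
      have "norm (c * f x + g x) \<le> norm c * norm (f x) + norm (g x)"
        using norm_triangle_ineq[of "c * f x" "g x"] by (simp add: norm_mult)
      also have "\<dots> \<le> max (2 * norm c * norm (f x)) (2 * norm (g x))" by linarith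
      finally have "norm (c * f x + g x) powr r \<le> (max (2 * norm c * norm (f x)) (2 * norm (g x))) powr r"
        using r by (intro powr_mono2) auto
      also have "\<dots> \<le> (2 * norm c * norm (f x)) powr r + (2 * norm (g x)) powr r"
        by (simp add: max_def)
      finally show ?thesis by (simp add: powr_mult)
    qed
    then show "AE x in lborel. norm (norm (c * f x + g x) powr r)
        \<le> norm ((2 * norm c) powr r * norm (f x) powr r + 2 powr r * norm (g x) powr r)"
      by simp
  qed simp
  then show ?thesis by (simp add: Lp_def)
qed

lemma H1_gradient:
  assumes "f \<in> H1"
  shows "(\<lambda>\<xi>. complex_of_real (norm \<xi>) * fourier f \<xi>) \<in> Lp 2" "Lp_norm 2 f \<le> H1_norm f"
proof -
  have L: "(\<lambda>\<xi>. complex_of_real (sqrt (1 + (norm \<xi>)\<^sup>2)) * fourier f \<xi>) \<in> Lp 2" and f: "f \<in> Lp 2"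
    using assms by (auto simp: H1_def)
  note F = fourier_Lp2[OF f]
  note [measurable] = Lp_measurable[OF F]
  have "norm \<xi> \<le> sqrt (1 + (norm \<xi>)\<^sup>2)" for \<xi> :: 'a by (rule real_le_rsqrt) simp
  then show "(\<lambda>\<xi>. complex_of_real (norm \<xi>) * fourier f \<xi>) \<in> Lp 2"
    by (intro Lp2_mono(1)[OF L]) (auto simp: norm_mult intro!: mult_right_mono)
  have "1 * norm (fourier f \<xi>) \<le> sqrt (1 + (norm \<xi>)\<^sup>2) * norm (fourier f \<xi>)" for \<xi>
    by (rule mult_right_mono) simp_all
  then have "norm (fourier f \<xi>) \<le> norm (complex_of_real (sqrt (1 + (norm \<xi>)\<^sup>2)) * fourier f \<xi>)" for \<xi>
    by (simp add: norm_mult)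
  then show "Lp_norm 2 f \<le> H1_norm f"
    unfolding H1_norm_def fourier_norm[OF f, symmetric] by (intro Lp2_mono(2)[OF L]) auto
qed

lemma mode_weight_mono:
  assumes "0 \<le> b" "0 \<le> \<sigma>" "\<sigma> \<le> \<tau>"
  shows "mode_weight b \<rho> \<sigma> \<le> mode_weight b \<rho> \<tau>"
  unfolding mode_weight_def using assms by (intro powr_mono2) auto

text \<open>Separates the factor due to the substitution \<open>u = (1+t)^(-mu1/2) v\<close> and the
  \<open>1/(1+t)\<close> from Cook's method; what is left is the growth of \<open>v\<close> in
  L^2.\<close>

lemma Theta_eq:
  assumes "t \<ge> 0"
  shows "Theta d r \<mu>1 \<mu> t =
    (1 + t) powr (- \<mu>1 / 2) * (growth_rate d r \<mu> (1 + t) * (1 + ln (1 + t)) powr delta \<mu> / (1 + t))"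
proof -
  have e: "(1 + t) powr (a - 1 - \<mu>1 / 2) = (1 + t) powr (- \<mu>1 / 2) * ((1 + t) powr a / (1 + t))" for a
  proof -
    have "a - 1 - \<mu>1 / 2 = - \<mu>1 / 2 + (a - 1)" by simp
    then show ?thesis using assms by (simp only: powr_add powr_diff) simp
  qed
  have e0: "(1 + t) powr (- 1 - \<mu>1 / 2) = (1 + t) powr (- \<mu>1 / 2) * (1 / (1 + t))"
    using e[of 0] assms by simp
  show ?thesis
    unfolding Theta_def growth_rate_def Let_def e e0 by (simp add: powr_add)
qed

lemma profile_Lp2:
  fixes v v' :: "'a::euclidean_space \<Rightarrow> complex"
  assumes v: "(\<lambda>\<xi>. complex_of_real (norm \<xi>) * v \<xi>) \<in> Lp 2" "v \<in> Lp 2" and v': "v' \<in> Lp 2"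
  shows "(\<lambda>\<xi>. profile_A (norm \<xi>) (v \<xi>) (v' \<xi>) t) \<in> Lp 2" "(\<lambda>\<xi>. profile_B (norm \<xi>) (v \<xi>) (v' \<xi>) t) \<in> Lp 2"
proof -
  note [measurable] = Lp_measurable[OF v(2)] Lp_measurable[OF v']
  have *: "norm ((norm \<xi> * p) *\<^sub>R v \<xi> + q *\<^sub>R v' \<xi>) \<le> norm (complex_of_real (norm (complex_of_real (norm \<xi>) * v \<xi>) + norm (v' \<xi>)))"
    if "\<bar>p\<bar> \<le> 1" "\<bar>q\<bar> \<le> 1" for p q :: real and \<xi>
  proof -
    have "norm ((norm \<xi> * p) *\<^sub>R v \<xi> + q *\<^sub>R v' \<xi>) \<le> \<bar>p\<bar> * (norm \<xi> * norm (v \<xi>)) + \<bar>q\<bar> * norm (v' \<xi>)"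
      using norm_triangle_ineq[of "(norm \<xi> * p) *\<^sub>R v \<xi>" "q *\<^sub>R v' \<xi>"] by (simp add: abs_mult mult_ac)
    also have "\<dots> \<le> 1 * (norm \<xi> * norm (v \<xi>)) + 1 * norm (v' \<xi>)"
      using that by (intro add_mono mult_right_mono) auto
    finally show ?thesis unfolding norm_of_real by (simp add: norm_mult)
  qed
  show "(\<lambda>\<xi>. profile_A (norm \<xi>) (v \<xi>) (v' \<xi>) t) \<in> Lp 2"
    using *[of "cos (_ * t)" "- sin (_ * t)"] unfolding profile_A_def
    by (intro Lp2_mono(1)[OF Lp2_norm_add(1)[OF v(1) v']]) auto
  show "(\<lambda>\<xi>. profile_B (norm \<xi>) (v \<xi>) (v' \<xi>) t) \<in> Lp 2"
    using *[of "sin (_ * t)" "cos (_ * t)"] unfolding profile_B_def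
    by (intro Lp2_mono(1)[OF Lp2_norm_add(1)[OF v(1) v']]) auto
qed

theorem corollary1p2:
  fixes \<mu>1 \<mu>2 \<mu> r :: real
  assumes mu: "\<mu> = \<mu>1 * (2 - \<mu>1) / 4 + \<mu>2"
    and r: "1 \<le> r" "r < 2"
    and alpha: "alpha DIM('a::euclidean_space) r \<mu> < 1"
  shows "\<exists>C>0. \<forall>(u0 :: 'a \<Rightarrow> complex) u1 u u'.
    (u0, u1) \<in> data_space r \<longrightarrow> wave_solution \<mu>1 \<mu>2 u0 u1 u u' \<longrightarrow>
    (\<exists>vp \<in> Hdot1 \<times> Lp 2. \<forall>t\<ge>0.
       Hdot1_norm (\<lambda>\<xi>. fourier (u t) \<xi>
           - complex_of_real ((1 + t) powr (- \<mu>1 / 2)) * fst (wave_flow t vp) \<xi>)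
         \<le> C * \<bar>\<mu>\<bar> * data_norm r (u0, \<lambda>x. complex_of_real (\<mu>1 / 2) * u0 x + u1 x)
             * Theta DIM('a) r \<mu>1 \<mu> t \<and>
       Lp_norm 2 (\<lambda>x. u' t x
           - complex_of_real ((1 + t) powr (- \<mu>1 / 2)) * snd (wave_flow t vp) x)
         \<le> C * (\<bar>\<mu>\<bar> + \<bar>\<mu>1\<bar>) * data_norm r (u0, \<lambda>x. complex_of_real (\<mu>1 / 2) * u0 x + u1 x)
             * Theta DIM('a) r \<mu>1 \<mu> t)"
proof -
  define b where "b = 1/2 + Re (nu \<mu>)"
  have b: "b \<ge> 0" using Re_nu_nonneg[of \<mu>] by (simp add: b_def)
  define L where "L \<tau> = (1 + ln \<tau>) powr delta \<mu>" for \<tau>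
  have L0: "L \<tau> \<ge> 0" for \<tau> by (simp add: L_def)
  have Lmono: "L \<sigma> \<le> L \<tau>" if "1 \<le> \<sigma>" "\<sigma> \<le> \<tau>" for \<sigma> \<tau>
    using that unfolding L_def by (intro powr_mono2 delta_nonneg) (auto intro: add_nonneg_nonneg)
  define G where "G \<tau> = growth_rate DIM('a) r \<mu> \<tau> * L \<tau>" for \<tau>
  have G0: "G \<tau> \<ge> 0" if "\<tau> \<ge> 1" for \<tau>
    using growth_rate_ge_1[OF that, of "DIM('a)" r \<mu>] L0[of \<tau>] by (simp add: G_def)
  obtain c1 where c1: "c1 > 0" and mode: "\<And>\<rho> V V' t. \<rho> > 0 \<Longrightarrow> damped_mode \<mu> \<rho> V V' \<Longrightarrow> t \<ge> 0 \<Longrightarrow>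
      norm (V t) \<le> c1 * L (1 + t) * mode_weight b \<rho> (1 + t) * (norm (V 0) + norm (V' 0))"
    using damped_mode_bound[of \<mu>] unfolding L_def mode_weight_def b_def by blast
  obtain c2 where c2: "c2 > 0" and weight: "\<And>f \<tau>. f \<in> Lp 2 \<inter> Lp r \<Longrightarrow> \<tau> \<ge> 1 \<Longrightarrow>
      (\<lambda>\<xi>::'a. of_real (mode_weight b (norm \<xi>) \<tau>) * fourier f \<xi>) \<in> Lp 2 \<and>
      Lp_norm 2 (\<lambda>\<xi>. of_real (mode_weight b (norm \<xi>) \<tau>) * fourier f \<xi>)
        \<le> c2 * growth_rate DIM('a) r \<mu> \<tau> * (Lp_norm 2 f + Lp_norm r f)"
    using weighted_data_bound[OF r, of \<mu>] unfolding b_def by blast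
  obtain c3 where c3: "c3 \<ge> 0" and dsum: "\<And>\<tau> n. \<tau> \<ge> 1 \<Longrightarrow> (\<Sum>j<n. (1/2) ^ j * G (2 ^ Suc j * \<tau>)) \<le> c3 * G \<tau>"
    using growth_dyadic_sum[OF alpha] unfolding G_def L_def by blast
  \<comment> \<open>The two profile components contribute an error \<open>c1 * c2 * c3\<close> each;
    the further \<open>c1 * c2\<close> pays for the term with \<open>mu1\<close> in the time
    derivative.\<close>
  define C where "C = c1 * c2 * (2 * c3 + 1)"
  have C: "C > 0" "2 * (c1 * c2 * c3) \<le> C" "c1 * c2 \<le> C"
    using c1 c2 c3 by (auto simp: C_def algebra_simps add_pos_nonneg)
  show ?thesis
  proof (intro exI[of _ C] conjI allI impI C(1))
    fix u0 u1 :: "'a \<Rightarrow> complex" and u u'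
    assume data: "(u0, u1) \<in> data_space r" and sol: "wave_solution \<mu>1 \<mu>2 u0 u1 u u'"
    define v1 where "v1 = (\<lambda>x. complex_of_real (\<mu>1 / 2) * u0 x + u1 x)"
    define D where "D = data_norm r (u0, v1)"
    have u0: "u0 \<in> H1" "u0 \<in> Lp 2" "u0 \<in> Lp r" and u1: "u1 \<in> Lp 2" "u1 \<in> Lp r"
      using data by (auto simp: data_space_def H1_def)
    have v1: "v1 \<in> Lp 2" "v1 \<in> Lp r"
      unfolding v1_def using r by (intro Lp_lincomb u0 u1; simp)+
    have DN: "(Lp_norm 2 u0 + Lp_norm r u0) + (Lp_norm 2 v1 + Lp_norm r v1) \<le> D"
      using H1_gradient(2)[OF u0(1)] by (simp add: D_def data_norm_def)
    have D0: "D \<ge> 0" using DN by (rule order_trans[rotated]) (intro add_nonneg_nonneg Lp_norm_nonneg)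
    have uH: "u t \<in> H1" and uL: "u t \<in> Lp 2" and u'L: "u' t \<in> Lp 2" if "t \<ge> 0" for t
      using sol that by (auto simp: wave_solution_def cont_H1_def C1_L2_def)
    define v where "v t \<xi> = complex_of_real ((1 + t) powr (\<mu>1 / 2)) * fourier (u t) \<xi>" for t \<xi>
    define v' where "v' t \<xi> = complex_of_real ((1 + t) powr (\<mu>1 / 2)) *
        (fourier (u' t) \<xi> + complex_of_real (\<mu>1 / (2 * (1 + t))) * fourier (u t) \<xi>)" for t \<xi>
    obtain V V' where VV: "\<And>t. t \<ge> 0 \<Longrightarrow> AE \<xi> in lborel. V t \<xi> = v t \<xi> \<and> V' t \<xi> = v' t \<xi>"
      and ode: "AE \<xi> in lborel. V 0 \<xi> = fourier u0 \<xi> \<and> V' 0 \<xi> = fourier v1 \<xi>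
        \<and> damped_mode \<mu> (norm \<xi>) (\<lambda>t. V t \<xi>) (\<lambda>t. V' t \<xi>)"
      using wave_solution_modes[OF sol mu u0(2) u1(1)] unfolding v_def v'_def v1_def by blast
    have vL: "(\<lambda>\<xi>. complex_of_real (norm \<xi>) * v t \<xi>) \<in> Lp 2" "v t \<in> Lp 2" "v' t \<in> Lp 2" if t: "t \<ge> 0" for t
    proof -
      show "(\<lambda>\<xi>. complex_of_real (norm \<xi>) * v t \<xi>) \<in> Lp 2"
        using Lp2_cmult[OF H1_gradient(1)[OF uH[OF t]], of "complex_of_real ((1 + t) powr (\<mu>1 / 2))"]
        by (simp add: v_def mult.left_commute)
      show "v t \<in> Lp 2" unfolding v_def by (intro Lp2_cmult fourier_Lp2 uL t)
      show "v' t \<in> Lp 2" unfolding v'_def by (intro Lp2_cmult Lp2_add fourier_Lp2 uL u'L t)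
    qed
    \<comment> \<open>The bound for a mode at time \<open>tau - 1\<close> with the data inserted, as
      an element of \<open>Lp 2\<close>. It increases with \<open>tau\<close>, so
      \<open>\<Phi> (1 + t)\<close> bounds the mode on all of \<open>[0, t]\<close>.\<close>
    define \<Phi> where "\<Phi> \<tau> \<xi> = complex_of_real (c1 * L \<tau>) *
        complex_of_real (norm (complex_of_real (mode_weight b (norm \<xi>) \<tau>) * fourier u0 \<xi>)
          + norm (complex_of_real (mode_weight b (norm \<xi>) \<tau>) * fourier v1 \<xi>))" for \<tau> \<xi>
    have w0: "mode_weight b \<rho> \<tau> \<ge> 0" for \<rho> \<tau> by (simp add: mode_weight_def)
    have n\<Phi>: "norm (\<Phi> \<tau> \<xi>) = c1 * L \<tau> * mode_weight b (norm \<xi>) \<tau> * (norm (fourier u0 \<xi>) + norm (fourier v1 \<xi>))" for \<tau> \<xi>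
    proof -
      have "norm (\<Phi> \<tau> \<xi>) = (c1 * L \<tau>) * (mode_weight b (norm \<xi>) \<tau> * norm (fourier u0 \<xi>) + mode_weight b (norm \<xi>) \<tau> * norm (fourier v1 \<xi>))"
        unfolding \<Phi>_def using c1 L0[of \<tau>] w0[of "norm \<xi>" \<tau>]
        by (simp only: norm_mult norm_of_real abs_of_nonneg mult_nonneg_nonneg add_nonneg_nonneg norm_ge_zero less_imp_le)
      then show ?thesis by (simp add: algebra_simps)
    qed
    define g where "g \<tau> = c1 * c2 * D * G \<tau>" for \<tau>
    have \<Phi>L: "\<Phi> \<tau> \<in> Lp 2" and \<Phi>g: "Lp_norm 2 (\<Phi> \<tau>) \<le> g \<tau>" if \<tau>: "\<tau> \<ge> 1" for \<tau>
    proof -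
      note W0 = weight[OF IntI[OF u0(2,3)] \<tau>] and W1 = weight[OF IntI[OF v1] \<tau>]
      note N = Lp2_norm_add[OF conjunct1[OF W0] conjunct1[OF W1]]
      show "\<Phi> \<tau> \<in> Lp 2" unfolding \<Phi>_def by (rule Lp2_cmult[OF N(1)])
      define q where "q = growth_rate DIM('a) r \<mu> \<tau>"
      have q: "q \<ge> 0" using growth_rate_ge_1[OF \<tau>, of "DIM('a)" r \<mu>] by (simp add: q_def)
      have "Lp_norm 2 (\<Phi> \<tau>) \<le> (c1 * L \<tau>) * (c2 * q * (Lp_norm 2 u0 + Lp_norm r u0) + c2 * q * (Lp_norm 2 v1 + Lp_norm r v1))"
      proof -
        have cL: "0 \<le> c1 * L \<tau>" using c1 L0[of \<tau>] by simp
        show ?thesis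
          unfolding \<Phi>_def Lp_norm2_cmult norm_of_real abs_of_nonneg[OF cL] q_def
          by (intro mult_left_mono order_trans[OF N(2)] add_mono conjunct2[OF W0] conjunct2[OF W1] cL)
      qed
      also have "\<dots> = (c1 * L \<tau> * c2 * q) * ((Lp_norm 2 u0 + Lp_norm r u0) + (Lp_norm 2 v1 + Lp_norm r v1))"
        by (simp add: algebra_simps)
      also have "\<dots> \<le> (c1 * L \<tau> * c2 * q) * D"
        using c1 c2 L0[of \<tau>] q by (intro mult_left_mono DN) auto
      finally show "Lp_norm 2 (\<Phi> \<tau>) \<le> g \<tau>" by (simp add: g_def G_def q_def mult_ac)
    qed
    have g0: "g \<tau> \<ge> 0" if "\<tau> \<ge> 1" for \<tau> using c1 c2 D0 G0[OF that] by (simp add: g_def)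
    have hsum: "(\<Sum>j<n. (1/2) ^ j * g (2 ^ Suc j * \<tau>)) \<le> c3 * g \<tau>" if \<tau>: "\<tau> \<ge> 1" for \<tau> n
    proof -
      have "(\<Sum>j<n. (1/2) ^ j * g (2 ^ Suc j * \<tau>)) = c1 * c2 * D * (\<Sum>j<n. (1/2) ^ j * G (2 ^ Suc j * \<tau>))"
        unfolding g_def sum_distrib_left by (simp only: mult_ac)
      also have "\<dots> \<le> c1 * c2 * D * (c3 * G \<tau>)" using c1 c2 D0 by (intro mult_left_mono dsum \<tau>) auto
      finally show ?thesis by (simp add: g_def mult_ac)
    qed
    \<comment> \<open>Frequency 0 forms a null set; there neither the mode bounds nor division by
      \<open>norm \<xi>\<close> are available.\<close>
    have ne0: "AE \<xi> in lborel. \<xi> \<noteq> (0::'a)" by (rule AE_lborel_singleton)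
    have Vle: "AE \<xi> in lborel. \<forall>s t. 0 \<le> s \<longrightarrow> s \<le> t \<longrightarrow> norm (V s \<xi>) \<le> norm (\<Phi> (1 + t) \<xi>)"
      using ode ne0
    proof eventually_elim
      case (elim \<xi>)
      show ?case
      proof (intro allI impI)
        fix s t :: real assume st: "0 \<le> s" "s \<le> t"
        have "norm (V s \<xi>) \<le> c1 * L (1 + s) * mode_weight b (norm \<xi>) (1 + s) * (norm (fourier u0 \<xi>) + norm (fourier v1 \<xi>))"
          using mode[of "norm \<xi>" "\<lambda>t. V t \<xi>" "\<lambda>t. V' t \<xi>" s] elim st by auto
        also have "\<dots> \<le> c1 * L (1 + t) * mode_weight b (norm \<xi>) (1 + t) * (norm (fourier u0 \<xi>) + norm (fourier v1 \<xi>))"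
          using st b c1 L0 w0 by (intro mult_right_mono mult_mono Lmono mode_weight_mono) auto
        finally show "norm (V s \<xi>) \<le> norm (\<Phi> (1 + t) \<xi>)" unfolding n\<Phi> .
      qed
    qed
    have inc: "AE \<xi> in lborel. \<forall>s t. 0 \<le> s \<longrightarrow> s \<le> t \<longrightarrow>
        norm (profile_A (norm \<xi>) (V t \<xi>) (V' t \<xi>) t - profile_A (norm \<xi>) (V s \<xi>) (V' s \<xi>) s)
          \<le> \<bar>\<mu>\<bar> * norm (\<Phi> (1 + t) \<xi>) * (1 / (1 + s) - 1 / (1 + t)) \<and>
        norm (profile_B (norm \<xi>) (V t \<xi>) (V' t \<xi>) t - profile_B (norm \<xi>) (V s \<xi>) (V' s \<xi>) s)
          \<le> \<bar>\<mu>\<bar> * norm (\<Phi> (1 + t) \<xi>) * (1 / (1 + s) - 1 / (1 + t))"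
      using ode Vle
    proof eventually_elim
      case (elim \<xi>)
      then have o: "damped_mode \<mu> (norm \<xi>) (\<lambda>t. V t \<xi>) (\<lambda>t. V' t \<xi>)" by blast
      show ?case
      proof (intro allI impI)
        fix s t :: real assume st: "0 \<le> s" "s \<le> t"
        have "norm (V x \<xi>) \<le> norm (\<Phi> (1 + t) \<xi>)" if "s \<le> x" "x \<le> t" for x
          using elim(2) st that by auto
        from profile_increment[OF o st this] show
          "norm (profile_A (norm \<xi>) (V t \<xi>) (V' t \<xi>) t - profile_A (norm \<xi>) (V s \<xi>) (V' s \<xi>) s)
            \<le> \<bar>\<mu>\<bar> * norm (\<Phi> (1 + t) \<xi>) * (1 / (1 + s) - 1 / (1 + t)) \<and>
          norm (profile_B (norm \<xi>) (V t \<xi>) (V' t \<xi>) t - profile_B (norm \<xi>) (V s \<xi>) (V' s \<xi>) s)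
            \<le> \<bar>\<mu>\<bar> * norm (\<Phi> (1 + t) \<xi>) * (1 / (1 + s) - 1 / (1 + t))" by blast
      qed
    qed
    have tail: "AE \<xi> in lborel. \<exists>S\<ge>0. \<forall>s t. 0 \<le> s \<longrightarrow> s \<le> t \<longrightarrow>
        norm (profile_A (norm \<xi>) (V t \<xi>) (V' t \<xi>) t - profile_A (norm \<xi>) (V s \<xi>) (V' s \<xi>) s) \<le> S * (1 / (1 + s) - 1 / (1 + t)) \<and>
        norm (profile_B (norm \<xi>) (V t \<xi>) (V' t \<xi>) t - profile_B (norm \<xi>) (V s \<xi>) (V' s \<xi>) s) \<le> S * (1 / (1 + s) - 1 / (1 + t))"
      using ode ne0
    proof eventually_elim
      case (elim \<xi>)
      then have o: "damped_mode \<mu> (norm \<xi>) (\<lambda>t. V t \<xi>) (\<lambda>t. V' t \<xi>)" and "norm \<xi> > 0" by auto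
      from damped_mode_bounded[OF this] obtain S where S: "S \<ge> 0" "\<And>t. t \<ge> 0 \<Longrightarrow> norm (V t \<xi>) \<le> S" by blast
      show ?case
      proof (intro exI[of _ "\<bar>\<mu>\<bar> * S"] conjI[of "0 \<le> \<bar>\<mu>\<bar> * S"] allI impI)
        show "0 \<le> \<bar>\<mu>\<bar> * S" using S by simp
        fix s t :: real assume st: "0 \<le> s" "s \<le> t"
        have "norm (V x \<xi>) \<le> S" if "s \<le> x" "x \<le> t" for x using S(2) st that by simp
        from profile_increment[OF o st this] show
          "norm (profile_A (norm \<xi>) (V t \<xi>) (V' t \<xi>) t - profile_A (norm \<xi>) (V s \<xi>) (V' s \<xi>) s) \<le> \<bar>\<mu>\<bar> * S * (1 / (1 + s) - 1 / (1 + t)) \<and>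
          norm (profile_B (norm \<xi>) (V t \<xi>) (V' t \<xi>) t - profile_B (norm \<xi>) (V s \<xi>) (V' s \<xi>) s) \<le> \<bar>\<mu>\<bar> * S * (1 / (1 + s) - 1 / (1 + t))"
          by blast
      qed
    qed
    have incA: "AE \<xi> in lborel. \<forall>s t. 0 \<le> s \<longrightarrow> s \<le> t \<longrightarrow>
        norm (profile_A (norm \<xi>) (V t \<xi>) (V' t \<xi>) t - profile_A (norm \<xi>) (V s \<xi>) (V' s \<xi>) s)
          \<le> \<bar>\<mu>\<bar> * norm (\<Phi> (1 + t) \<xi>) * (1 / (1 + s) - 1 / (1 + t))"
      by (rule eventually_mono[OF inc]) blast
    have incB: "AE \<xi> in lborel. \<forall>s t. 0 \<le> s \<longrightarrow> s \<le> t \<longrightarrow>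
        norm (profile_B (norm \<xi>) (V t \<xi>) (V' t \<xi>) t - profile_B (norm \<xi>) (V s \<xi>) (V' s \<xi>) s)
          \<le> \<bar>\<mu>\<bar> * norm (\<Phi> (1 + t) \<xi>) * (1 / (1 + s) - 1 / (1 + t))"
      by (rule eventually_mono[OF inc]) blast
    have tailA: "AE \<xi> in lborel. \<exists>S\<ge>0. \<forall>s t. 0 \<le> s \<longrightarrow> s \<le> t \<longrightarrow>
        norm (profile_A (norm \<xi>) (V t \<xi>) (V' t \<xi>) t - profile_A (norm \<xi>) (V s \<xi>) (V' s \<xi>) s) \<le> S * (1 / (1 + s) - 1 / (1 + t))"
      by (rule eventually_mono[OF tail]) blast
    have tailB: "AE \<xi> in lborel. \<exists>S\<ge>0. \<forall>s t. 0 \<le> s \<longrightarrow> s \<le> t \<longrightarrow>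
        norm (profile_B (norm \<xi>) (V t \<xi>) (V' t \<xi>) t - profile_B (norm \<xi>) (V s \<xi>) (V' s \<xi>) s) \<le> S * (1 / (1 + s) - 1 / (1 + t))"
      by (rule eventually_mono[OF tail]) blast
    \<comment> \<open>\<open>A\<close> and \<open>B\<close> are built from the chosen transforms and
      so are measurable; at each time they agree almost everywhere with the profiles of
      \<open>V\<close>.\<close>
    define A where "A t \<xi> = profile_A (norm \<xi>) (v t \<xi>) (v' t \<xi>) t" for t \<xi>
    define B where "B t \<xi> = profile_B (norm \<xi>) (v t \<xi>) (v' t \<xi>) t" for t \<xi>
    have AL: "A t \<in> Lp 2" and BL: "B t \<in> Lp 2" if "t \<ge> 0" for t
      unfolding A_def[abs_def] B_def[abs_def] using profile_Lp2[OF vL[OF that]] by auto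
    have "\<exists>Ap \<in> Lp 2. \<forall>t\<ge>0. Lp_norm 2 (\<lambda>\<xi>. A t \<xi> - Ap \<xi>) \<le> \<bar>\<mu>\<bar> * (c3 * g (1 + t)) / (1 + t)"
    proof (rule dyadic_scattering[where X="\<lambda>t \<xi>. profile_A (norm \<xi>) (V t \<xi>) (V' t \<xi>) t" and \<Phi>=\<Phi> and g=g and h="\<lambda>\<tau>. c3 * g \<tau>"])
      show "AE \<xi> in lborel. profile_A (norm \<xi>) (V t \<xi>) (V' t \<xi>) t = A t \<xi>" if "t \<ge> 0" for t
        using VV[OF that] by eventually_elim (simp add: A_def)
    qed ((rule AL incA tailA \<Phi>L \<Phi>g hsum abs_ge_zero; assumption)+)
    then obtain Ap where ApL: "Ap \<in> Lp 2"
      and Ap: "\<And>t. t \<ge> 0 \<Longrightarrow> Lp_norm 2 (\<lambda>\<xi>. A t \<xi> - Ap \<xi>) \<le> \<bar>\<mu>\<bar> * (c3 * g (1 + t)) / (1 + t)" by blast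
    have "\<exists>Bp \<in> Lp 2. \<forall>t\<ge>0. Lp_norm 2 (\<lambda>\<xi>. B t \<xi> - Bp \<xi>) \<le> \<bar>\<mu>\<bar> * (c3 * g (1 + t)) / (1 + t)"
    proof (rule dyadic_scattering[where X="\<lambda>t \<xi>. profile_B (norm \<xi>) (V t \<xi>) (V' t \<xi>) t" and \<Phi>=\<Phi> and g=g and h="\<lambda>\<tau>. c3 * g \<tau>"])
      show "AE \<xi> in lborel. profile_B (norm \<xi>) (V t \<xi>) (V' t \<xi>) t = B t \<xi>" if "t \<ge> 0" for t
        using VV[OF that] by eventually_elim (simp add: B_def)
    qed ((rule BL incB tailB \<Phi>L \<Phi>g hsum abs_ge_zero; assumption)+)
    then obtain Bp where BpL: "Bp \<in> Lp 2"
      and Bp: "\<And>t. t \<ge> 0 \<Longrightarrow> Lp_norm 2 (\<lambda>\<xi>. B t \<xi> - Bp \<xi>) \<le> \<bar>\<mu>\<bar> * (c3 * g (1 + t)) / (1 + t)" by blast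
    \<comment> \<open>The first profile component carries a factor \<open>norm \<xi>\<close>.
      Dividing its limit by this factor gives an element of \<open>Hdot1\<close>, which need not be
      square integrable itself; the limit of the second component is a transform to be
      inverted.\<close>
    define F where "F \<xi> = Ap \<xi> / complex_of_real (norm \<xi>)" for \<xi>
    define k where "k = inv_fourier Bp"
    note hk = has_fourier_inv_fourier[OF BpL, folded k_def]
    have kL: "k \<in> Lp 2" using has_fourierD(1)[OF hk] .
    have fk: "AE \<xi> in lborel. fourier k \<xi> = Bp \<xi>" by (rule fourier_eq_AE[OF hk])
    note [measurable] = Lp_measurable[OF ApL] Lp_measurable[OF BpL] Lp_measurable[OF fourier_Lp2[OF kL]]
    have Fm [measurable]: "F \<in> borel_measurable borel" unfolding F_def[abs_def] by measurable
    have FH: "F \<in> Hdot1" unfolding Hdot1_def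
      by (auto intro!: Lp2_mono(1)[OF ApL] simp: F_def norm_mult norm_divide)
    define E where "E t \<xi> = complex_of_real (norm (A t \<xi> - Ap \<xi>) + norm (B t \<xi> - Bp \<xi>))" for t \<xi>
    have EL: "E t \<in> Lp 2" and En: "Lp_norm 2 (E t) \<le> 2 * (\<bar>\<mu>\<bar> * (c3 * g (1 + t)) / (1 + t))" if t: "t \<ge> 0" for t
      unfolding E_def[abs_def] using Lp2_norm_add[OF Lp2_diff[OF AL[OF t] ApL] Lp2_diff[OF BL[OF t] BpL]] Ap[OF t] Bp[OF t]
      by auto
    have rot: "norm (p *\<^sub>R x + q *\<^sub>R y) \<le> norm x + norm y" if "\<bar>p\<bar> \<le> 1" "\<bar>q\<bar> \<le> 1" for p q :: real and x y :: complex
    proof -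
      have "norm (p *\<^sub>R x + q *\<^sub>R y) \<le> \<bar>p\<bar> * norm x + \<bar>q\<bar> * norm y"
        using norm_triangle_ineq[of "p *\<^sub>R x" "q *\<^sub>R y"] by simp
      also have "\<dots> \<le> 1 * norm x + 1 * norm y" using that by (intro add_mono mult_right_mono) auto
      finally show ?thesis by simp
    qed
    have "Hdot1_norm (\<lambda>\<xi>. fourier (u t) \<xi> - complex_of_real ((1 + t) powr (- \<mu>1 / 2)) * fst (wave_flow t (F, k)) \<xi>)
         \<le> C * \<bar>\<mu>\<bar> * D * Theta DIM('a) r \<mu>1 \<mu> t \<and>
       Lp_norm 2 (\<lambda>x. u' t x - complex_of_real ((1 + t) powr (- \<mu>1 / 2)) * snd (wave_flow t (F, k)) x)
         \<le> C * (\<bar>\<mu>\<bar> + \<bar>\<mu>1\<bar>) * D * Theta DIM('a) r \<mu>1 \<mu> t" if t: "t \<ge> 0" for t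
    proof -
      define c where "c = (1 + t) powr (- \<mu>1 / 2)"
      have c: "c > 0" using t by (simp add: c_def)
      have cc: "c * (1 + t) powr (\<mu>1 / 2) = 1" using t unfolding c_def powr_add[symmetric] by simp
      have cc': "complex_of_real c * complex_of_real ((1 + t) powr (\<mu>1 / 2)) = 1"
        unfolding of_real_mult[symmetric] cc by simp
      have \<tau>: "1 + t \<ge> 1" using t by simp
      have Th: "Theta DIM('a) r \<mu>1 \<mu> t = c * (G (1 + t) / (1 + t))"
        unfolding Theta_eq[OF t] c_def G_def L_def ..
      note [measurable] = Lp_measurable[OF fourier_Lp2[OF uL[OF t]]] Lp_measurable[OF fourier_Lp2[OF u'L[OF t]]]
      have fu: "fourier (u t) \<xi> = complex_of_real c * v t \<xi>" for \<xi>
        unfolding v_def mult.assoc[symmetric] cc' by simp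
      \<comment> \<open>Undoing the substitution for the time derivative leaves the extra term
        \<open>mu1/(2(1+t)) u\<close>; it obeys the same decay as the error and is the source of
        \<open>|mu1|\<close> in the second estimate.\<close>
      have fu': "fourier (u' t) \<xi> = complex_of_real c * v' t \<xi> - complex_of_real (\<mu>1 / (2 * (1 + t))) * fourier (u t) \<xi>" for \<xi>
        unfolding v'_def mult.assoc[symmetric] cc' by simp
      have gT: "c * (\<bar>\<mu>\<bar> * (c3 * g (1 + t)) / (1 + t)) = c1 * c2 * c3 * \<bar>\<mu>\<bar> * D * Theta DIM('a) r \<mu>1 \<mu> t"
        unfolding Th g_def by simp
      have T0: "Theta DIM('a) r \<mu>1 \<mu> t \<ge> 0" unfolding Th using c G0[OF \<tau>] t by simp
      have nE: "norm (E t \<xi>) = norm (A t \<xi> - Ap \<xi>) + norm (B t \<xi> - Bp \<xi>)" for \<xi>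
        unfolding E_def norm_of_real by simp
      have cE: "Lp_norm 2 (\<lambda>\<xi>. complex_of_real c * E t \<xi>) \<le> 2 * (c1 * c2 * c3) * \<bar>\<mu>\<bar> * D * Theta DIM('a) r \<mu>1 \<mu> t"
      proof -
        have "Lp_norm 2 (\<lambda>\<xi>. complex_of_real c * E t \<xi>) \<le> c * (2 * (\<bar>\<mu>\<bar> * (c3 * g (1 + t)) / (1 + t)))"
          unfolding Lp_norm2_cmult using c En[OF t] by (simp only: norm_of_real abs_of_pos mult_left_mono less_imp_le)
        also have "\<dots> = 2 * (c * (\<bar>\<mu>\<bar> * (c3 * g (1 + t)) / (1 + t)))" by simp
        finally show ?thesis unfolding gT by (simp add: mult_ac)
      qed
      have muD: "0 \<le> \<bar>\<mu>\<bar> * D * Theta DIM('a) r \<mu>1 \<mu> t" "0 \<le> \<bar>\<mu>1\<bar> * D * Theta DIM('a) r \<mu>1 \<mu> t"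
        using D0 T0 by (auto intro!: mult_nonneg_nonneg)
      have "Hdot1_norm (\<lambda>\<xi>. fourier (u t) \<xi> - complex_of_real c * fst (wave_flow t (F, k)) \<xi>)
          \<le> Lp_norm 2 (\<lambda>\<xi>. complex_of_real c * E t \<xi>)"
        unfolding Hdot1_norm_def
      proof (rule Lp2_mono(2)[OF Lp2_cmult[OF EL[OF t]]])
        show "(\<lambda>\<xi>. complex_of_real (norm \<xi>) * (fourier (u t) \<xi> - complex_of_real c * fst (wave_flow t (F, k)) \<xi>)) \<in> borel_measurable borel"
          unfolding wave_flow_def by simp
        show "AE \<xi> in lborel. norm (complex_of_real (norm \<xi>) * (fourier (u t) \<xi> - complex_of_real c * fst (wave_flow t (F, k)) \<xi>))
            \<le> norm (complex_of_real c * E t \<xi>)"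
          using fk ne0
        proof eventually_elim
          case (elim \<xi>)
          define \<rho> where "\<rho> = norm \<xi>"
          have \<rho>: "\<rho> \<noteq> 0" using elim by (simp add: \<rho>_def)
          \<comment> \<open>The mode and the free wave arise from \<open>(A t, B t)\<close> and
            \<open>(Ap, Bp)\<close> by the same rotation, so their difference is the rotated
            difference of the profiles.\<close>
          have r1: "complex_of_real \<rho> * v t \<xi> = cos (\<rho> * t) *\<^sub>R A t \<xi> + sin (\<rho> * t) *\<^sub>R B t \<xi>"
            using profile_inverse(1)[of \<rho> "v t \<xi>" t "v' t \<xi>"] by (simp add: A_def B_def \<rho>_def scaleR_conv_of_real)
          have r2: "complex_of_real \<rho> * fst (wave_flow t (F, k)) \<xi> = cos (\<rho> * t) *\<^sub>R Ap \<xi> + sin (\<rho> * t) *\<^sub>R Bp \<xi>"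
            using \<rho> elim(1) unfolding wave_flow_def F_def \<rho>_def[symmetric]
            by (simp add: scaleR_conv_of_real distrib_left mult.commute[of t] \<rho>_def[symmetric])
          have "complex_of_real \<rho> * (fourier (u t) \<xi> - complex_of_real c * fst (wave_flow t (F, k)) \<xi>)
            = complex_of_real c * (complex_of_real \<rho> * v t \<xi> - complex_of_real \<rho> * fst (wave_flow t (F, k)) \<xi>)"
            unfolding fu by (simp add: algebra_simps)
          also have "\<dots> = complex_of_real c * (cos (\<rho> * t) *\<^sub>R (A t \<xi> - Ap \<xi>) + sin (\<rho> * t) *\<^sub>R (B t \<xi> - Bp \<xi>))"
            unfolding r1 r2 by (simp add: algebra_simps)
          finally show ?case
            unfolding \<rho>_def[symmetric] norm_mult[of "complex_of_real c"] nE
            by (simp only: norm_mult) (intro mult_left_mono rot norm_ge_zero abs_cos_le_one abs_sin_le_one)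
        qed
      qed
      also have "\<dots> \<le> 2 * (c1 * c2 * c3) * \<bar>\<mu>\<bar> * D * Theta DIM('a) r \<mu>1 \<mu> t" by (rule cE)
      also have "\<dots> \<le> C * \<bar>\<mu>\<bar> * D * Theta DIM('a) r \<mu>1 \<mu> t"
        using mult_right_mono[OF C(2) muD(1)] by (simp add: mult.assoc)
      finally have 1: "Hdot1_norm (\<lambda>\<xi>. fourier (u t) \<xi> - complex_of_real c * fst (wave_flow t (F, k)) \<xi>)
          \<le> C * \<bar>\<mu>\<bar> * D * Theta DIM('a) r \<mu>1 \<mu> t" .
      define \<Psi> where "\<Psi> \<xi> = - complex_of_real (norm \<xi> * sin (t * norm \<xi>)) * F \<xi> + complex_of_real (cos (t * norm \<xi>)) * fourier k \<xi>" for \<xi>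
      have \<Psi>m [measurable]: "\<Psi> \<in> borel_measurable borel" unfolding \<Psi>_def[abs_def] by simp
      have \<Psi>eq: "AE \<xi> in lborel. \<Psi> \<xi> = (- sin (norm \<xi> * t)) *\<^sub>R Ap \<xi> + cos (norm \<xi> * t) *\<^sub>R Bp \<xi>"
        using fk ne0 by eventually_elim (simp add: \<Psi>_def F_def scaleR_conv_of_real mult.commute[of t])
      have \<Psi>L: "\<Psi> \<in> Lp 2"
      proof (rule Lp2_mono(1)[OF Lp2_norm_add(1)[OF ApL BpL] \<Psi>m])
        show "AE \<xi> in lborel. norm (\<Psi> \<xi>) \<le> norm (complex_of_real (norm (Ap \<xi>) + norm (Bp \<xi>)))"
          using \<Psi>eq
        proof eventually_elim
          case (elim \<xi>)
          then show ?case
            using rot[of "- sin (norm \<xi> * t)" "cos (norm \<xi> * t)" "Ap \<xi>" "Bp \<xi>"] by (simp only: norm_of_real) simp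
        qed
      qed
      have snd: "snd (wave_flow t (F, k)) = inv_fourier \<Psi>" by (simp add: wave_flow_def \<Psi>_def[abs_def])
      \<comment> \<open>Isometry moves the estimate to the Fourier side, where
        \<open>inv_fourier \<Psi>\<close> becomes \<open>\<Psi>\<close> again.\<close>
      have "has_fourier (\<lambda>x. 1 * u' t x + (- complex_of_real c) * inv_fourier \<Psi> x) (\<lambda>\<xi>. 1 * fourier (u' t) \<xi> + (- complex_of_real c) * \<Psi> \<xi>)"
        by (intro has_fourier_lincomb has_fourier_fourier has_fourier_inv_fourier \<Psi>L u'L t)
      from has_fourier_norm[OF this]
      have "Lp_norm 2 (\<lambda>x. u' t x - complex_of_real c * snd (wave_flow t (F, k)) x) = Lp_norm 2 (\<lambda>\<xi>. fourier (u' t) \<xi> - complex_of_real c * \<Psi> \<xi>)"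
        by (simp add: snd)
      also have "\<dots> \<le> Lp_norm 2 (\<lambda>\<xi>. complex_of_real (norm (complex_of_real c * E t \<xi>)
           + norm (complex_of_real (\<mu>1 / (2 * (1 + t)) * c) * \<Phi> (1 + t) \<xi>)))"
      proof (rule Lp2_mono(2)[OF Lp2_norm_add(1)[OF Lp2_cmult[OF EL[OF t]] Lp2_cmult[OF \<Phi>L[OF \<tau>]]]])
        show "(\<lambda>\<xi>. fourier (u' t) \<xi> - complex_of_real c * \<Psi> \<xi>) \<in> borel_measurable borel" by simp
        show "AE \<xi> in lborel. norm (fourier (u' t) \<xi> - complex_of_real c * \<Psi> \<xi>)
            \<le> norm (complex_of_real (norm (complex_of_real c * E t \<xi>) + norm (complex_of_real (\<mu>1 / (2 * (1 + t)) * c) * \<Phi> (1 + t) \<xi>)))"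
          using \<Psi>eq VV[OF t] Vle
        proof eventually_elim
          case (elim \<xi>)
          define \<rho> where "\<rho> = norm \<xi>"
          have r: "v' t \<xi> = - sin (\<rho> * t) *\<^sub>R A t \<xi> + cos (\<rho> * t) *\<^sub>R B t \<xi>"
            using profile_inverse(2)[of "v' t \<xi>" \<rho> t "v t \<xi>"] by (simp add: A_def B_def \<rho>_def)
          have "fourier (u' t) \<xi> - complex_of_real c * \<Psi> \<xi>
            = complex_of_real c * (- sin (\<rho> * t) *\<^sub>R (A t \<xi> - Ap \<xi>) + cos (\<rho> * t) *\<^sub>R (B t \<xi> - Bp \<xi>))
              - complex_of_real (\<mu>1 / (2 * (1 + t))) * (complex_of_real c * v t \<xi>)"
            unfolding fu' fu elim(1) \<rho>_def[symmetric] r by (simp add: algebra_simps)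
          also have "norm \<dots> \<le> norm (complex_of_real c * (- sin (\<rho> * t) *\<^sub>R (A t \<xi> - Ap \<xi>) + cos (\<rho> * t) *\<^sub>R (B t \<xi> - Bp \<xi>)))
              + norm (complex_of_real (\<mu>1 / (2 * (1 + t))) * (complex_of_real c * v t \<xi>))"
            by (rule norm_triangle_ineq4)
          also have "\<dots> \<le> norm (complex_of_real c * E t \<xi>) + norm (complex_of_real (\<mu>1 / (2 * (1 + t)) * c) * \<Phi> (1 + t) \<xi>)"
          proof (rule add_mono)
            show "norm (complex_of_real c * (- sin (\<rho> * t) *\<^sub>R (A t \<xi> - Ap \<xi>) + cos (\<rho> * t) *\<^sub>R (B t \<xi> - Bp \<xi>))) \<le> norm (complex_of_real c * E t \<xi>)"
              unfolding norm_mult[of "complex_of_real c"] nE by (intro mult_left_mono rot) auto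
            have "norm (v t \<xi>) \<le> norm (\<Phi> (1 + t) \<xi>)" using elim(2,3) t by auto
            then show "norm (complex_of_real (\<mu>1 / (2 * (1 + t))) * (complex_of_real c * v t \<xi>))
              \<le> norm (complex_of_real (\<mu>1 / (2 * (1 + t)) * c) * \<Phi> (1 + t) \<xi>)"
              unfolding of_real_mult mult.assoc norm_mult by (intro mult_left_mono) auto
          qed
          finally show ?case unfolding norm_of_real by (rule order_trans[OF _ abs_ge_self])
        qed
      qed
      also have "\<dots> \<le> Lp_norm 2 (\<lambda>\<xi>. complex_of_real c * E t \<xi>) + Lp_norm 2 (\<lambda>\<xi>. complex_of_real (\<mu>1 / (2 * (1 + t)) * c) * \<Phi> (1 + t) \<xi>)"
        by (rule Lp2_norm_add(2)[OF Lp2_cmult[OF EL[OF t]] Lp2_cmult[OF \<Phi>L[OF \<tau>]]])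
      also have "Lp_norm 2 (\<lambda>\<xi>. complex_of_real (\<mu>1 / (2 * (1 + t)) * c) * \<Phi> (1 + t) \<xi>)
          \<le> c1 * c2 * (\<bar>\<mu>1\<bar> * D * Theta DIM('a) r \<mu>1 \<mu> t)"
      proof -
        have "\<bar>\<mu>1 / (2 * (1 + t)) * c\<bar> = \<bar>\<mu>1\<bar> / (2 * (1 + t)) * c" using c t by (simp add: abs_mult)
        also have "\<dots> \<le> \<bar>\<mu>1\<bar> / (1 + t) * c" using c t by (intro mult_right_mono divide_left_mono) auto
        finally have "Lp_norm 2 (\<lambda>\<xi>. complex_of_real (\<mu>1 / (2 * (1 + t)) * c) * \<Phi> (1 + t) \<xi>) \<le> \<bar>\<mu>1\<bar> / (1 + t) * c * g (1 + t)"
          unfolding Lp_norm2_cmult norm_of_real using \<Phi>g[OF \<tau>] c t by (intro mult_mono) auto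
        then show ?thesis unfolding Th g_def by (simp add: mult_ac)
      qed
      also have "c1 * c2 * (\<bar>\<mu>1\<bar> * D * Theta DIM('a) r \<mu>1 \<mu> t) \<le> C * (\<bar>\<mu>1\<bar> * D * Theta DIM('a) r \<mu>1 \<mu> t)"
        by (rule mult_right_mono[OF C(3) muD(2)])
      also have "Lp_norm 2 (\<lambda>\<xi>. complex_of_real c * E t \<xi>) \<le> C * (\<bar>\<mu>\<bar> * D * Theta DIM('a) r \<mu>1 \<mu> t)"
        using order_trans[OF cE] mult_right_mono[OF C(2) muD(1)] by (simp add: mult.assoc)
      finally have 2: "Lp_norm 2 (\<lambda>x. u' t x - complex_of_real c * snd (wave_flow t (F, k)) x)
         \<le> C * (\<bar>\<mu>\<bar> + \<bar>\<mu>1\<bar>) * D * Theta DIM('a) r \<mu>1 \<mu> t"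
        by (simp add: algebra_simps)
      show ?thesis using 1 2 unfolding c_def by blast
    qed
    then show "\<exists>vp \<in> Hdot1 \<times> Lp 2. \<forall>t\<ge>0.
       Hdot1_norm (\<lambda>\<xi>. fourier (u t) \<xi>
           - complex_of_real ((1 + t) powr (- \<mu>1 / 2)) * fst (wave_flow t vp) \<xi>)
         \<le> C * \<bar>\<mu>\<bar> * data_norm r (u0, \<lambda>x. complex_of_real (\<mu>1 / 2) * u0 x + u1 x)
             * Theta DIM('a) r \<mu>1 \<mu> t \<and>
       Lp_norm 2 (\<lambda>x. u' t x
           - complex_of_real ((1 + t) powr (- \<mu>1 / 2)) * snd (wave_flow t vp) x)
         \<le> C * (\<bar>\<mu>\<bar> + \<bar>\<mu>1\<bar>) * data_norm r (u0, \<lambda>x. complex_of_real (\<mu>1 / 2) * u0 x + u1 x)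
             * Theta DIM('a) r \<mu>1 \<mu> t"
      using FH kL unfolding D_def v1_def by (intro bexI[of _ "(F, k)"]) auto
  qed
qed



end
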